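(* Let $\varphi\in L^2(0,1)$, regarded as a $2$-periodic odd function on $\mathbb{R}$, let $\varphi_n(x)=\varphi(nx)$ for $n\in\mathbb{N}$, and set $D=S\varphi$. The system $\{\varphi_n\}_n$ is an orthonormal sequence in $L^2(0,1)$ if and only if $D\in\mathcal{H}^\infty$ and for almost all $\gamma\in\Xi$ and almost all $t\in\mathbb{R}$ we have $|D^\gamma(it)|=1$.
   Context: All spaces are over $\mathbb{C}$. Let $e_n(x)=\sqrt2\sin(\pi nx)$, an orthonormal basis of $L^2(0,1)$. $\mathcal{H}^2$ is the Hilbert space of Dirichlet series $\sum_{n\ge1} a_n n^{-s}$ with $\|\cdot\|_{\mathcal{H}^2}=(\sum_n|a_n|^2)^{1/2}<\infty$, and $S:L^2(0,1)\to\mathcal{H}^2$ is the isometric isomorphism $S(\sum c_n e_n)=\sum c_n n^{-s}$. $\mathcal{H}^\infty$ is the space of Dirichlet series that define a bounded holomorphic function on $\{s\in\mathbb{C}:\operatorname{Re}s>0\}$. $\Xi$ is the set of characters, i.e. maps $\gamma:\mathbb{N}\to\mathbb{C}$ with $\gamma(mn)=\gamma(m)\gamma(n)$ and $|\gamma(n)|=1$ for all $m,n$; it is identified with the infinite polytorus $\mathbb{T}^\infty$ (countably infinite product of unit circles, with normalized Haar measure) through $\gamma\mapsto(\gamma(p_1),\gamma(p_2),\dots)$, where $p_1<p_2<\cdots$ are the primes; "almost all $\gamma$" refers to this measure. For $D=\sum a_nn^{-s}$ and $\gamma\in\Xi$, $D^\gamma(s)=\sum a_n\gamma(n)n^{-s}$;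 if $D\in\mathcal{H}^\infty$ then $D^\gamma\in\mathcal{H}^\infty$ for all $\gamma$. For $t\in\mathbb{R}$, $D^\gamma(it):=\lim_{\sigma\to0^+}D^\gamma(\sigma+it)$; for $D\in\mathcal{H}^\infty$ and every $\gamma$ this limit exists for almost all $t$. *)

theory Defs
  imports "HOL-Probability.Probability" "HOL-Computational_Algebra.Primes"
begin

text \<open>Elements of \<open>L\<^sup>2(0,1)\<close> are given by representatives, whose values outside \<open>(0,1)\<close> are
  irrelevant.\<close>

definition L2_unit :: "(real \<Rightarrow> complex) set" where
  "L2_unit = {f. f \<in> borel_measurable (lebesgue_on {0<..<1}) \<and>
                 integrable (lebesgue_on {0<..<1}) (\<lambda>x. (cmod (f x))\<^sup>2)}"

definition L2_inner :: "(real \<Rightarrow> complex) \<Rightarrow> (real \<Rightarrow> complex) \<Rightarrow> complex" where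
  "L2_inner f g = (LINT x|lebesgue_on {0<..<1}. f x * cnj (g x))"

text \<open>Sequences are indexed by the positive integers; the term at index \<open>0\<close> is ignored.\<close>

definition orthonormal_sequence :: "(nat \<Rightarrow> real \<Rightarrow> complex) \<Rightarrow> bool" where
  "orthonormal_sequence u \<longleftrightarrow> (\<forall>n\<ge>1. u n \<in> L2_unit) \<and>
     (\<forall>m\<ge>1. \<forall>n\<ge>1. L2_inner (u m) (u n) = (if m = n then 1 else 0))"

text \<open>The \<open>2\<close>-periodic odd function on the real line that agrees with \<open>f\<close> on \<open>(0,1)\<close>.  The point \<open>y\<close>
  is the representative of \<open>x\<close> modulo \<open>2\<close> in \<open>[-1,1)\<close>; oddness and periodicity force the
  value \<open>0\<close> at the integers.\<close>

definition odd_periodic :: "(real \<Rightarrow> complex) \<Rightarrow> real \<Rightarrow> complex" where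
  "odd_periodic f x =
     (let y = x - 2 * of_int \<lfloor>(x + 1) / 2\<rfloor>
      in if 0 < y then f y else if -1 < y \<and> y < 0 then - f (- y) else 0)"

lemma odd_periodic_eq:
  assumes "0 < x" "x < 1"
  shows "odd_periodic f x = f x"
proof -
  have "\<lfloor>(x + 1) / 2\<rfloor> = 0"
    using assms by (intro floor_unique) auto
  thus ?thesis
    using assms by (simp add: odd_periodic_def)
qed

lemma odd_periodic_periodic: "odd_periodic f (x + 2) = odd_periodic f x"
proof -
  have "(x + 2 + 1) / 2 = (x + 1) / 2 + 1"
    by (simp add: field_simps)
  hence "\<lfloor>(x + 2 + 1) / 2\<rfloor> = \<lfloor>(x + 1) / 2\<rfloor> + 1"
    by (simp only:) linarith
  thus ?thesis
    by (simp add: odd_periodic_def)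
qed

lemma odd_periodic_odd: "odd_periodic f (- x) = - odd_periodic f x"
proof -
  define k where "k = \<lfloor>(x + 1) / 2\<rfloor>"
  define y where "y = x - 2 * of_int k"
  have "of_int k \<le> (x + 1) / 2" "(x + 1) / 2 < of_int k + 1"
    unfolding k_def by (rule of_int_floor_le, rule real_of_int_floor_add_one_gt)
  hence y: "-1 \<le> y" "y < 1"
    unfolding y_def by (simp_all add: field_simps)
  have x: "odd_periodic f x = (if 0 < y then f y else if -1 < y \<and> y < 0 then - f (- y) else 0)"
    by (simp add: odd_periodic_def y_def k_def Let_def)
  show ?thesis
  proof (cases "y = -1")
    case True
    hence "\<lfloor>(- x + 1) / 2\<rfloor> = - k + 1"
      unfolding y_def by (intro floor_unique) auto
    hence "- x - 2 * of_int \<lfloor>(- x + 1) / 2\<rfloor> = -1"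
      using True by (simp add: y_def)
    with True show ?thesis
      by (simp add: x odd_periodic_def [of f "- x"] Let_def)
  next
    case False
    hence "\<lfloor>(- x + 1) / 2\<rfloor> = - k"
      using y unfolding y_def by (intro floor_unique) auto
    hence "- x - 2 * of_int \<lfloor>(- x + 1) / 2\<rfloor> = - y"
      by (simp add: y_def)
    with y False show ?thesis
      by (simp add: x odd_periodic_def [of f "- x"] Let_def)
  qed
qed

definition sine_basis :: "nat \<Rightarrow> real \<Rightarrow> complex" where
  "sine_basis n x = of_real (sqrt 2 * sin (pi * real n * x))"

text \<open>A Dirichlet series is represented by its sequence of coefficients; the coefficient at
  index \<open>0\<close> is ignored.\<close>

definition dirichlet_term :: "(nat \<Rightarrow> complex) \<Rightarrow> complex \<Rightarrow> nat \<Rightarrow> complex" where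
  "dirichlet_term a s n = a (Suc n) * of_nat (Suc n) powr (- s)"

definition dirichlet_sum :: "(nat \<Rightarrow> complex) \<Rightarrow> complex \<Rightarrow> complex" where
  "dirichlet_sum a s = (\<Sum>n. dirichlet_term a s n)"

text \<open>The isometry \<open>S\<close> from \<open>L\<^sup>2(0,1)\<close> onto the Hardy space \<open>H\<^sup>2\<close>: the \<open>n\<close>-th coefficient
  of \<open>S f\<close> is the coefficient of \<open>f\<close> in the orthonormal basis \<open>sine_basis\<close>.\<close>

definition dirichlet_transform :: "(real \<Rightarrow> complex) \<Rightarrow> nat \<Rightarrow> complex" where
  "dirichlet_transform f n = L2_inner f (sine_basis n)"

definition H_infinity :: "(nat \<Rightarrow> complex) set" where
  "H_infinity = {a. (\<forall>s. Re s > 0 \<longrightarrow> summable (dirichlet_term a s)) \<and>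
                    dirichlet_sum a holomorphic_on {s. Re s > 0} \<and>
                    bounded (dirichlet_sum a ` {s. Re s > 0})}"

text \<open>The coefficients of \<open>D\<^sup>\<gamma>\<close>.\<close>

definition twist :: "(nat \<Rightarrow> complex) \<Rightarrow> (nat \<Rightarrow> complex) \<Rightarrow> nat \<Rightarrow> complex" where
  "twist a \<gamma> n = a n * \<gamma> n"

text \<open>The radial limit at \<open>i t\<close>.  The value is unspecified where no limit exists, which for series
  in \<open>H_infinity\<close> happens only for \<open>t\<close> in a null set.\<close>

definition boundary_value :: "(nat \<Rightarrow> complex) \<Rightarrow> real \<Rightarrow> complex" where
  "boundary_value a t = Lim (at_right 0) (\<lambda>\<sigma>. dirichlet_sum a (Complex \<sigma> t))"

text \<open>Characters live on the positive integers; the value at \<open>0\<close> is fixed to be \<open>0\<close>, so that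
  a character is determined by its values on the positive integers.\<close>

definition characters :: "(nat \<Rightarrow> complex) set" where
  "characters = {\<gamma>. \<gamma> 0 = 0 \<and> (\<forall>n\<ge>1. cmod (\<gamma> n) = 1) \<and>
                    (\<forall>m\<ge>1. \<forall>n\<ge>1. \<gamma> (m * n) = \<gamma> m * \<gamma> n)}"

definition circle_haar :: "complex measure" where
  "circle_haar = distr (uniform_measure lborel {0..<1}) (restrict_space borel (sphere 0 1))
                   (\<lambda>x. cis (2 * pi * x))"

definition polytorus_haar :: "(nat \<Rightarrow> complex) measure" where
  "polytorus_haar = PiM UNIV (\<lambda>_. circle_haar)"

text \<open>The identification of characters with points of the polytorus;
  \<open>enumerate {p. prime p} k\<close> is the prime at position \<open>k\<close>, counted from \<open>0\<close>.\<close>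

definition prime_values :: "(nat \<Rightarrow> complex) \<Rightarrow> nat \<Rightarrow> complex" where
  "prime_values \<gamma> k = \<gamma> (enumerate {p::nat. prime p} k)"

lemma bij_betw_prime_values: "bij_betw prime_values characters (space polytorus_haar)"
proof -
  define P where "P = {p::nat. prime p}"
  have inf: "infinite P"
    unfolding P_def by (rule primes_infinite)
  have sp: "space polytorus_haar = {z. \<forall>k. cmod (z k) = 1}"
    by (auto simp: polytorus_haar_def circle_haar_def space_PiM space_restrict_space)
  have pv: "prime_values \<gamma> k = \<gamma> (enumerate P k)" for \<gamma> k
    by (simp add: prime_values_def P_def)
  have enum_pos: "enumerate P k \<ge> 1" for k
    using enumerate_in_set [OF inf, of k] by (auto simp: P_def dest: prime_ge_1_nat)
  show ?thesis
    unfolding bij_betw_def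
  proof
    show "inj_on prime_values characters"
    proof (rule inj_onI)
      fix \<gamma> \<delta> assume c: "\<gamma> \<in> characters" "\<delta> \<in> characters" and eq: "prime_values \<gamma> = prime_values \<delta>"
      have on_primes: "\<gamma> p = \<delta> p" if p: "prime p" for p
      proof -
        obtain k where "p = enumerate P k"
          using enumerate_Ex [OF inf, of p] p unfolding P_def by auto
        thus ?thesis
          using fun_cong [OF eq, of k] by (simp add: pv)
      qed
      have one: "\<gamma> 1 = 1" "\<delta> 1 = 1"
        using c by (auto simp: characters_def dest!: spec [of _ 1])
      show "\<gamma> = \<delta>"
      proof
        fix n show "\<gamma> n = \<delta> n"
        proof (induction n rule: prime_divisors_induct)
          case zero
          show ?case using c by (simp add: characters_def)
        next
          case (unit x)
          thus ?case using one by simp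
        next
          case (factor p x)
          show ?case
          proof (cases "x = 0")
            case False
            hence "x \<ge> 1" "p \<ge> 1"
              using factor.hyps by (auto dest: prime_ge_1_nat)
            thus ?thesis
              using c factor.IH on_primes [OF factor.hyps] by (simp add: characters_def)
          qed (use c in \<open>simp add: characters_def\<close>)
        qed
      qed
    qed
    show "prime_values ` characters = space polytorus_haar"
    proof (intro equalityI subsetI)
      fix z assume "z \<in> prime_values ` characters"
      thus "z \<in> space polytorus_haar"
        using enum_pos by (auto simp: sp pv characters_def)
    next
      fix z assume "z \<in> space polytorus_haar"
      hence z: "cmod (z k) = 1" for k
        by (simp add: sp)
      define idx where "idx = the_inv (enumerate P)"
      have idx: "idx (enumerate P k) = k" for k
        unfolding idx_def by (rule the_inv_f_f) (rule inj_enumerate [OF inf])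
      define \<gamma> where "\<gamma> n = (if n = 0 then 0
        else prod_mset (image_mset (\<lambda>p. z (idx p)) (prime_factorization n)))" for n :: nat
      have norm1: "cmod (prod_mset (image_mset (\<lambda>p. z (idx p)) M)) = 1" for M
        by (induction M) (auto simp: norm_mult z)
      have "\<gamma> \<in> characters"
        by (auto simp: characters_def \<gamma>_def norm1 prime_factorization_mult)
      moreover have "prime_values \<gamma> = z"
      proof
        fix k
        have "prime (enumerate P k)"
          using enumerate_in_set [OF inf, of k] by (simp add: P_def)
        thus "prime_values \<gamma> k = z k"
          using enum_pos [of k] by (auto simp: pv \<gamma>_def prime_factorization_prime idx)
      qed
      ultimately show "z \<in> prime_values ` characters"
        by blast
    qed
  qed
qed

text \<open>The Haar measure of the polytorus, transported to the characters along the
  bijection \<open>prime_values\<close>.\<close>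

definition character_haar :: "(nat \<Rightarrow> complex) measure" where
  "character_haar = distr polytorus_haar
     (vimage_algebra characters prime_values polytorus_haar)
     (the_inv_into characters prime_values)"

end

theory Submission
  imports Defs "HOL-Complex_Analysis.Complex_Analysis" "HOL-Real_Asymp.Real_Asymp"
begin

text \<open>Write \<open>a\<^sub>n\<close> for the sine coefficients of \<open>\<phi>\<close> and let \<open>F(\<gamma>) = \<Sum> a\<^sub>n \<gamma>(n)\<close> in \<open>L\<^sup>2(\<Xi>)\<close>.  Both
  \<open>\<langle>\<phi>\<^sub>m, \<phi>\<^sub>n\<rangle>\<close> and \<open>\<integral> \<bar>F\<bar>\<^sup>2 \<gamma>(m) cnj(\<gamma>(n))\<close> equal the sum of \<open>a\<^sub>j cnj(a\<^sub>k)\<close> over \<open>mj = nk\<close>, so by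
  uniqueness of Fourier coefficients on \<open>\<Xi>\<close> the dilations are orthonormal iff \<open>\<bar>F\<bar> = 1\<close> almost
  everywhere.  It remains to compare \<open>F\<close> with boundary values.

  If \<open>F\<close> is bounded, then for almost all \<open>\<gamma>\<close> the function \<open>g(t) = F(\<gamma>(n) n\<^sup>-\<^sup>i\<^sup>t)\<close> is bounded and is
  approximated by the polynomials \<open>\<Sum> a\<^sub>n \<gamma>(n) n\<^sup>-\<^sup>i\<^sup>t\<close> in a weighted \<open>L\<^sup>1\<close> norm on the line.  Integrating
  \<open>g\<close> against a kernel whose Fourier transform cuts off exactly at \<open>n = N\<close> bounds the partial sums
  by \<open>N\<^sup>\<eta>\<close> for every \<open>\<eta> > 0\<close>, whence \<open>D\<^sup>\<gamma>\<close> converges in the right half-plane by Abel summation;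
  integrating against the Poisson kernel shows that \<open>D\<^sup>\<gamma>\<close> is the Poisson extension of \<open>g\<close>, so its
  radial limits are \<open>g\<close> almost everywhere.  Kronecker's theorem transfers the bounds from one such
  \<open>D\<^sup>\<gamma>\<close> to \<open>D\<close>, so \<open>D\<close> lies in \<open>H\<^sup>\<infinity>\<close>.

  Conversely, if \<open>D\<close> is in \<open>H\<^sup>\<infinity>\<close>, its Gaussian averages along vertical lines are absolutely convergent
  Dirichlet series with the same bound; by Kronecker's theorem this bound holds for all their twists,
  and passing to the \<open>L\<^sup>2\<close> limit gives that \<open>F\<close> is bounded.\<close>

section \<open>Square-integrable functions and orthonormal systems\<close>

text \<open>\<open>H_infinity\<close> asks for convergence of the series throughout the half-plane,
  not merely for a bounded analytic continuation. This is why partial sums have to be estimated at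
  all, and why the cut-off must be exact: its cost is the L^1 norm of the kernel, which grows slower
  than every power of N. A second obstacle is that F is determined only up to null sets, while a
  single vertical orbit is itself null. Statements about almost all orbits come from Fubini's
  theorem and the invariance of Haar measure, and they need errors that are summable; hence the
  subsequence of partial sums with squared error at most (1/4)^k, since L^2 convergence alone
  controls no orbit. Conversely, a bound for D gives no immediate hold on its twists, whose series
  converge at best conditionally; Gaussian averaging replaces them by absolutely convergent series,
  in which vertical characters can tend to an arbitrary character term by term. Boundary values can
  be read as values of F only once F is known to be bounded, so in both directions boundedness comes
  first.\<close>

definition sq_integrable :: "'a measure \<Rightarrow> ('a \<Rightarrow> complex) \<Rightarrow> bool" where
  "sq_integrable M f \<longleftrightarrow> f \<in> borel_measurable M \<and> integrable M (\<lambda>x. (cmod (f x))\<^sup>2)"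

lemma sq_integrable_add:
  assumes "sq_integrable M f" "sq_integrable M g"
  shows "sq_integrable M (\<lambda>x. f x + g x)"
proof -
  have [measurable]: "f \<in> borel_measurable M" "g \<in> borel_measurable M"
    using assms by (auto simp: sq_integrable_def)
  have "integrable M (\<lambda>x. (cmod (f x + g x))\<^sup>2)"
  proof (rule Bochner_Integration.integrable_bound)
    show "integrable M (\<lambda>x. 2 * (cmod (f x))\<^sup>2 + 2 * (cmod (g x))\<^sup>2)"
      using assms by (auto simp: sq_integrable_def)
    have "(cmod (z + w))\<^sup>2 \<le> 2 * (cmod z)\<^sup>2 + 2 * (cmod w)\<^sup>2" for z w
    proof -
      have "(cmod (z + w))\<^sup>2 \<le> (cmod z + cmod w)\<^sup>2"
        by (intro power_mono norm_triangle_ineq) auto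
      also have "\<dots> \<le> 2 * (cmod z)\<^sup>2 + 2 * (cmod w)\<^sup>2"
        using zero_le_power2[of "cmod z - cmod w"] by (simp add: power2_eq_square algebra_simps)
      finally show ?thesis .
    qed
    thus "AE x in M. norm ((cmod (f x + g x))\<^sup>2) \<le> norm (2 * (cmod (f x))\<^sup>2 + 2 * (cmod (g x))\<^sup>2)"
      by (intro AE_I2) (auto intro: order_trans[OF _ abs_ge_self])
  qed auto
  thus ?thesis by (simp add: sq_integrable_def)
qed

lemma sq_integrable_cmult: "sq_integrable M f \<Longrightarrow> sq_integrable M (\<lambda>x. c * f x)"
  by (auto simp: sq_integrable_def norm_mult power_mult_distrib)

lemma sq_integrable_diff:
  assumes "sq_integrable M f" "sq_integrable M g"
  shows "sq_integrable M (\<lambda>x. f x - g x)"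
  using sq_integrable_add[OF assms(1) sq_integrable_cmult[OF assms(2), of "-1"]] by simp

lemma sq_integrable_sum:
  "(\<And>i. i \<in> I \<Longrightarrow> sq_integrable M (f i)) \<Longrightarrow> sq_integrable M (\<lambda>x. \<Sum>i\<in>I. f i x)"
  by (induction I rule: infinite_finite_induct)
     (auto intro!: sq_integrable_add simp: sq_integrable_def[of M "\<lambda>x. 0"])

lemma nn_integral_sq_integrable:
  assumes "sq_integrable M f"
  shows "(\<integral>\<^sup>+x. ennreal (cmod (f x)) ^ 2 \<partial>M) = ennreal (\<integral>x. (cmod (f x))\<^sup>2 \<partial>M)"
  using assms by (simp add: sq_integrable_def nn_integral_eq_integral ennreal_power)

lemma sq_integrable_prod:
  assumes "sq_integrable M f" "sq_integrable M g"
  shows "integrable M (\<lambda>x. f x * g x)"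
    and "(\<integral>x. cmod (f x) * cmod (g x) \<partial>M) \<le>
           sqrt (\<integral>x. (cmod (f x))\<^sup>2 \<partial>M) * sqrt (\<integral>x. (cmod (g x))\<^sup>2 \<partial>M)"
proof -
  have [measurable]: "f \<in> borel_measurable M" "g \<in> borel_measurable M"
    using assms by (auto simp: sq_integrable_def)
  have int: "integrable M (\<lambda>x. cmod (f x) * cmod (g x))"
  proof (rule Bochner_Integration.integrable_bound)
    show "integrable M (\<lambda>x. (cmod (f x))\<^sup>2 + (cmod (g x))\<^sup>2)"
      using assms by (auto simp: sq_integrable_def)
    have "a * b \<le> a\<^sup>2 + b\<^sup>2" if "a \<ge> 0" "b \<ge> 0" for a b :: real
    proof -
      have "0 \<le> (a - b)\<^sup>2" by simp
      hence "2 * (a * b) \<le> a\<^sup>2 + b\<^sup>2" by (simp add: power2_eq_square algebra_simps)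
      moreover have "a * b \<ge> 0" using that by simp
      ultimately show ?thesis by linarith
    qed
    thus "AE x in M. norm (cmod (f x) * cmod (g x)) \<le> norm ((cmod (f x))\<^sup>2 + (cmod (g x))\<^sup>2)"
      by (intro AE_I2) auto
  qed auto
  thus "integrable M (\<lambda>x. f x * g x)"
    by (rule Bochner_Integration.integrable_bound) (auto simp: norm_mult)
  have "(ennreal (\<integral>x. cmod (f x) * cmod (g x) \<partial>M))\<^sup>2 =
        (\<integral>\<^sup>+x. ennreal (cmod (f x)) * ennreal (cmod (g x)) \<partial>M)\<^sup>2"
    using int by (simp add: nn_integral_eq_integral ennreal_mult[symmetric])
  also have "\<dots> \<le> (\<integral>\<^sup>+x. ennreal (cmod (f x)) ^ 2 \<partial>M) * (\<integral>\<^sup>+x. ennreal (cmod (g x)) ^ 2 \<partial>M)"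
    by (rule Cauchy_Schwarz_nn_integral) auto
  also have "\<dots> = ennreal ((\<integral>x. (cmod (f x))\<^sup>2 \<partial>M) * (\<integral>x. (cmod (g x))\<^sup>2 \<partial>M))"
    by (simp add: nn_integral_sq_integrable assms ennreal_mult)
  finally have "(\<integral>x. cmod (f x) * cmod (g x) \<partial>M)\<^sup>2 \<le>
      (\<integral>x. (cmod (f x))\<^sup>2 \<partial>M) * (\<integral>x. (cmod (g x))\<^sup>2 \<partial>M)"
    by (simp add: ennreal_power mult_nonneg_nonneg)
  thus "(\<integral>x. cmod (f x) * cmod (g x) \<partial>M) \<le>
           sqrt (\<integral>x. (cmod (f x))\<^sup>2 \<partial>M) * sqrt (\<integral>x. (cmod (g x))\<^sup>2 \<partial>M)"
    by (metis real_le_rsqrt real_sqrt_mult)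
qed

lemma sq_integrable_integral_prod_le:
  assumes "sq_integrable M f" "sq_integrable M g"
  shows "cmod (\<integral>x. f x * g x \<partial>M) \<le>
           sqrt (\<integral>x. (cmod (f x))\<^sup>2 \<partial>M) * sqrt (\<integral>x. (cmod (g x))\<^sup>2 \<partial>M)"
  using integral_norm_bound[of M "\<lambda>x. f x * g x"] sq_integrable_prod(2)[OF assms]
  by (simp add: norm_mult)

lemma measurable_cnj [measurable]: "cnj \<in> borel_measurable borel"
  by (intro borel_measurable_continuous_onI continuous_intros)

lemma sq_integrable_cnj: "sq_integrable M f \<Longrightarrow> sq_integrable M (\<lambda>x. cnj (f x))"
  by (auto simp: sq_integrable_def)

lemma inner_tendsto:
  assumes f: "\<And>N. sq_integrable M (fN N)" "sq_integrable M f"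
      and g: "\<And>N. sq_integrable M (gN N)" "sq_integrable M g"
      and fl: "(\<lambda>N. \<integral>x. (cmod (f x - fN N x))\<^sup>2 \<partial>M) \<longlonglongrightarrow> 0"
      and gl: "(\<lambda>N. \<integral>x. (cmod (g x - gN N x))\<^sup>2 \<partial>M) \<longlonglongrightarrow> 0"
  shows "(\<lambda>N. \<integral>x. fN N x * cnj (gN N x) \<partial>M) \<longlonglongrightarrow> (\<integral>x. f x * cnj (g x) \<partial>M)"
proof -
  let ?n = "\<lambda>h. sqrt (\<integral>x. (cmod (h x))\<^sup>2 \<partial>M)"
  have fd: "sq_integrable M (\<lambda>x. f x - fN N x)" and gd: "sq_integrable M (\<lambda>x. g x - gN N x)" for N
    using f g by (auto intro: sq_integrable_diff)
  \<comment> \<open>This splitting involves only the fixed norms of f and g and the norms of the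
    errors, so the estimate does not depend on the size of \<open>fN\<close> and
    \<open>gN\<close>.\<close>
  have eq: "(\<integral>x. f x * cnj (g x) \<partial>M) - (\<integral>x. fN N x * cnj (gN N x) \<partial>M) =
      (\<integral>x. (f x - fN N x) * cnj (g x) \<partial>M) + (\<integral>x. f x * cnj (g x - gN N x) \<partial>M)
       - (\<integral>x. (f x - fN N x) * cnj (g x - gN N x) \<partial>M)" for N
  proof -
    have "(\<integral>x. f x * cnj (g x) \<partial>M) - (\<integral>x. fN N x * cnj (gN N x) \<partial>M) =
        (\<integral>x. f x * cnj (g x) - fN N x * cnj (gN N x) \<partial>M)"
      using f g by (subst Bochner_Integration.integral_diff)
        (auto intro!: sq_integrable_prod sq_integrable_cnj)
    also have "\<dots> = (\<integral>x. ((f x - fN N x) * cnj (g x) + f x * cnj (g x - gN N x))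
         - (f x - fN N x) * cnj (g x - gN N x) \<partial>M)"
      by (intro Bochner_Integration.integral_cong) (auto simp: algebra_simps)
    also have "\<dots> = (\<integral>x. (f x - fN N x) * cnj (g x) \<partial>M) + (\<integral>x. f x * cnj (g x - gN N x) \<partial>M)
       - (\<integral>x. (f x - fN N x) * cnj (g x - gN N x) \<partial>M)"
      using f g fd gd
      by (simp add: sq_integrable_prod sq_integrable_cnj
           del: complex_cnj_diff)
    finally show ?thesis .
  qed
  have bnd: "cmod ((\<integral>x. f x * cnj (g x) \<partial>M) - (\<integral>x. fN N x * cnj (gN N x) \<partial>M)) \<le>
      ?n (\<lambda>x. f x - fN N x) * ?n g + ?n f * ?n (\<lambda>x. g x - gN N x)
       + ?n (\<lambda>x. f x - fN N x) * ?n (\<lambda>x. g x - gN N x)" for N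
  proof -
    have "cmod (a + b - c) \<le> A + B + C" if "cmod a \<le> A" "cmod b \<le> B" "cmod c \<le> C" for a b c A B C
      using norm_triangle_ineq4[of "a + b" c] norm_triangle_ineq[of a b] that by linarith
    moreover note sq_integrable_integral_prod_le[OF fd sq_integrable_cnj[OF g(2)], of N]
      sq_integrable_integral_prod_le[OF f(2) sq_integrable_cnj[OF gd], of N]
      sq_integrable_integral_prod_le[OF fd sq_integrable_cnj[OF gd], of N N]
    ultimately show ?thesis unfolding eq by (simp only: complex_mod_cnj)
  qed
  have "(\<lambda>N. ?n (\<lambda>x. f x - fN N x) * ?n g + ?n f * ?n (\<lambda>x. g x - gN N x)
       + ?n (\<lambda>x. f x - fN N x) * ?n (\<lambda>x. g x - gN N x)) \<longlonglongrightarrow> sqrt 0 * ?n g + ?n f * sqrt 0 + sqrt 0 * sqrt 0"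
    by (intro tendsto_intros fl gl)
  hence lim: "(\<lambda>N. ?n (\<lambda>x. f x - fN N x) * ?n g + ?n f * ?n (\<lambda>x. g x - gN N x)
       + ?n (\<lambda>x. f x - fN N x) * ?n (\<lambda>x. g x - gN N x)) \<longlonglongrightarrow> 0"
    by simp
  have "(\<lambda>N. (\<integral>x. f x * cnj (g x) \<partial>M) - (\<integral>x. fN N x * cnj (gN N x) \<partial>M)) \<longlonglongrightarrow> 0"
    by (rule Lim_null_comparison[OF _ lim]) (use bnd in auto)
  from tendsto_diff[OF tendsto_const[of "\<integral>x. f x * cnj (g x) \<partial>M"] this] show ?thesis by simp
qed

text \<open>Interpreted twice: for \<open>\<gamma> n\<close> on the characters with B = 1, and for
  \<open>sine_basis\<close> on (0,1) with B = sqrt 2. On a probability space the uniform bound makes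
  every \<open>u n\<close> square-integrable. Indices start at 1, as for Dirichlet
  coefficients.\<close>

locale bounded_orthonormal = prob_space M for M :: "'a measure" +
  fixes u :: "nat \<Rightarrow> 'a \<Rightarrow> complex" and B :: real
  assumes u_meas [measurable]: "\<And>n. n \<ge> 1 \<Longrightarrow> u n \<in> borel_measurable M"
  assumes u_bounded: "\<And>n x. n \<ge> 1 \<Longrightarrow> x \<in> space M \<Longrightarrow> cmod (u n x) \<le> B"
  assumes u_orth: "\<And>m n. m \<ge> 1 \<Longrightarrow> n \<ge> 1 \<Longrightarrow>
     (\<integral>x. u m x * cnj (u n x) \<partial>M) = (if m = n then 1 else 0)"
begin

definition psum :: "(nat \<Rightarrow> complex) \<Rightarrow> nat \<Rightarrow> 'a \<Rightarrow> complex" where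
  "psum a N x = (\<Sum>n=1..N. a n * u n x)"

lemma u_sq: "n \<ge> 1 \<Longrightarrow> sq_integrable M (u n)"
  unfolding sq_integrable_def
proof
  assume n: "n \<ge> 1"
  thus [measurable]: "u n \<in> borel_measurable M" by simp
  show "integrable M (\<lambda>x. (cmod (u n x))\<^sup>2)"
    by (rule integrable_const_bound[of _ "B\<^sup>2"])
       (use u_bounded[OF n] in \<open>auto intro!: power_mono\<close>)
qed

lemma sum_sq: "A \<subseteq> {1..} \<Longrightarrow> sq_integrable M (\<lambda>x. \<Sum>n\<in>A. a n * u n x)"
  by (intro sq_integrable_sum sq_integrable_cmult u_sq) auto

lemma psum_sq: "sq_integrable M (psum a N)"
  unfolding psum_def by (rule sum_sq) auto

lemma psum_measurable [measurable]: "psum a N \<in> borel_measurable M"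
  using psum_sq by (simp add: sq_integrable_def)

lemma inner_sums:
  assumes "finite A" "A \<subseteq> {1..}" "finite A'" "A' \<subseteq> {1..}"
  shows "(\<integral>x. (\<Sum>n\<in>A. a n * u n x) * cnj (\<Sum>n\<in>A'. c n * u n x) \<partial>M) = (\<Sum>n\<in>A \<inter> A'. a n * cnj (c n))"
proof -
  have i: "integrable M (\<lambda>x. u m x * cnj (u n x))" if "m \<ge> 1" "n \<ge> 1" for m n
    using that by (intro sq_integrable_prod sq_integrable_cnj u_sq) auto
  have "(\<integral>x. (\<Sum>n\<in>A. a n * u n x) * cnj (\<Sum>n\<in>A'. c n * u n x) \<partial>M) =
        (\<integral>x. (\<Sum>m\<in>A. \<Sum>n\<in>A'. (a m * cnj (c n)) * (u m x * cnj (u n x))) \<partial>M)"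
    by (intro Bochner_Integration.integral_cong refl)
       (simp add: sum_product mult_ac)
  also have "\<dots> = (\<Sum>m\<in>A. \<Sum>n\<in>A'. (a m * cnj (c n)) * (\<integral>x. u m x * cnj (u n x) \<partial>M))"
  proof -
    have j: "integrable M (\<lambda>x. (a m * cnj (c n)) * (u m x * cnj (u n x)))" if "m \<in> A" "n \<in> A'" for m n
      using that assms by (intro integrable_mult_right i) auto
    show ?thesis
      by (subst Bochner_Integration.integral_sum, intro Bochner_Integration.integrable_sum j, assumption+,
          intro sum.cong refl, subst Bochner_Integration.integral_sum, intro j, assumption+) simp
  qed
  also have "\<dots> = (\<Sum>m\<in>A. \<Sum>n\<in>A'. if m = n then a m * cnj (c n) else 0)"
    using assms by (intro sum.cong refl) (auto simp: subset_iff u_orth)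
  also have "\<dots> = (\<Sum>m\<in>A. if m \<in> A' then a m * cnj (c m) else 0)"
    using assms by (simp add: sum.delta)
  also have "\<dots> = (\<Sum>n\<in>A \<inter> A'. a n * cnj (c n))"
    using assms by (simp add: sum.inter_restrict)
  finally show ?thesis .
qed

lemma integral_norm_sum_sq:
  assumes "finite A" "A \<subseteq> {1..}"
  shows "(\<integral>x. (cmod (\<Sum>n\<in>A. a n * u n x))\<^sup>2 \<partial>M) = (\<Sum>n\<in>A. (cmod (a n))\<^sup>2)"
proof -
  have "complex_of_real (\<integral>x. (cmod (\<Sum>n\<in>A. a n * u n x))\<^sup>2 \<partial>M) =
      (\<integral>x. (\<Sum>n\<in>A. a n * u n x) * cnj (\<Sum>n\<in>A. a n * u n x) \<partial>M)"
    by (simp only: integral_complex_of_real[symmetric] complex_norm_square)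
  also have "\<dots> = (\<Sum>n\<in>A. a n * cnj (a n))"
    using inner_sums[OF assms assms, of a a] by simp
  also have "\<dots> = of_real (\<Sum>n\<in>A. (cmod (a n))\<^sup>2)"
    by (simp only: of_real_sum complex_norm_square)
  finally have "complex_of_real (\<integral>x. (cmod (\<Sum>n\<in>A. a n * u n x))\<^sup>2 \<partial>M) = of_real (\<Sum>n\<in>A. (cmod (a n))\<^sup>2)" .
  thus ?thesis using of_real_eq_iff by blast
qed

lemma inner_psum_u:
  assumes "n \<ge> 1" "n \<le> N"
  shows "(\<integral>x. psum a N x * cnj (u n x) \<partial>M) = a n"
  using inner_sums[of "{1..N}" "{n}" a "\<lambda>_. 1"] assms by (simp add: psum_def)

definition l2tail :: "(nat \<Rightarrow> complex) \<Rightarrow> nat \<Rightarrow> real" where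
  "l2tail a N = (\<Sum>n. (cmod (a (n + Suc N)))\<^sup>2)"

lemma l2tail_lim: "summable (\<lambda>n. (cmod (a n))\<^sup>2) \<Longrightarrow> l2tail a \<longlonglongrightarrow> 0"
  unfolding l2tail_def using LIMSEQ_Suc[OF suminf_exist_split2[of "\<lambda>n. (cmod (a n))\<^sup>2"]]
  by simp

lemma l2tail_bound:
  assumes "summable (\<lambda>n. (cmod (a n))\<^sup>2)" "N \<le> N'"
  shows "(\<integral>x. (cmod (psum a N' x - psum a N x))\<^sup>2 \<partial>M) \<le> l2tail a N"
proof -
  have *: "psum a N' x - psum a N x = (\<Sum>n\<in>{Suc N..N'}. a n * u n x)" for x
  proof -
    have "{1..N'} = {1..N} \<union> {Suc N..N'}" using assms(2) by auto
    thus ?thesis unfolding psum_def by (simp add: sum.union_disjoint)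
  qed
  have "(\<integral>x. (cmod (psum a N' x - psum a N x))\<^sup>2 \<partial>M) = (\<Sum>n\<in>{Suc N..N'}. (cmod (a n))\<^sup>2)"
    unfolding * by (rule integral_norm_sum_sq) auto
  also have "{Suc N..N'} = (\<lambda>n. n + Suc N) ` {..<N' - N}"
    using assms(2) by (auto simp: image_iff Bex_def) presburger
  also have "(\<Sum>n\<in>\<dots>. (cmod (a n))\<^sup>2) = (\<Sum>n<N' - N. (cmod (a (n + Suc N)))\<^sup>2)"
    by (subst sum.reindex) (auto simp: inj_on_def)
  also have "\<dots> \<le> l2tail a N"
    unfolding l2tail_def using assms summable_iff_shift[of "\<lambda>n. (cmod (a n))\<^sup>2" "Suc N"] by (intro sum_le_suminf) auto
  finally show ?thesis .
qed

lemma L1_le_L2: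
  assumes "sq_integrable M f"
  shows "integrable M f" "(\<integral>x. cmod (f x) \<partial>M) \<le> sqrt (\<integral>x. (cmod (f x))\<^sup>2 \<partial>M)"
proof -
  have "sq_integrable M (\<lambda>_. 1)" by (simp add: sq_integrable_def)
  from sq_integrable_prod[OF assms this] 
  show "integrable M f" "(\<integral>x. cmod (f x) \<partial>M) \<le> sqrt (\<integral>x. (cmod (f x))\<^sup>2 \<partial>M)"
    by (auto simp: prob_space)
qed

text \<open>Fatou's lemma for the squared moduli. The bound is asked only from \<open>k0\<close> on
  because \<open>riesz_fischer\<close> compares with a fixed partial sum N, and the tail estimate
  holds only once \<open>r k\<close> has passed N.\<close>

lemma fatou_L2:
  assumes [measurable]: "\<And>k. f k \<in> borel_measurable M" "g \<in> borel_measurable M"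
      and lim: "AE x in M. (\<lambda>k. f k x) \<longlonglongrightarrow> g x"
      and bnd: "\<And>k. k \<ge> k0 \<Longrightarrow> sq_integrable M (f k) \<and> (\<integral>x. (cmod (f k x))\<^sup>2 \<partial>M) \<le> C"
  shows "sq_integrable M g" "(\<integral>x. (cmod (g x))\<^sup>2 \<partial>M) \<le> C"
proof -
  have C: "C \<ge> 0" using bnd[of k0] by (meson Bochner_Integration.integral_nonneg order_refl order_trans zero_le_power2)
  have "(\<integral>\<^sup>+x. ennreal ((cmod (g x))\<^sup>2) \<partial>M) = (\<integral>\<^sup>+x. liminf (\<lambda>k. ennreal ((cmod (f k x))\<^sup>2)) \<partial>M)"
    using lim
  proof (intro nn_integral_cong_AE, eventually_elim)
    case (elim x)
    have "(\<lambda>k. ennreal ((cmod (f k x))\<^sup>2)) \<longlonglongrightarrow> ennreal ((cmod (g x))\<^sup>2)"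
      using elim by (intro tendsto_intros)
    from lim_imp_Liminf[OF _ this] show ?case by simp
  qed
  also have "\<dots> \<le> liminf (\<lambda>k. \<integral>\<^sup>+x. ennreal ((cmod (f k x))\<^sup>2) \<partial>M)"
    by (rule nn_integral_liminf) auto
  also have "\<dots> \<le> ennreal C"
  proof -
    have "(\<integral>\<^sup>+x. ennreal ((cmod (f k x))\<^sup>2) \<partial>M) \<le> ennreal C" if "k \<ge> k0" for k
      using nn_integral_sq_integrable[of M "f k"] bnd[OF that] C by (simp add: ennreal_power)
    hence "\<forall>\<^sub>F k in sequentially. (\<integral>\<^sup>+x. ennreal ((cmod (f k x))\<^sup>2) \<partial>M) \<le> ennreal C"
      by (auto simp: eventually_sequentially)
    thus ?thesis by (intro Liminf_le) auto
  qed
  finally have le: "(\<integral>\<^sup>+x. ennreal ((cmod (g x))\<^sup>2) \<partial>M) \<le> ennreal C" .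
  hence "integrable M (\<lambda>x. (cmod (g x))\<^sup>2)"
    by (intro integrableI_bounded) (auto intro: le_less_trans)
  thus sq: "sq_integrable M g" by (simp add: sq_integrable_def)
  show "(\<integral>x. (cmod (g x))\<^sup>2 \<partial>M) \<le> C"
    using le nn_integral_sq_integrable[OF sq] C by (simp add: ennreal_power)
qed

text \<open>The integral of the series is the sum of the integrals, hence finite, and a function
  with finite integral is finite almost everywhere.\<close>

lemma AE_summable_if_L1_small:
  assumes [measurable]: "\<And>k. f k \<in> borel_measurable M"
      and bnd: "\<And>k. integrable M (f k) \<and> (\<integral>x. cmod (f (k::nat) x) \<partial>M) \<le> (1/2) ^ k"
  shows "AE x in M. summable (\<lambda>k. cmod (f k x))"
proof -
  have "(\<integral>\<^sup>+x. (\<Sum>k. ennreal (cmod (f k x))) \<partial>M) = (\<Sum>k. \<integral>\<^sup>+x. ennreal (cmod (f k x)) \<partial>M)"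
    by (rule nn_integral_suminf) auto
  also have "\<dots> \<le> (\<Sum>k. ennreal ((1/2) ^ k))"
    using bnd by (intro suminf_le) (auto simp: nn_integral_eq_integral)
  also have "\<dots> = ennreal (\<Sum>k. (1/2) ^ k)"
    by (intro suminf_ennreal2) (auto simp: summable_geometric)
  finally have "(\<integral>\<^sup>+x. (\<Sum>k. ennreal (cmod (f k x))) \<partial>M) \<noteq> \<infinity>"
    by (auto simp: top_unique)
  hence "AE x in M. (\<Sum>k. ennreal (cmod (f k x))) \<noteq> \<infinity>"
    by (intro nn_integral_PInf_AE) auto
  thus ?thesis
    by eventually_elim (auto intro!: summable_suminf_not_top)
qed

text \<open>Along a subsequence with tails below (1/4)^k, consecutive partial sums are within
  (1/2)^k in L^1, so they telescope to an almost everywhere limit; Fatou's lemma then gives the L^2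
  error at every N. The rate along r is part of the conclusion because it is needed again when
  errors are averaged over orbits.\<close>

theorem riesz_fischer:
  assumes sm: "summable (\<lambda>n. (cmod (a n))\<^sup>2)"
  obtains r F where "strict_mono r" "sq_integrable M F"
    "AE x in M. (\<lambda>k. psum a (r k) x) \<longlonglongrightarrow> F x"
    "\<And>N. (\<integral>x. (cmod (F x - psum a N x))\<^sup>2 \<partial>M) \<le> l2tail a N"
    "\<And>k. l2tail a (r k) \<le> (1/4) ^ k"
proof -
  have ev: "\<forall>\<^sub>F N in sequentially. l2tail a N < (1/4) ^ k" for k :: nat
    by (rule order_tendstoD(2)[OF l2tail_lim[OF sm]]) auto
  have "\<exists>r. \<forall>k. l2tail a (r k) < (1/4) ^ k \<and> r k < r (Suc k)"
  proof (rule dependent_nat_choice)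
    show "\<exists>N. l2tail a N < (1/4) ^ 0" using ev[of 0] eventually_happens by fastforce
    show "\<exists>y. l2tail a y < (1/4) ^ Suc n \<and> x < y" for x n
      using eventually_happens[OF eventually_conj[OF ev[of "Suc n"] eventually_gt_at_top[of x]]]
      by auto
  qed
  then obtain r where r: "\<And>k. l2tail a (r k) < (1/4) ^ k" "\<And>k. r k < r (Suc k)" by auto
  have mono: "strict_mono r" using r(2) by (simp add: strict_mono_Suc_iff)
  \<comment> \<open>\<open>lim\<close> is applied at every point, also where nothing converges; this
    makes F measurable without handling an exceptional set.\<close>
  define F where "F x = lim (\<lambda>k. psum a (r k) x)" for x
  have [measurable]: "F \<in> borel_measurable M" unfolding F_def by measurable
  have "AE x in M. summable (\<lambda>k. cmod (psum a (r (Suc k)) x - psum a (r k) x))"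
  proof (rule AE_summable_if_L1_small)
    fix k
    have sq: "sq_integrable M (\<lambda>x. psum a (r (Suc k)) x - psum a (r k) x)"
      by (intro sq_integrable_diff psum_sq)
    have "(\<integral>x. cmod (psum a (r (Suc k)) x - psum a (r k) x) \<partial>M) \<le>
        sqrt (\<integral>x. (cmod (psum a (r (Suc k)) x - psum a (r k) x))\<^sup>2 \<partial>M)"
      by (rule L1_le_L2[OF sq])
    also have "\<dots> \<le> sqrt ((1/4) ^ k)"
      using l2tail_bound[OF sm, of "r k" "r (Suc k)"] r(2)[of k] r(1)[of k] by simp
    also have "\<dots> = (1/2) ^ k" by (simp add: real_sqrt_power real_sqrt_divide)
    finally show "integrable M (\<lambda>x. psum a (r (Suc k)) x - psum a (r k) x) \<and>
        (\<integral>x. cmod (psum a (r (Suc k)) x - psum a (r k) x) \<partial>M) \<le> (1/2) ^ k"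
      using L1_le_L2[OF sq] by blast
  qed auto
  hence lim: "AE x in M. (\<lambda>k. psum a (r k) x) \<longlonglongrightarrow> F x"
  proof eventually_elim
    case (elim x)
    hence "summable (\<lambda>k. psum a (r (Suc k)) x - psum a (r k) x)"
      by (rule summable_norm_cancel)
    hence "convergent (\<lambda>k. \<Sum>i<k. psum a (r (Suc i)) x - psum a (r i) x)"
      by (simp add: summable_iff_convergent)
    hence "convergent (\<lambda>k. psum a (r k) x - psum a (r 0) x)"
      by (subst (asm) sum_lessThan_telescope)
    from convergent_add[OF this convergent_const[of "psum a (r 0) x"]]
    show ?case unfolding F_def by (simp add: convergent_LIMSEQ_iff)
  qed
  have *: "sq_integrable M (\<lambda>x. F x - psum a N x) \<and> (\<integral>x. (cmod (F x - psum a N x))\<^sup>2 \<partial>M) \<le> l2tail a N" for N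
  proof -
    have l: "AE x in M. (\<lambda>k. psum a (r k) x - psum a N x) \<longlonglongrightarrow> F x - psum a N x"
      using lim by eventually_elim (intro tendsto_intros)
    have b: "sq_integrable M (\<lambda>x. psum a (r k) x - psum a N x) \<and>
        (\<integral>x. (cmod (psum a (r k) x - psum a N x))\<^sup>2 \<partial>M) \<le> l2tail a N" if "k \<ge> N" for k
      using l2tail_bound[OF sm, of N "r k"] strict_mono_imp_increasing[OF mono, of k] that
      by (auto intro: sq_integrable_diff psum_sq)
    show ?thesis
      using fatou_L2[OF _ _ l b] by auto
  qed
  have "sq_integrable M (\<lambda>x. (F x - psum a 0 x) + psum a 0 x)"
    by (intro sq_integrable_add psum_sq) (use * in auto)
  hence "sq_integrable M F" by simp
  with mono lim * r(1) show ?thesis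
    by (intro that[of r F]) (auto intro: less_imp_le)
qed

end

section \<open>Annihilators of families of test functions\<close>

text \<open>An annihilator that is stable under multiplication by some functions is stable under
  multiplication by the indicators of all sets in the \<open>\<sigma>\<close>-algebra which they generate.  This is how
  vanishing Fourier coefficients force a function to vanish, on \<open>\<Xi>\<close> as well as on \<open>(0,1)\<close>.\<close>

definition annihilator :: "'a measure \<Rightarrow> ('a \<Rightarrow> complex) set \<Rightarrow> ('a \<Rightarrow> complex) set" where
  "annihilator M E = {h. integrable M h \<and> (\<forall>e\<in>E. (\<integral>x. h x * e x \<partial>M) = 0)}"

context finite_measure
begin

lemma integrable_mult_bounded:
  assumes h: "integrable M h" and e: "e \<in> borel_measurable M"
    and K: "\<And>x. x \<in> space M \<Longrightarrow> cmod (e x) \<le> K"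
  shows "integrable M (\<lambda>x. h x * (e x :: complex))"
proof (rule Bochner_Integration.integrable_bound)
  show "integrable M (\<lambda>x. K * cmod (h x))" using h by auto
  show "(\<lambda>x. h x * e x) \<in> borel_measurable M" using h e by auto
  show "AE x in M. norm (h x * e x) \<le> norm (K * cmod (h x))"
  proof (intro AE_I2)
    fix x assume x: "x \<in> space M"
    have "K \<ge> 0" using K[OF x] norm_ge_zero order_trans by blast
    thus "norm (h x * e x) \<le> norm (K * cmod (h x))"
      using K[OF x] by (auto simp: norm_mult abs_mult mult.commute intro: mult_right_mono)
  qed
qed

context
  fixes E :: "('a \<Rightarrow> complex) set"
  assumes E_meas: "\<And>e. e \<in> E \<Longrightarrow> e \<in> borel_measurable M"
      and E_bounded: "\<And>e. e \<in> E \<Longrightarrow> \<exists>K. \<forall>x\<in>space M. cmod (e x) \<le> K"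
begin

text \<open>Dominated convergence for \<open>h j * e\<close>, with majorant w times a bound for e.
  This closure is what carries multipliers from polynomials in X to continuous functions and on to
  indicators.\<close>

lemma annihilator_limit:
  assumes h: "\<And>j. h j \<in> annihilator M E" and w: "integrable M w"
    and dom: "\<And>j x. x \<in> space M \<Longrightarrow> cmod (h j x) \<le> w x"
    and lim: "\<And>x. x \<in> space M \<Longrightarrow> (\<lambda>j. h j x) \<longlonglongrightarrow> g x"
  shows "g \<in> annihilator M E"
proof -
  have hm [measurable]: "h j \<in> borel_measurable M" for j using h[of j] by (auto simp: annihilator_def)
  have gm [measurable]: "g \<in> borel_measurable M"
    by (rule borel_measurable_LIMSEQ_metric[OF hm lim])
  have gi: "integrable M g"
    by (rule integrable_dominated_convergence[where s = h and w = w])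
       (use w dom lim in \<open>auto intro!: AE_I2\<close>)
  have "(\<integral>x. g x * e x \<partial>M) = 0" if e: "e \<in> E" for e
  proof -
    have [measurable]: "e \<in> borel_measurable M" using E_meas[OF e] .
    obtain K where K: "\<And>x. x \<in> space M \<Longrightarrow> cmod (e x) \<le> K" using E_bounded[OF e] by auto
    have "(\<lambda>j. \<integral>x. h j x * e x \<partial>M) \<longlonglongrightarrow> (\<integral>x. g x * e x \<partial>M)"
    proof (rule integral_dominated_convergence[where w = "\<lambda>x. w x * K"])
      show "AE x in M. (\<lambda>j. h j x * e x) \<longlonglongrightarrow> g x * e x"
        by (intro AE_I2 tendsto_intros lim)
      show "AE x in M. norm (h j x * e x) \<le> w x * K" for j
      proof (intro AE_I2)
        fix x assume x: "x \<in> space M"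
        have "w x \<ge> 0" using dom[OF x, of j] norm_ge_zero order_trans by blast
        thus "norm (h j x * e x) \<le> w x * K"
          using dom[OF x, of j] K[OF x] by (auto simp: norm_mult intro: mult_mono)
      qed
    qed (use w in auto)
    moreover have "(\<integral>x. h j x * e x \<partial>M) = 0" for j using h e by (auto simp: annihilator_def)
    ultimately show ?thesis by (simp add: LIMSEQ_const_iff)
  qed
  with gi show ?thesis by (auto simp: annihilator_def)
qed

lemma annihilator_add:
  assumes "g \<in> annihilator M E" "h \<in> annihilator M E"
  shows "(\<lambda>x. g x + h x) \<in> annihilator M E"
proof -
  have "integrable M (\<lambda>x. k x * e x)" if "k \<in> annihilator M E" "e \<in> E" for k e
    using that E_bounded[of e] E_meas[of e]
    by (auto simp: annihilator_def intro: integrable_mult_bounded)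
  thus ?thesis using assms by (auto simp: annihilator_def distrib_right)
qed

lemma annihilator_cmult: "g \<in> annihilator M E \<Longrightarrow> (\<lambda>x. c * g x) \<in> annihilator M E"
  by (auto simp: annihilator_def mult.assoc)

lemma annihilator_diff:
  assumes "g \<in> annihilator M E" "h \<in> annihilator M E"
  shows "(\<lambda>x. g x - h x) \<in> annihilator M E"
  using annihilator_add[OF assms(1) annihilator_cmult[OF assms(2), of "-1"]] by simp

context
  fixes X :: "'a \<Rightarrow> real" and B :: real
  assumes X_meas [measurable]: "X \<in> borel_measurable M"
    and X_bounded: "\<And>x. x \<in> space M \<Longrightarrow> \<bar>X x\<bar> \<le> B"
    and X_mult: "\<And>h. h \<in> annihilator M E \<Longrightarrow> (\<lambda>x. h x * of_real (X x)) \<in> annihilator M E"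
begin

text \<open>The induction generalises over h, since a product of polynomials acts by two successive
  multiplications.\<close>

lemma annihilator_polynomial:
  assumes "real_polynomial_function p" "h \<in> annihilator M E"
  shows "(\<lambda>x. h x * of_real (p (X x))) \<in> annihilator M E"
  using assms
proof (induction arbitrary: h rule: real_polynomial_function.induct)
  case (linear f)
  then obtain c where c: "f = (\<lambda>x. x * c)" by (auto simp: real_bounded_linear)
  show ?case using annihilator_cmult[OF X_mult[OF linear(2)], of "of_real c"]
    by (simp add: c mult_ac)
next
  case (const c)
  show ?case using annihilator_cmult[OF const, of "of_real c"] by (simp add: mult_ac)
next
  case (add f g)
  show ?case using annihilator_add[OF add.IH(1)[OF add.prems] add.IH(2)[OF add.prems]]
    by (simp add: algebra_simps)
next
  case (mult f g)
  show ?case using mult.IH(2)[OF mult.IH(1)[OF mult.prems]] by (simp add: mult_ac)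
qed

text \<open>Polynomials approximate f uniformly on [-B, B], which contains the values of X; errors
  of at most 1 turn a bound K for f into the majorant K + 1.\<close>

lemma annihilator_continuous:
  assumes f: "continuous_on UNIV f" and h: "h \<in> annihilator M E"
  shows "(\<lambda>x. h x * of_real (f (X x) :: real)) \<in> annihilator M E"
proof -
  have "\<exists>p. real_polynomial_function p \<and> (\<forall>y\<in>{-B..B}. \<bar>f y - p y\<bar> < 1 / Suc j)" for j :: nat
  proof -
    have "compact {-B..B}" "continuous_on {-B..B} f" "0 < 1 / real (Suc j)"
      using continuous_on_subset[OF f] by auto
    from Stone_Weierstrass_real_polynomial_function[OF this] show ?thesis by metis
  qed
  then obtain p where p: "\<And>j. real_polynomial_function (p j)"
    "\<And>j y. y \<in> {-B..B} \<Longrightarrow> \<bar>f y - p j y\<bar> < 1 / Suc j" by metis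
  have "bounded (f ` {-B..B})"
    by (intro compact_imp_bounded compact_continuous_image continuous_on_subset[OF f]) auto
  then obtain K where "\<forall>y\<in>{-B..B}. \<bar>f y\<bar> \<le> K" by (auto simp: bounded_iff)
  hence K: "\<And>y. y \<in> {-B..B} \<Longrightarrow> \<bar>f y\<bar> \<le> K" by blast
  have XB: "X x \<in> {-B..B}" if "x \<in> space M" for x using X_bounded[OF that] by auto
  show ?thesis
  proof (rule annihilator_limit)
    show "(\<lambda>x. h x * of_real (p j (X x))) \<in> annihilator M E" for j
      by (rule annihilator_polynomial[OF p(1) h])
    show "integrable M (\<lambda>x. cmod (h x) * (K + 1))" using h by (auto simp: annihilator_def)
    fix j x assume x: "x \<in> space M"
    have "1 / real (Suc j) \<le> 1" by simp
    hence "\<bar>p j (X x)\<bar> \<le> K + 1"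
      using p(2)[OF XB[OF x], of j] K[OF XB[OF x]] by linarith
    thus "cmod (h x * of_real (p j (X x))) \<le> cmod (h x) * (K + 1)"
      by (auto simp: norm_mult intro: mult_left_mono)
  next
    fix x assume x: "x \<in> space M"
    have "(\<lambda>j. f (X x) - p j (X x)) \<longlonglongrightarrow> 0"
    proof (rule Lim_null_comparison[OF _ LIMSEQ_inverse_real_of_nat])
      show "\<forall>\<^sub>F j in sequentially. norm (f (X x) - p j (X x)) \<le> inverse (real (Suc j))"
        using p(2)[OF XB[OF x]] by (intro always_eventually allI less_imp_le) (simp add: inverse_eq_divide)
    qed
    hence "(\<lambda>j. p j (X x)) \<longlonglongrightarrow> f (X x)"
      using tendsto_diff[OF tendsto_const[of "f (X x)"]] by fastforce
    thus "(\<lambda>j. h x * of_real (p j (X x))) \<longlonglongrightarrow> h x * of_real (f (X x))"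
      by (intro tendsto_intros)
  qed
qed

lemma annihilator_closed:
  assumes C: "closed C" and h: "h \<in> annihilator M E"
  shows "(\<lambda>x. h x * indicator (X -` C \<inter> space M) x) \<in> annihilator M E"
\<comment> \<open>\<open>infdist\<close> to the empty set is 0 by convention, so the cut-off
  functions below would be constantly 1 there instead of 0.\<close>
proof (cases "C = {}")
  case True
  show ?thesis using annihilator_cmult[OF h, of 0] by (simp add: True)
next
  case False
  \<comment> \<open>Continuous functions with values in [0,1] that equal 1 on C and are eventually 0
    at each point outside the closed set C.\<close>
  define f where "f j y = max 0 (1 - real j * infdist y C)" for j y
  show ?thesis
  proof (rule annihilator_limit)
    show "(\<lambda>x. h x * of_real (f j (X x))) \<in> annihilator M E" for j
      unfolding f_def by (rule annihilator_continuous[OF _ h]) (intro continuous_intros)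
    show "integrable M (\<lambda>x. cmod (h x))" using h by (auto simp: annihilator_def)
    fix j x assume x: "x \<in> space M"
    have "0 \<le> f j (X x)" "f j (X x) \<le> 1" by (auto simp: f_def infdist_nonneg)
    thus "cmod (h x * of_real (f j (X x))) \<le> cmod (h x)"
      by (auto simp: norm_mult intro: mult_left_le)
  next
    fix x assume x: "x \<in> space M"
    have "(\<lambda>j. f j (X x)) \<longlonglongrightarrow> indicator C (X x)"
    proof (cases "X x \<in> C")
      case True
      thus ?thesis by (simp add: f_def)
    next
      case nin: False
      hence pos: "infdist (X x) C > 0"
        using in_closed_iff_infdist_zero[OF C False, of "X x"] infdist_nonneg[of "X x" C] by linarith
      obtain J where J: "real J * infdist (X x) C > 1" using reals_Archimedean3[OF pos] by blast
      have "f j (X x) = 0" if "j \<ge> J" for j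
      proof -
        have "real J * infdist (X x) C \<le> real j * infdist (X x) C"
          using that pos by (intro mult_right_mono) auto
        thus ?thesis using J by (simp add: f_def)
      qed
      hence "\<forall>\<^sub>F j in sequentially. f j (X x) = indicator C (X x)"
        using nin by (auto simp: eventually_sequentially)
      thus ?thesis by (rule tendsto_eventually)
    qed
    hence "(\<lambda>j. h x * of_real (f j (X x))) \<longlonglongrightarrow> h x * of_real (indicator C (X x))"
      by (intro tendsto_intros)
    thus "(\<lambda>j. h x * of_real (f j (X x))) \<longlonglongrightarrow> h x * indicator (X -` C \<inter> space M) x"
      using x by (cases "X x \<in> C") (simp_all add: indicator_def)
  qed
qed

end

text \<open>Since the claim is proved for all h at once, two indicators can be applied one after the
  other, which yields intersections. Inclusion-exclusion then handles finite unions, and dominated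
  convergence countable ones.\<close>

lemma annihilator_sigma:
  assumes X: "\<And>X. X \<in> \<X> \<Longrightarrow> X \<in> borel_measurable M \<and> (\<exists>B. \<forall>x\<in>space M. \<bar>X x\<bar> \<le> B)"
    and X_mult: "\<And>X h. X \<in> \<X> \<Longrightarrow> h \<in> annihilator M E \<Longrightarrow> (\<lambda>x. h x * of_real (X x :: real)) \<in> annihilator M E"
    and A: "A \<in> sigma_sets (space M) {X -` C \<inter> space M |X C. X \<in> \<X> \<and> closed C}"
    and h: "h \<in> annihilator M E"
  shows "(\<lambda>x. h x * indicator A x) \<in> annihilator M E"
  using A h
proof (induction arbitrary: h rule: sigma_sets.induct)
  case (Basic A)
  then obtain X C where XC: "A = X -` C \<inter> space M" "X \<in> \<X>" "closed C" by auto
  obtain B where "\<And>x. x \<in> space M \<Longrightarrow> \<bar>X x\<bar> \<le> B" using X[OF XC(2)] by auto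
  with X_mult[OF XC(2)] X[OF XC(2)] XC(3) Basic(2) show ?case
    unfolding XC(1) by (intro annihilator_closed[where B = B]) auto
next
  case Empty
  show ?case using annihilator_cmult[OF Empty, of 0] by simp
next
  case (Compl A)
  have "(\<lambda>x. h x - h x * indicator A x) \<in> annihilator M E"
    by (intro annihilator_diff Compl)
  moreover have "(\<integral>x. h x * indicator (space M - A) x * e x \<partial>M) = (\<integral>x. (h x - h x * indicator A x) * e x \<partial>M)" for e
    by (intro Bochner_Integration.integral_cong) (auto simp: indicator_def)
  moreover have "integrable M (\<lambda>x. h x * indicator (space M - A) x) \<longleftrightarrow> integrable M (\<lambda>x. h x - h x * indicator A x)"
    by (intro Bochner_Integration.integrable_cong) (auto simp: indicator_def)
  ultimately show ?case by (simp add: annihilator_def)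
next
  case (Union A)
  have fin: "(\<lambda>x. h x * indicator (\<Union>i<j. A i) x) \<in> annihilator M E" for j :: nat
  proof (induction j)
    case 0
    show ?case using annihilator_cmult[OF Union(3), of 0] by simp
  next
    case (Suc j)
    have "(\<lambda>x. (h x * indicator (\<Union>i<j. A i) x + h x * indicator (A j) x) -
        (h x * indicator (\<Union>i<j. A i) x) * indicator (A j) x) \<in> annihilator M E"
      by (intro annihilator_diff annihilator_add Suc Union.IH Union.prems)
    also have "(\<lambda>x. (h x * indicator (\<Union>i<j. A i) x + h x * indicator (A j) x) -
        (h x * indicator (\<Union>i<j. A i) x) * indicator (A j) x) = (\<lambda>x. h x * indicator (\<Union>i<Suc j. A i) x)"
      by (rule ext) (auto simp: lessThan_Suc split: split_indicator)
    finally show ?case .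
  qed
  show ?case
  proof (rule annihilator_limit[OF fin])
    show "integrable M (\<lambda>x. cmod (h x))" using Union.prems by (auto simp: annihilator_def)
    show "cmod (h x * indicator (\<Union>i<j. A i) x) \<le> cmod (h x)" for j x
      by (auto simp: indicator_def)
    show "(\<lambda>j. h x * indicator (\<Union>i<j. A i) x) \<longlonglongrightarrow> h x * indicator (\<Union>i. A i) x" for x
      by (intro tendsto_intros LIMSEQ_indicator_UN)
  qed
qed

text \<open>The indicators reach every measurable set, so all set integrals of \<open>h * e\<close>
  vanish. Generation is asked only up to null sets because Lebesgue measurable subsets of (0,1) are
  generated only in that sense.\<close>

lemma annihilator_eq_0:
  assumes X: "\<And>X. X \<in> \<X> \<Longrightarrow> X \<in> borel_measurable M \<and> (\<exists>B. \<forall>x\<in>space M. \<bar>X x\<bar> \<le> B)"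
    and X_mult: "\<And>X h. X \<in> \<X> \<Longrightarrow> h \<in> annihilator M E \<Longrightarrow> (\<lambda>x. h x * of_real (X x :: real)) \<in> annihilator M E"
    and gen: "\<And>A. A \<in> sets M \<Longrightarrow>
      \<exists>A'\<in>sigma_sets (space M) {X -` C \<inter> space M |X C. X \<in> \<X> \<and> closed C}. AE x in M. x \<in> A \<longleftrightarrow> x \<in> A'"
    and h: "h \<in> annihilator M E" and e: "e \<in> E"
  shows "AE x in M. h x * e x = 0"
proof (rule density_zero)
  obtain K where K: "\<And>x. x \<in> space M \<Longrightarrow> cmod (e x) \<le> K" using E_bounded[OF e] by auto
  show i: "integrable M (\<lambda>x. h x * e x)"
    using h K E_meas[OF e] by (auto simp: annihilator_def intro: integrable_mult_bounded)
  fix A assume A: "A \<in> sets M"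
  obtain A' where A': "A' \<in> sigma_sets (space M) {X -` C \<inter> space M |X C. X \<in> \<X> \<and> closed C}"
      "AE x in M. x \<in> A \<longleftrightarrow> x \<in> A'" using gen[OF A] by auto
  have "(\<lambda>x. h x * indicator A' x) \<in> annihilator M E"
    by (rule annihilator_sigma[OF X X_mult A'(1) h])
  hence i': "integrable M (\<lambda>x. h x * indicator A' x)" and z: "(\<integral>x. h x * indicator A' x * e x \<partial>M) = 0"
    using e by (auto simp: annihilator_def)
  have "set_lebesgue_integral M A (\<lambda>x. h x * e x) = (\<integral>x. h x * indicator A' x * e x \<partial>M)"
    unfolding set_lebesgue_integral_def
  proof (rule integral_cong_AE)
    show "(\<lambda>x. indicat_real A x *\<^sub>R (h x * e x)) \<in> borel_measurable M" using i A by measurable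
    show "(\<lambda>x. h x * indicator A' x * e x) \<in> borel_measurable M"
      using i' E_meas[OF e] by auto
    show "AE x in M. indicat_real A x *\<^sub>R (h x * e x) = h x * indicator A' x * e x"
      using A'(2) by eventually_elim (auto simp: indicator_def)
  qed
  thus "set_lebesgue_integral M A (\<lambda>x. h x * e x) = 0" using z by simp
qed

end

end

section \<open>Haar measure on the characters\<close>

lemma measurable_cis [measurable]: "cis \<in> borel_measurable borel"
  unfolding cis_conv_exp [abs_def] by (intro borel_measurable_continuous_onI continuous_intros)

lemma space_circle_haar: "space circle_haar = sphere 0 1"
  by (simp add: circle_haar_def space_restrict_space)

lemma sets_circle_haar: "sets circle_haar = sets (restrict_space borel (sphere 0 1))"
  by (simp add: circle_haar_def)

lemma measurable_cis_2pi: "(\<lambda>x. cis (2 * pi * x)) \<in> uniform_measure lborel {0..<1} \<rightarrow>\<^sub>M restrict_space borel (sphere 0 1)"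
proof (rule measurable_restrict_space2)
  have "(\<lambda>x. cis (2 * pi * x)) \<in> borel_measurable lborel" by measurable
  thus "(\<lambda>x. cis (2 * pi * x)) \<in> borel_measurable (uniform_measure lborel {0..<1})"
    using measurable_cong_sets[OF sets_uniform_measure refl] by blast
qed auto

lemma prob_space_circle_haar: "prob_space circle_haar"
  unfolding circle_haar_def
proof (rule prob_space.prob_space_distr)
  show "prob_space (uniform_measure lborel {0..<1::real})"
    by (rule prob_space_uniform_measure) auto
qed (rule measurable_cis_2pi)

lemma nn_integral_circle_haar:
  assumes [measurable]: "f \<in> borel_measurable circle_haar"
  shows "(\<integral>\<^sup>+w. f w \<partial>circle_haar) = (\<integral>\<^sup>+x. f (cis (2 * pi * x)) * indicator {0..<1} x \<partial>lborel)"
proof -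
  have fm: "f \<in> borel_measurable (restrict_space borel (sphere 0 1))"
    using assms measurable_cong_sets[OF sets_circle_haar refl] by blast
  have [measurable]: "(\<lambda>x. f (cis (2 * pi * x))) \<in> borel_measurable lborel"
    using measurable_compose[OF measurable_cis_2pi fm] measurable_cong_sets[OF sets_uniform_measure refl] by blast
  have "(\<integral>\<^sup>+w. f w \<partial>circle_haar) = (\<integral>\<^sup>+x. f (cis (2 * pi * x)) \<partial>uniform_measure lborel {0..<1})"
    unfolding circle_haar_def by (intro nn_integral_distr measurable_cis_2pi) (use fm in auto)
  also have "\<dots> = (\<integral>\<^sup>+x. f (cis (2 * pi * x)) * indicator {0..<1} x \<partial>lborel)"
    by (subst nn_integral_uniform_measure) (auto simp: divide_ennreal_def)
  finally show ?thesis .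
qed

text \<open>The shifted window is cut at 1, and the part beyond 1 is moved back by one
  period.\<close>

lemma nn_integral_periodic:
  fixes f :: "real \<Rightarrow> ennreal"
  assumes [measurable]: "f \<in> borel_measurable borel" and per: "\<And>x. f (x + 1) = f x"
    and \<alpha>: "0 \<le> \<alpha>" "\<alpha> < 1"
  shows "(\<integral>\<^sup>+x. f (x + \<alpha>) * indicator {0..<1} x \<partial>lborel) = (\<integral>\<^sup>+x. f x * indicator {0..<1} x \<partial>lborel)"
proof -
  have shift: "(\<integral>\<^sup>+x. g x \<partial>lborel) = (\<integral>\<^sup>+x. g (x + c) \<partial>lborel)"
    if [measurable]: "g \<in> borel_measurable borel" for g :: "real \<Rightarrow> ennreal" and c
    using nn_integral_real_affine[of g 1 c] by (simp add: add.commute)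
  have "(\<integral>\<^sup>+x. f (x + \<alpha>) * indicator {0..<1} x \<partial>lborel) =
        (\<integral>\<^sup>+x. f (x + \<alpha>) * indicator {\<alpha>..<1+\<alpha>} (x + \<alpha>) \<partial>lborel)"
    by (intro nn_integral_cong) (auto simp: indicator_def)
  also have "\<dots> = (\<integral>\<^sup>+x. f x * indicator {\<alpha>..<1+\<alpha>} x \<partial>lborel)"
    by (rule shift[symmetric]) measurable
  also have "\<dots> = (\<integral>\<^sup>+x. f x * indicator {\<alpha>..<1} x + f x * indicator {1..<1+\<alpha>} x \<partial>lborel)"
    using \<alpha> by (intro nn_integral_cong) (auto simp: indicator_def)
  also have "\<dots> = (\<integral>\<^sup>+x. f x * indicator {\<alpha>..<1} x \<partial>lborel) + (\<integral>\<^sup>+x. f x * indicator {1..<1+\<alpha>} x \<partial>lborel)"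
    by (rule nn_integral_add) auto
  also have "(\<integral>\<^sup>+x. f x * indicator {1..<1+\<alpha>} x \<partial>lborel) = (\<integral>\<^sup>+x. f (x + 1) * indicator {1..<1+\<alpha>} (x + 1) \<partial>lborel)"
    by (rule shift) measurable
  also have "\<dots> = (\<integral>\<^sup>+x. f x * indicator {0..<\<alpha>} x \<partial>lborel)"
    by (intro nn_integral_cong) (auto simp: per indicator_def)
  also have "(\<integral>\<^sup>+x. f x * indicator {\<alpha>..<1} x \<partial>lborel) + \<dots> =
      (\<integral>\<^sup>+x. f x * indicator {\<alpha>..<1} x + f x * indicator {0..<\<alpha>} x \<partial>lborel)"
    by (rule nn_integral_add[symmetric]) auto
  also have "\<dots> = (\<integral>\<^sup>+x. f x * indicator {0..<1} x \<partial>lborel)"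
    using \<alpha> by (intro nn_integral_cong) (auto simp: indicator_def)
  finally show ?thesis .
qed

lemma measurable_circle_rotation:
  assumes "cmod c = 1"
  shows "(\<lambda>w. c * w) \<in> circle_haar \<rightarrow>\<^sub>M circle_haar"
proof -
  have "(\<lambda>w. c * w) \<in> restrict_space borel (sphere 0 1) \<rightarrow>\<^sub>M restrict_space borel (sphere 0 1)"
    by (rule measurable_restrict_space2)
       (use assms in \<open>auto simp: space_restrict_space norm_mult intro!: measurable_restrict_space1\<close>)
  thus ?thesis using measurable_cong_sets[OF sets_circle_haar sets_circle_haar] by blast
qed

text \<open>In the parametrisation by [0,1) a rotation is a translation of the angle, and integrals
  of 1-periodic functions over a period do not change under translation.\<close>

lemma circle_haar_rotation:
  assumes c: "cmod c = 1"
  shows "distr circle_haar circle_haar (\<lambda>w. c * w) = circle_haar"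
proof (rule measure_eqI)
  fix A assume "A \<in> sets (distr circle_haar circle_haar (\<lambda>w. c * w))"
  hence A: "A \<in> sets circle_haar" by simp
  then obtain A' where A': "A' \<in> sets borel" "A = A' \<inter> sphere 0 1"
    by (auto simp: sets_circle_haar sets_restrict_space)
  have "\<exists>\<alpha>. 0 \<le> \<alpha> \<and> \<alpha> < 1 \<and> c = cis (2 * pi * \<alpha>)"
  proof (intro exI[of _ "Arg2pi c / (2 * pi)"] conjI)
    show "0 \<le> Arg2pi c / (2 * pi)" "Arg2pi c / (2 * pi) < 1"
      using Arg2pi[of c] by (auto simp: field_simps)
    show "c = cis (2 * pi * (Arg2pi c / (2 * pi)))"
      using Arg2pi_eq[of c] c by (simp add: cis_conv_exp mult.commute)
  qed
  then obtain \<alpha> where \<alpha>: "0 \<le> \<alpha>" "\<alpha> < 1" "c = cis (2 * pi * \<alpha>)" by blast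
  define f :: "real \<Rightarrow> ennreal" where "f x = indicator A' (cis (2 * pi * x))" for x
  have [measurable]: "f \<in> borel_measurable borel"
    unfolding f_def using A' by measurable
  have per: "f (x + 1) = f x" for x
  proof -
    have "cis (2 * pi * (x + 1)) = cis (2 * pi * x)"
      by (simp add: distrib_left flip: cis_mult)
    thus ?thesis by (simp add: f_def)
  qed
  have "emeasure (distr circle_haar circle_haar (\<lambda>w. c * w)) A =
        (\<integral>\<^sup>+w. indicator A (c * w) \<partial>circle_haar)"
  proof -
    have "emeasure (distr circle_haar circle_haar (\<lambda>w. c * w)) A =
        (\<integral>\<^sup>+w. indicator A w \<partial>distr circle_haar circle_haar (\<lambda>w. c * w))"
      using A by simp
    also have "\<dots> = (\<integral>\<^sup>+w. indicator A (c * w) \<partial>circle_haar)"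
      by (rule nn_integral_distr[OF measurable_circle_rotation[OF c]]) (use A in simp)
    finally show ?thesis .
  qed
  also have "\<dots> = (\<integral>\<^sup>+x. indicator A (c * cis (2 * pi * x)) * indicator {0..<1} x \<partial>lborel)"
    by (rule nn_integral_circle_haar)
       (rule measurable_compose[OF measurable_circle_rotation[OF c]], use A in auto)
  also have "\<dots> = (\<integral>\<^sup>+x. f (x + \<alpha>) * indicator {0..<1} x \<partial>lborel)"
    by (intro nn_integral_cong)
       (auto simp: f_def A' \<alpha>(3) cis_mult distrib_left add.commute indicator_def norm_mult)
  also have "\<dots> = (\<integral>\<^sup>+x. f x * indicator {0..<1} x \<partial>lborel)"
    by (rule nn_integral_periodic) (use per \<alpha> in auto)
  also have "\<dots> = (\<integral>\<^sup>+x. indicator A (cis (2 * pi * x)) * indicator {0..<1} x \<partial>lborel)"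
    by (intro nn_integral_cong) (auto simp: f_def A' indicator_def)
  also have "\<dots> = (\<integral>\<^sup>+w. indicator A w \<partial>circle_haar)"
    by (rule nn_integral_circle_haar[symmetric]) (use A in auto)
  also have "\<dots> = emeasure circle_haar A" using A by simp
  finally show "emeasure (distr circle_haar circle_haar (\<lambda>w. c * w)) A = emeasure circle_haar A" .
qed simp

section \<open>Rotation invariance on the infinite torus\<close>

lemma space_polytorus_haar: "space polytorus_haar = {z. \<forall>k. cmod (z k) = 1}"
  by (auto simp: polytorus_haar_def space_PiM space_circle_haar)

lemma prob_space_polytorus_haar: "prob_space polytorus_haar"
  unfolding polytorus_haar_def by (intro prob_space_PiM prob_space_circle_haar)

lemma measurable_polytorus_rotation:
  assumes "\<And>k. cmod (\<kappa> k) = 1"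
  shows "(\<lambda>z k. \<kappa> k * z k) \<in> polytorus_haar \<rightarrow>\<^sub>M polytorus_haar"
  unfolding polytorus_haar_def
proof (rule measurable_PiM_single')
  show "(\<lambda>z. \<kappa> k * z k) \<in> PiM UNIV (\<lambda>_. circle_haar) \<rightarrow>\<^sub>M circle_haar" for k
  proof -
    have "(\<lambda>z. z k) \<in> PiM UNIV (\<lambda>_. circle_haar) \<rightarrow>\<^sub>M circle_haar" by simp
    from measurable_compose[OF this measurable_circle_rotation[OF assms]] show ?thesis .
  qed
  show "(\<lambda>z k. \<kappa> k * z k) \<in> space (PiM UNIV (\<lambda>_. circle_haar)) \<rightarrow> (UNIV \<rightarrow>\<^sub>E space circle_haar)"
    using assms by (auto simp: space_PiM space_circle_haar PiE_iff norm_mult)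
qed

text \<open>Finite cylinders determine the product measure, and the preimage of a cylinder under a
  coordinatewise rotation is a cylinder with rotated sides.\<close>

lemma polytorus_haar_rotation:
  assumes \<kappa>: "\<And>k. cmod (\<kappa> k) = 1"
  shows "distr polytorus_haar polytorus_haar (\<lambda>z k. \<kappa> k * z k) = polytorus_haar"
proof -
  interpret product_prob_space "\<lambda>_::nat. circle_haar" UNIV
    by (intro product_prob_spaceI prob_space_circle_haar)
  let ?D = "distr polytorus_haar polytorus_haar (\<lambda>z k. \<kappa> k * z k)"
  show ?thesis
  proof (rule measure_eqI_PiM_infinite[where I = UNIV and M = "\<lambda>_. circle_haar"])
    show "sets ?D = sets (PiM UNIV (\<lambda>_. circle_haar))" by (simp add: polytorus_haar_def)
    show "sets polytorus_haar = sets (PiM UNIV (\<lambda>_. circle_haar))" by (simp add: polytorus_haar_def)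
    have "prob_space ?D" by (intro prob_space.prob_space_distr[OF prob_space_polytorus_haar] measurable_polytorus_rotation \<kappa>)
    thus "finite_measure ?D" by (simp add: prob_space_def)
    fix A :: "nat \<Rightarrow> complex set" and J :: "nat set"
    assume J: "finite J" "J \<subseteq> UNIV" and A: "\<And>i. i \<in> J \<Longrightarrow> A i \<in> sets circle_haar"
    let ?B = "\<lambda>i. (\<lambda>w. \<kappa> i * w) -` A i \<inter> space circle_haar"
    have B: "?B i \<in> sets circle_haar" if "i \<in> J" for i
      using measurable_circle_rotation[OF \<kappa>] A[OF that] by (rule measurable_sets)
    have S: "prod_emb UNIV (\<lambda>_. circle_haar) J (Pi\<^sub>E J A) \<in> sets polytorus_haar"
      unfolding polytorus_haar_def using J A by (intro sets_PiM_I) auto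
    have "emeasure ?D (prod_emb UNIV (\<lambda>_. circle_haar) J (Pi\<^sub>E J A)) =
        emeasure polytorus_haar ((\<lambda>z k. \<kappa> k * z k) -` prod_emb UNIV (\<lambda>_. circle_haar) J (Pi\<^sub>E J A) \<inter> space polytorus_haar)"
      by (rule emeasure_distr[OF measurable_polytorus_rotation[OF \<kappa>] S])
    also have "(\<lambda>z k. \<kappa> k * z k) -` prod_emb UNIV (\<lambda>_. circle_haar) J (Pi\<^sub>E J A) \<inter> space polytorus_haar
        = prod_emb UNIV (\<lambda>_. circle_haar) J (Pi\<^sub>E J ?B)"
      using \<kappa> by (auto simp: prod_emb_def space_polytorus_haar space_circle_haar PiE_iff extensional_def norm_mult)
    also have "emeasure polytorus_haar \<dots> = (\<Prod>i\<in>J. emeasure circle_haar (?B i))"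
      unfolding polytorus_haar_def using J B by (intro emeasure_PiM_emb) auto
    also have "\<dots> = (\<Prod>i\<in>J. emeasure (distr circle_haar circle_haar (\<lambda>w. \<kappa> i * w)) (A i))"
      using A measurable_circle_rotation[OF \<kappa>] by (intro prod.cong refl) (simp add: emeasure_distr)
    also have "\<dots> = (\<Prod>i\<in>J. emeasure circle_haar (A i))"
      by (simp add: circle_haar_rotation \<kappa>)
    also have "\<dots> = emeasure polytorus_haar (prod_emb UNIV (\<lambda>_. circle_haar) J (Pi\<^sub>E J A))"
      unfolding polytorus_haar_def using J A by (intro emeasure_PiM_emb[symmetric]) auto
    finally show "emeasure ?D (prod_emb UNIV (\<lambda>_. circle_haar) J (Pi\<^sub>E J A)) =
        emeasure polytorus_haar (prod_emb UNIV (\<lambda>_. circle_haar) J (Pi\<^sub>E J A))" .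
  qed
qed

section \<open>Haar measure transported to the characters\<close>

lemma space_character_haar [simp]: "space character_haar = characters"
  by (simp add: character_haar_def)

lemma prime_values_the_inv:
  "z \<in> space polytorus_haar \<Longrightarrow> prime_values (the_inv_into characters prime_values z) = z"
  by (rule f_the_inv_into_f_bij_betw[OF bij_betw_prime_values]) simp

lemma the_inv_in_characters:
  "z \<in> space polytorus_haar \<Longrightarrow> the_inv_into characters prime_values z \<in> characters"
  using bij_betw_the_inv_into[OF bij_betw_prime_values] by (auto simp: bij_betw_def)

lemma the_inv_prime_values:
  "\<gamma> \<in> characters \<Longrightarrow> the_inv_into characters prime_values (prime_values \<gamma>) = \<gamma>"
  using bij_betw_prime_values by (auto simp: bij_betw_def intro: the_inv_into_f_f)

lemma prime_values_in_space: "\<gamma> \<in> characters \<Longrightarrow> prime_values \<gamma> \<in> space polytorus_haar"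
  using bij_betw_prime_values by (auto simp: bij_betw_def)

abbreviation character_algebra :: "(nat \<Rightarrow> complex) measure" where
  "character_algebra \<equiv> vimage_algebra characters prime_values polytorus_haar"

lemma measurable_the_inv: "the_inv_into characters prime_values \<in> polytorus_haar \<rightarrow>\<^sub>M character_algebra"
proof (rule measurable_vimage_algebra2)
  show "(\<lambda>z. prime_values (the_inv_into characters prime_values z)) \<in> polytorus_haar \<rightarrow>\<^sub>M polytorus_haar"
    by (rule measurable_cong[THEN iffD2, OF prime_values_the_inv]) auto
qed (auto intro: the_inv_in_characters)

lemma sets_character_haar: "sets character_haar = sets character_algebra"
  by (simp add: character_haar_def)

lemma prob_space_character_haar: "prob_space character_haar"
  unfolding character_haar_def
  by (rule prob_space.prob_space_distr[OF prob_space_polytorus_haar measurable_the_inv])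

lemma measurable_prime_values: "prime_values \<in> character_haar \<rightarrow>\<^sub>M polytorus_haar"
proof -
  have "prime_values \<in> character_algebra \<rightarrow>\<^sub>M polytorus_haar"
    by (rule measurable_vimage_algebra1) (auto intro: prime_values_in_space)
  thus ?thesis using measurable_cong_sets[OF sets_character_haar refl] by blast
qed

lemma prime_index:
  assumes "prime (p::nat)"
  obtains k where "p = enumerate {p::nat. prime p} k"
  using enumerate_Ex[OF primes_infinite, of p] assms by auto

lemma measurable_circle_borel: "(\<lambda>w. w) \<in> circle_haar \<rightarrow>\<^sub>M borel"
  using measurable_cong_sets[OF sets_circle_haar refl] measurable_restrict_space1[of "\<lambda>w. w" borel borel]
  by auto

lemma measurable_character_prime:
  assumes "prime p"
  shows "(\<lambda>\<gamma>. \<gamma> p) \<in> borel_measurable character_haar"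
proof -
  obtain k where k: "p = enumerate {p::nat. prime p} k" using prime_index[OF assms] .
  have "(\<lambda>z. z k) \<in> polytorus_haar \<rightarrow>\<^sub>M circle_haar"
    unfolding polytorus_haar_def by (rule measurable_component_singleton) auto
  from measurable_compose[OF measurable_compose[OF measurable_prime_values this] measurable_circle_borel]
  show ?thesis by (simp add: prime_values_def k)
qed

lemma character_1: "\<gamma> \<in> characters \<Longrightarrow> \<gamma> (Suc 0) = 1"
  by (auto simp: characters_def dest!: spec [of _ "Suc 0"])

lemma character_0: "\<gamma> \<in> characters \<Longrightarrow> \<gamma> 0 = 0"
  by (auto simp: characters_def)

lemma character_mult: "\<gamma> \<in> characters \<Longrightarrow> \<gamma> (m * n) = \<gamma> m * \<gamma> n"
  by (cases "m = 0"; cases "n = 0") (auto simp: characters_def)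

lemma norm_character: "\<gamma> \<in> characters \<Longrightarrow> n \<ge> 1 \<Longrightarrow> cmod (\<gamma> n) = 1"
  by (auto simp: characters_def)

lemma norm_character_le: "\<gamma> \<in> characters \<Longrightarrow> cmod (\<gamma> n) \<le> 1"
  by (cases "n = 0") (auto simp: characters_def)

text \<open>Only the values at primes are coordinates of the polytorus; complete multiplicativity
  gives the others by induction over the factorisation.\<close>

lemma measurable_character [measurable]: "(\<lambda>\<gamma>. \<gamma> n) \<in> borel_measurable character_haar"
proof (induction n rule: prime_divisors_induct)
  case zero
  show ?case by (rule measurable_cong[where g = "\<lambda>_. 0", THEN iffD2]) (auto simp: character_0)
next
  case (unit x)
  hence x: "x = Suc 0" by simp
  show ?case unfolding x
    by (rule measurable_cong[where g = "\<lambda>_. 1", THEN iffD2]) (auto simp: character_1)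
next
  case (factor p x)
  have "(\<lambda>\<gamma>. \<gamma> p * \<gamma> x) \<in> borel_measurable character_haar"
    using factor measurable_character_prime[of p] by measurable
  thus ?case
    by (subst measurable_cong[where g = "\<lambda>\<gamma>. \<gamma> p * \<gamma> x"]) (auto simp: character_mult)
qed

text \<open>The sigma-algebra on the characters is pulled back along \<open>prime_values\<close>, so
  values at primes are the only test.\<close>

lemma measurable_character_haarI:
  assumes sp: "\<And>x. x \<in> space M \<Longrightarrow> f x \<in> characters"
    and m: "\<And>p. prime p \<Longrightarrow> (\<lambda>x. f x p) \<in> borel_measurable M"
  shows "f \<in> M \<rightarrow>\<^sub>M character_haar"
proof -
  have "f \<in> M \<rightarrow>\<^sub>M character_algebra"
  proof (rule measurable_vimage_algebra2)
    show "f \<in> space M \<rightarrow> characters" using sp by auto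
    show "(\<lambda>x. prime_values (f x)) \<in> M \<rightarrow>\<^sub>M polytorus_haar"
      unfolding polytorus_haar_def
    proof (rule measurable_PiM_single')
      show "(\<lambda>x. prime_values (f x)) \<in> space M \<rightarrow> (UNIV \<rightarrow>\<^sub>E space circle_haar)"
        using sp prime_values_in_space by (fastforce simp: space_circle_haar space_polytorus_haar)
      show "(\<lambda>x. prime_values (f x) k) \<in> M \<rightarrow>\<^sub>M circle_haar" for k
      proof -
        have "prime (enumerate {p::nat. prime p} k)"
          using enumerate_in_set[OF primes_infinite, of k] by simp
        from m[OF this] have "(\<lambda>x. prime_values (f x) k) \<in> borel_measurable M"
          by (simp add: prime_values_def)
        hence "(\<lambda>x. prime_values (f x) k) \<in> M \<rightarrow>\<^sub>M restrict_space borel (sphere 0 1)"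
          by (intro measurable_restrict_space2)
             (use sp prime_values_in_space in \<open>auto simp: space_polytorus_haar\<close>)
        thus ?thesis using measurable_cong_sets[OF refl sets_circle_haar] by blast
      qed
    qed
  qed
  thus ?thesis using measurable_cong_sets[OF refl sets_character_haar] by blast
qed

lemma twist_character: "\<kappa> \<in> characters \<Longrightarrow> \<gamma> \<in> characters \<Longrightarrow> twist \<kappa> \<gamma> \<in> characters"
  by (auto simp: characters_def twist_def norm_mult)

lemma measurable_twist: "\<kappa> \<in> characters \<Longrightarrow> twist \<kappa> \<in> character_haar \<rightarrow>\<^sub>M character_haar"
  by (rule measurable_character_haarI) (auto intro: twist_character simp: twist_def)

text \<open>Under \<open>prime_values\<close> a twist by \<kappa> becomes the coordinatewise
  rotation by the prime values of \<kappa>.\<close>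

lemma character_haar_twist:
  assumes \<kappa>: "\<kappa> \<in> characters"
  shows "distr character_haar character_haar (twist \<kappa>) = character_haar"
proof -
  let ?i = "the_inv_into characters prime_values"
  let ?r = "\<lambda>z k. prime_values \<kappa> k * z k"
  have k1: "cmod (prime_values \<kappa> k) = 1" for k
    using prime_values_in_space[OF \<kappa>] by (simp add: space_polytorus_haar)
  have mt: "twist \<kappa> \<in> character_algebra \<rightarrow>\<^sub>M character_haar"
    using measurable_twist[OF \<kappa>] measurable_cong_sets[OF sets_character_haar refl] by blast
  have mi: "?i \<in> polytorus_haar \<rightarrow>\<^sub>M character_haar"
    using measurable_the_inv measurable_cong_sets[OF refl sets_character_haar] by blast
  have eq: "twist \<kappa> (?i z) = ?i (?r z)" if z: "z \<in> space polytorus_haar" for z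
  proof -
    have "prime_values (twist \<kappa> (?i z)) = ?r z"
      using prime_values_the_inv[OF z] by (auto simp: prime_values_def twist_def fun_eq_iff)
    hence "?i (prime_values (twist \<kappa> (?i z))) = ?i (?r z)" by simp
    thus ?thesis using the_inv_prime_values[OF twist_character[OF \<kappa> the_inv_in_characters[OF z]]] by simp
  qed
  have "distr character_haar character_haar (twist \<kappa>) = distr polytorus_haar character_haar (twist \<kappa> \<circ> ?i)"
    unfolding character_haar_def
    by (subst distr_distr) (use mt measurable_the_inv in \<open>auto simp: character_haar_def\<close>)
  also have "\<dots> = distr polytorus_haar character_haar (?i \<circ> ?r)"
    by (intro distr_cong refl) (simp add: eq)
  also have "\<dots> = distr (distr polytorus_haar polytorus_haar ?r) character_haar ?i"
    by (rule distr_distr[symmetric]) (use mi measurable_polytorus_rotation[OF k1] in auto)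
  also have "\<dots> = distr polytorus_haar character_haar ?i"
    by (simp add: polytorus_haar_rotation k1)
  also have "\<dots> = character_haar"
    unfolding character_haar_def by (intro distr_cong refl) (auto simp: character_haar_def)
  finally show ?thesis .
qed

lemma integral_character_twist:
  fixes f :: "(nat \<Rightarrow> complex) \<Rightarrow> 'b :: {banach, second_countable_topology}"
  assumes "\<kappa> \<in> characters" "f \<in> borel_measurable character_haar"
  shows "(\<integral>\<gamma>. f (twist \<kappa> \<gamma>) \<partial>character_haar) = (\<integral>\<gamma>. f \<gamma> \<partial>character_haar)"
proof -
  have "(\<integral>\<gamma>. f \<gamma> \<partial>character_haar) = (\<integral>\<gamma>. f \<gamma> \<partial>distr character_haar character_haar (twist \<kappa>))"
    by (simp add: character_haar_twist assms)
  also have "\<dots> = (\<integral>\<gamma>. f (twist \<kappa> \<gamma>) \<partial>character_haar)"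
    by (rule integral_distr) (use assms measurable_twist in auto)
  finally show ?thesis by simp
qed

lemma nn_integral_character_twist:
  assumes "\<kappa> \<in> characters" "f \<in> borel_measurable character_haar"
  shows "(\<integral>\<^sup>+\<gamma>. f (twist \<kappa> \<gamma>) \<partial>character_haar) = (\<integral>\<^sup>+\<gamma>. f \<gamma> \<partial>character_haar)"
proof -
  have "(\<integral>\<^sup>+\<gamma>. f \<gamma> \<partial>character_haar) = (\<integral>\<^sup>+\<gamma>. f \<gamma> \<partial>distr character_haar character_haar (twist \<kappa>))"
    by (simp add: character_haar_twist assms)
  also have "\<dots> = (\<integral>\<^sup>+\<gamma>. f (twist \<kappa> \<gamma>) \<partial>character_haar)"
    by (rule nn_integral_distr) (use assms measurable_twist in auto)
  finally show ?thesis by simp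
qed

lemma AE_character_twist:
  assumes "\<kappa> \<in> characters" "AE \<gamma> in character_haar. P \<gamma>"
  shows "AE \<gamma> in character_haar. P (twist \<kappa> \<gamma>)"
proof (rule AE_distrD[OF measurable_twist[OF assms(1)]])
  show "AE \<gamma> in distr character_haar character_haar (twist \<kappa>). P \<gamma>"
    unfolding character_haar_twist[OF assms(1)] by (rule assms(2))
qed

text \<open>The character n^(-it). Twisting by it translates a Dirichlet series by it along the
  imaginary direction; the value at 0 follows the convention of \<open>characters\<close>.\<close>

definition vertical :: "real \<Rightarrow> nat \<Rightarrow> complex" where
  "vertical t n = (if n = 0 then 0 else cis (- t * ln (real n)))"

lemma vertical_character: "vertical t \<in> characters"
  by (auto simp: characters_def vertical_def ln_mult cis_mult algebra_simps)

lemma vertical_add: "twist (vertical s) (vertical t) = vertical (s + t)"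
  by (auto simp: twist_def vertical_def cis_mult algebra_simps)

text \<open>For m and n distinct, with \<open>L = ln n - ln m\<close>, the twist by the vertical
  character at \<open>pi / L\<close> multiplies the integrand by cis pi = -1. Haar invariance then
  makes the integral equal to its own negative.\<close>

lemma integral_character_prod:
  assumes "m \<ge> 1" "n \<ge> 1"
  shows "(\<integral>\<gamma>. \<gamma> m * cnj (\<gamma> n) \<partial>character_haar) = (if m = n then 1 else 0)"
proof (cases "m = n")
  case True
  have "(\<integral>\<gamma>. \<gamma> m * cnj (\<gamma> n) \<partial>character_haar) = (\<integral>\<gamma>. (1::complex) \<partial>character_haar)"
    using assms True by (intro Bochner_Integration.integral_cong)
      (auto simp: complex_norm_square[symmetric] norm_character)
  thus ?thesis using True prob_space.prob_space[OF prob_space_character_haar] by simp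
next
  case False
  define L where "L = ln (real n) - ln (real m)"
  have L: "L \<noteq> 0" using False assms by (auto simp: L_def)
  define \<kappa> where "\<kappa> = vertical (pi / L)"
  have \<kappa>: "\<kappa> \<in> characters" by (simp add: \<kappa>_def vertical_character)
  have "\<kappa> m * cnj (\<kappa> n) = cis (- (pi / L) * ln (real m) + (pi / L) * ln (real n))"
    using assms by (simp add: \<kappa>_def vertical_def cis_cnj cis_mult)
  also have "- (pi / L) * ln (real m) + (pi / L) * ln (real n) = (pi / L) * L"
    unfolding L_def by (simp only: algebra_simps)
  also have "\<dots> = pi" using L by simp
  finally have k: "\<kappa> m * cnj (\<kappa> n) = -1" by simp
  let ?I = "\<integral>\<gamma>. \<gamma> m * cnj (\<gamma> n) \<partial>character_haar"
  have "?I = (\<integral>\<gamma>. twist \<kappa> \<gamma> m * cnj (twist \<kappa> \<gamma> n) \<partial>character_haar)"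
    by (rule integral_character_twist[symmetric, OF \<kappa>]) measurable
  also have "\<dots> = (\<integral>\<gamma>. (\<kappa> m * cnj (\<kappa> n)) * (\<gamma> m * cnj (\<gamma> n)) \<partial>character_haar)"
    by (intro Bochner_Integration.integral_cong refl) (simp add: twist_def mult_ac)
  also have "\<dots> = - ?I" unfolding k by simp
  finally show ?thesis using False by (simp add: eq_neg_iff_add_eq_0)
qed

interpretation characters: bounded_orthonormal character_haar "\<lambda>n \<gamma>. \<gamma> n" 1
proof -
  interpret prob_space character_haar by (rule prob_space_character_haar)
  show "bounded_orthonormal character_haar (\<lambda>n \<gamma>. \<gamma> n) 1"
    by unfold_locales (auto simp: integral_character_prod norm_character)
qed

text \<open>The products \<open>\<gamma> m * cnj (\<gamma> n)\<close> are stable under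
  multiplication by \<open>\<gamma> p\<close> and its conjugate, so their annihilator is stable
  under multiplication by the real and imaginary parts of \<open>\<gamma> p\<close>; these functions
  generate the sigma-algebra. The conclusion is read off at m = n = 1, where the product is
  1.\<close>

lemma character_haar_uniqueness:
  assumes h: "integrable character_haar h"
    and z: "\<And>m n. m \<ge> 1 \<Longrightarrow> n \<ge> 1 \<Longrightarrow> (\<integral>\<gamma>. h \<gamma> * (\<gamma> m * cnj (\<gamma> n)) \<partial>character_haar) = 0"
  shows "AE \<gamma> in character_haar. h \<gamma> = 0"
proof -
  define E where "E = {\<lambda>\<gamma>::nat \<Rightarrow> complex. \<gamma> m * cnj (\<gamma> n) | m n. m \<ge> 1 \<and> n \<ge> 1}"
  define \<X> where "\<X> = {\<lambda>\<gamma>::nat \<Rightarrow> complex. Re (\<gamma> p) | p. prime p} \<union> {\<lambda>\<gamma>. Im (\<gamma> p) | p. prime p}"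
  let ?G = "{X -` C \<inter> characters |X C. X \<in> \<X> \<and> closed C}"
  have Em: "e \<in> borel_measurable character_haar" if "e \<in> E" for e
    using that by (auto simp: E_def)
  have Eb: "\<exists>K. \<forall>\<gamma>\<in>space character_haar. cmod (e \<gamma>) \<le> K" if "e \<in> E" for e
    using that by (intro exI[of _ 1]) (auto simp: E_def norm_mult norm_character)
  have mult_prime: "(\<lambda>\<gamma>. g \<gamma> * \<gamma> p) \<in> annihilator character_haar E"
      "(\<lambda>\<gamma>. g \<gamma> * cnj (\<gamma> p)) \<in> annihilator character_haar E"
    if g: "g \<in> annihilator character_haar E" and p: "prime p" for g p
  proof -
    have gi: "integrable character_haar g" using g by (auto simp: annihilator_def)
    have p1: "p \<ge> 1" using prime_ge_1_nat[OF p] .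
    have z': "(\<integral>\<gamma>. g \<gamma> * (\<gamma> m * cnj (\<gamma> n)) \<partial>character_haar) = 0" if "m \<ge> 1" "n \<ge> 1" for m n
      using g that by (auto simp: annihilator_def E_def)
    have "integrable character_haar (\<lambda>\<gamma>. g \<gamma> * \<gamma> p)"
      by (rule characters.integrable_mult_bounded[OF gi, where K = 1]) (auto simp: norm_character_le)
    moreover have "(\<integral>\<gamma>. g \<gamma> * \<gamma> p * (\<gamma> m * cnj (\<gamma> n)) \<partial>character_haar) = 0" if "m \<ge> 1" "n \<ge> 1" for m n
    proof -
      have "(\<integral>\<gamma>. g \<gamma> * \<gamma> p * (\<gamma> m * cnj (\<gamma> n)) \<partial>character_haar) =
          (\<integral>\<gamma>. g \<gamma> * (\<gamma> (p * m) * cnj (\<gamma> n)) \<partial>character_haar)"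
        by (intro Bochner_Integration.integral_cong refl) (simp add: character_mult mult_ac)
      thus ?thesis using z'[of "p * m" n] that p1 by (simp add: Suc_le_eq)
    qed
    ultimately show "(\<lambda>\<gamma>. g \<gamma> * \<gamma> p) \<in> annihilator character_haar E"
      by (auto simp: annihilator_def E_def)
    have "integrable character_haar (\<lambda>\<gamma>. g \<gamma> * cnj (\<gamma> p))"
      by (rule characters.integrable_mult_bounded[OF gi, where K = 1]) (auto simp: norm_character_le)
    moreover have "(\<integral>\<gamma>. g \<gamma> * cnj (\<gamma> p) * (\<gamma> m * cnj (\<gamma> n)) \<partial>character_haar) = 0" if "m \<ge> 1" "n \<ge> 1" for m n
    proof -
      have "(\<integral>\<gamma>. g \<gamma> * cnj (\<gamma> p) * (\<gamma> m * cnj (\<gamma> n)) \<partial>character_haar) =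
          (\<integral>\<gamma>. g \<gamma> * (\<gamma> m * cnj (\<gamma> (p * n))) \<partial>character_haar)"
        by (intro Bochner_Integration.integral_cong refl) (simp add: character_mult mult_ac)
      thus ?thesis using z'[of m "p * n"] that p1 by (simp add: Suc_le_eq)
    qed
    ultimately show "(\<lambda>\<gamma>. g \<gamma> * cnj (\<gamma> p)) \<in> annihilator character_haar E"
      by (auto simp: annihilator_def E_def)
  qed
  have Xm: "(\<lambda>\<gamma>. g \<gamma> * of_real (X \<gamma>)) \<in> annihilator character_haar E"
    if X: "X \<in> \<X>" and g: "g \<in> annihilator character_haar E" for X g
  proof -
    note ann = characters.annihilator_add[OF Em Eb] characters.annihilator_cmult[OF Em Eb]
      characters.annihilator_diff[OF Em Eb]
    from X consider p where "prime p" "X = (\<lambda>\<gamma>. Re (\<gamma> p))" | p where "prime p" "X = (\<lambda>\<gamma>. Im (\<gamma> p))"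
      by (auto simp: \<X>_def)
    thus ?thesis
    proof cases
      case 1
      have "(\<lambda>\<gamma>. (1/2) * (g \<gamma> * \<gamma> p + g \<gamma> * cnj (\<gamma> p))) \<in> annihilator character_haar E"
        by (intro ann mult_prime g 1)
      also have "(\<lambda>\<gamma>. (1/2) * (g \<gamma> * \<gamma> p + g \<gamma> * cnj (\<gamma> p))) = (\<lambda>\<gamma>. g \<gamma> * of_real (X \<gamma>))"
        by (simp add: 1(2) complex_add_cnj flip: distrib_left)
      finally show ?thesis .
    next
      case 2
      have "(\<lambda>\<gamma>. (1/(2*\<i>)) * (g \<gamma> * \<gamma> p - g \<gamma> * cnj (\<gamma> p))) \<in> annihilator character_haar E"
        by (intro ann mult_prime g 2)
      also have "(\<lambda>\<gamma>. (1/(2*\<i>)) * (g \<gamma> * \<gamma> p - g \<gamma> * cnj (\<gamma> p))) = (\<lambda>\<gamma>. g \<gamma> * of_real (X \<gamma>))"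
        by (rule ext, simp add: 2(2) complex_diff_cnj flip: right_diff_distrib, simp add: complex_eq_iff)
      finally show ?thesis .
    qed
  qed
  have gen: "A \<in> sigma_sets characters ?G" if A: "A \<in> sets character_haar" for A
  proof -
    let ?S = "sigma characters ?G"
    have G: "?G \<subseteq> Pow characters" by auto
    have m: "X \<in> borel_measurable ?S" if "X \<in> \<X>" for X
      unfolding borel_eq_closed
      by (rule measurable_measure_of) (use that G in \<open>auto simp: space_measure_of sets_measure_of\<close>)
    \<comment> \<open>Measurability of the identity map expresses that the Haar sigma-algebra is
      contained in the generated one, and it can be tested at primes.\<close>
    have "(\<lambda>\<gamma>. \<gamma>) \<in> ?S \<rightarrow>\<^sub>M character_haar"
    proof (rule measurable_character_haarI)
      show "\<gamma> \<in> characters" if "\<gamma> \<in> space ?S" for \<gamma> using that G by (simp add: space_measure_of)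
      fix p :: nat assume p: "prime p"
      have "(\<lambda>\<gamma>. Re (\<gamma> p)) \<in> borel_measurable ?S" "(\<lambda>\<gamma>. Im (\<gamma> p)) \<in> borel_measurable ?S"
        using p by - (rule m, simp only: \<X>_def, blast)+
      thus "(\<lambda>\<gamma>. \<gamma> p) \<in> borel_measurable ?S" by (simp add: borel_measurable_complex_iff)
    qed
    from measurable_sets[OF this A] have "A \<inter> characters \<in> sets ?S" using G by (simp add: space_measure_of)
    moreover have "A \<inter> characters = A" using sets.sets_into_space[OF A] by auto
    ultimately show ?thesis using G by (simp add: sets_measure_of)
  qed
  have eE: "(\<lambda>\<gamma>. \<gamma> (Suc 0) * cnj (\<gamma> (Suc 0))) \<in> E"
    unfolding E_def by (intro CollectI exI[of _ "Suc 0"]) simp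
  have hE: "h \<in> annihilator character_haar E" using h z by (auto simp: annihilator_def E_def)
  have X1: "X \<in> borel_measurable character_haar \<and> (\<exists>B. \<forall>\<gamma>\<in>space character_haar. \<bar>X \<gamma>\<bar> \<le> B)"
    if "X \<in> \<X>" for X
  proof
    show "X \<in> borel_measurable character_haar" using that by (auto simp: \<X>_def)
    have "\<bar>X \<gamma>\<bar> \<le> 1" if "\<gamma> \<in> characters" for \<gamma>
    proof -
      obtain p where "\<bar>X \<gamma>\<bar> \<le> cmod (\<gamma> p)"
        using \<open>X \<in> \<X>\<close> abs_Re_le_cmod abs_Im_le_cmod by (auto simp: \<X>_def)
      also have "\<dots> \<le> 1" by (rule norm_character_le[OF that])
      finally show ?thesis .
    qed
    thus "\<exists>B. \<forall>\<gamma>\<in>space character_haar. \<bar>X \<gamma>\<bar> \<le> B" by auto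
  qed
  have "AE \<gamma> in character_haar. h \<gamma> * (\<gamma> (Suc 0) * cnj (\<gamma> (Suc 0))) = 0"
  proof (rule characters.annihilator_eq_0[OF Em Eb X1 Xm _ hE eE])
    show "\<exists>A'\<in>sigma_sets (space character_haar) {X -` C \<inter> space character_haar |X C. X \<in> \<X> \<and> closed C}.
        AE x in character_haar. (x \<in> A) = (x \<in> A')" if "A \<in> sets character_haar" for A
      using gen[OF that] by (intro bexI[of _ A]) auto
  qed
  thus ?thesis using AE_space by eventually_elim (auto simp: character_1)
qed

section \<open>Fejer and Poisson kernels\<close>

lemma FTC_Ioi_nonneg:
  fixes f F :: "real \<Rightarrow> real"
  assumes F: "\<And>x. x > a \<Longrightarrow> (F has_real_derivative f x) (at x)"
    and f: "\<And>x. x > a \<Longrightarrow> isCont f x" and nn: "\<And>x. x > a \<Longrightarrow> 0 \<le> f x"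
    and A: "(F \<longlongrightarrow> A) (at_right a)" and B: "(F \<longlongrightarrow> B) at_top"
  shows "integrable lborel (\<lambda>x. indicator {a<..} x * f x)"
    and "(\<integral>x. indicator {a<..} x * f x \<partial>lborel) = B - A"
proof -
  have A': "((F \<circ> real_of_ereal) \<longlongrightarrow> A) (at_right (ereal a))"
    using A by (simp add: ereal_tendsto_simps)
  have B': "((F \<circ> real_of_ereal) \<longlongrightarrow> B) (at_left \<infinity>)"
    using B by (simp add: ereal_tendsto_simps)
  have e: "einterval (ereal a) \<infinity> = {a<..}" by (auto simp: einterval_def)
  note ftc = interval_integral_FTC_nonneg[of "ereal a" \<infinity> F f, OF _ _ _ _ A' B']
  have "set_integrable lborel (einterval (ereal a) \<infinity>) f"
    by (rule ftc(1)) (use F f nn in auto)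
  thus "integrable lborel (\<lambda>x. indicator {a<..} x * f x)"
    by (simp add: e set_integrable_def)
  have "(LBINT x=ereal a..\<infinity>. f x) = B - A"
    by (rule ftc(2)) (use F f nn in auto)
  thus "(\<integral>x. indicator {a<..} x * f x \<partial>lborel) = B - A"
    by (simp add: interval_lebesgue_integral_def e set_lebesgue_integral_def)
qed

lemma FTC_Ioo_nonneg:
  fixes f F :: "real \<Rightarrow> real"
  assumes "a < b"
    and F: "\<And>x. a < x \<Longrightarrow> x < b \<Longrightarrow> (F has_real_derivative f x) (at x)"
    and f: "\<And>x. a < x \<Longrightarrow> x < b \<Longrightarrow> isCont f x" and nn: "\<And>x. a < x \<Longrightarrow> x < b \<Longrightarrow> 0 \<le> f x"
    and A: "(F \<longlongrightarrow> A) (at_right a)" and B: "(F \<longlongrightarrow> B) (at_left b)"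
  shows "integrable lborel (\<lambda>x. indicator {a<..<b} x * f x)"
    and "(\<integral>x. indicator {a<..<b} x * f x \<partial>lborel) = B - A"
proof -
  have A': "((F \<circ> real_of_ereal) \<longlongrightarrow> A) (at_right (ereal a))"
    using A by (simp add: ereal_tendsto_simps)
  have B': "((F \<circ> real_of_ereal) \<longlongrightarrow> B) (at_left (ereal b))"
    using B by (simp add: ereal_tendsto_simps)
  have e: "einterval (ereal a) (ereal b) = {a<..<b}" by (auto simp: einterval_def)
  note ftc = interval_integral_FTC_nonneg[of "ereal a" "ereal b" F f, OF _ _ _ _ A' B']
  have "set_integrable lborel (einterval (ereal a) (ereal b)) f"
    by (rule ftc(1)) (use assms in auto)
  thus "integrable lborel (\<lambda>x. indicator {a<..<b} x * f x)"
    by (simp add: e set_integrable_def)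
  have "(LBINT x=ereal a..ereal b. f x) = B - A"
    by (rule ftc(2)) (use assms in auto)
  thus "(\<integral>x. indicator {a<..<b} x * f x \<partial>lborel) = B - A"
    using \<open>a < b\<close> by (simp add: interval_lebesgue_integral_def e set_lebesgue_integral_def)
qed

lemma integral_even:
  fixes f :: "real \<Rightarrow> real"
  assumes [measurable]: "f \<in> borel_measurable borel" and even: "\<And>x. f (- x) = f x"
    and i: "integrable lborel (\<lambda>x. indicator {0<..} x * f x)"
  shows "integrable lborel f"
    and "(\<integral>x. f x \<partial>lborel) = 2 * (\<integral>x. indicator {0<..} x * f x \<partial>lborel)"
proof -
  let ?g = "\<lambda>x. indicator {0<..} x * f x"
  have i': "integrable lborel (\<lambda>x. ?g (- x))"
    using lborel_integrable_real_affine[OF i, of "-1" 0] by simp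
  have ae: "AE x in lborel. f x = ?g x + ?g (- x)"
    using AE_lborel_singleton[of 0] by eventually_elim (auto simp: indicator_def even)
  show "integrable lborel f"
    by (rule integrable_cong_AE[THEN iffD2, OF _ _ ae]) (use i i' in auto)
  have "(\<integral>x. f x \<partial>lborel) = (\<integral>x. ?g x + ?g (- x) \<partial>lborel)"
    by (rule integral_cong_AE) (use ae in auto)
  also have "\<dots> = (\<integral>x. ?g x \<partial>lborel) + (\<integral>x. ?g (- x) \<partial>lborel)"
    using i i' by (rule Bochner_Integration.integral_add)
  also have "(\<integral>x. ?g (- x) \<partial>lborel) = (\<integral>x. ?g x \<partial>lborel)"
    using lborel_integral_real_affine[of "-1" ?g 0] by simp
  finally show "(\<integral>x. f x \<partial>lborel) = 2 * (\<integral>x. ?g x \<partial>lborel)" by simp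
qed

text \<open>At \<open>u = 0\<close> the value is \<open>0\<close>, since division by zero gives \<open>0\<close>.\<close>

definition fejer :: "real \<Rightarrow> real \<Rightarrow> real" where
  "fejer r u = (1 - cos (r * u)) / u\<^sup>2"

lemma fejer_measurable [measurable]: "(\<lambda>x. fejer (f x) (g x)) \<in> borel_measurable M"
  if [measurable]: "f \<in> borel_measurable M" "g \<in> borel_measurable M" for f g M
  unfolding fejer_def by measurable

lemma fejer_nonneg: "fejer r u \<ge> 0"
  by (simp add: fejer_def)

lemma fejer_even: "fejer r (- u) = fejer r u"
  by (simp add: fejer_def)

lemma one_minus_cos_le: "1 - cos x \<le> x\<^sup>2 / 2" for x :: real
proof -
  have "1 - cos x = 2 * (sin (x/2))\<^sup>2" using cos_double_sin[of "x/2"] by simp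
  also have "(sin (x/2))\<^sup>2 \<le> (x/2)\<^sup>2"
    using abs_sin_x_le_abs_x[of "x/2"] by (simp only: abs_le_square_iff)
  finally show ?thesis by (simp add: power2_eq_square)
qed

text \<open>Integration by parts: on u > 0 an antiderivative is
  \<open>Si u - (1 - cos u) / u\<close>, which rises from 0 to pi / 2, and evenness doubles
  this.\<close>

lemma fejer_1: "integrable lborel (fejer 1)" "(\<integral>u. fejer 1 u \<partial>lborel) = pi"
proof -
  have D: "((\<lambda>u. Si u - (1 - cos u) / u) has_real_derivative fejer 1 u) (at u)" if "u > 0" for u
  proof -
    have "((\<lambda>u. Si u - (1 - cos u) / u) has_real_derivative sinc u - (sin u * u - (1 - cos u)) / (u * u)) (at u)"
      using that by (auto intro!: derivative_eq_intros DERIV_Si)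
    moreover have "sinc u - (sin u * u - (1 - cos u)) / (u * u) = fejer 1 u"
      using that by (simp add: fejer_def field_simps power2_eq_square)
    ultimately show ?thesis by simp
  qed
  have "(Si \<longlongrightarrow> Si 0) (at_right 0)"
    using isCont_Si[of 0] by (auto simp: isCont_def intro: filterlim_mono[OF _ order_refl at_le])
  hence Si0: "(Si \<longlongrightarrow> 0) (at_right 0)" by (simp add: Si_def zero_ereal_def[symmetric])
  have c0: "((\<lambda>u::real. (1 - cos u) / u) \<longlongrightarrow> 0) (at_right 0)" by real_asymp
  have c1: "((\<lambda>u::real. (1 - cos u) / u) \<longlongrightarrow> 0) at_top" by real_asymp
  have A: "((\<lambda>u. Si u - (1 - cos u) / u) \<longlongrightarrow> 0) (at_right 0)"
    using tendsto_diff[OF Si0 c0] by simp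
  have B: "((\<lambda>u. Si u - (1 - cos u) / u) \<longlongrightarrow> pi / 2) at_top"
    using tendsto_diff[OF Si_at_top c1] by simp
  have cont: "isCont (fejer 1) u" if "u > 0" for u
    unfolding fejer_def using that by (intro continuous_intros) auto
  note ftc = FTC_Ioi_nonneg[OF D cont fejer_nonneg A B]
  show "integrable lborel (fejer 1)" "(\<integral>u. fejer 1 u \<partial>lborel) = pi"
    using integral_even[OF _ fejer_even ftc(1)] ftc(2) by auto
qed

text \<open>Scaling by r reduces to r = 1. Negative r occur as well, because
  \<open>fejer_cos\<close> applies this to l - r, and this is where the absolute value comes
  from.\<close>

lemma fejer_integral: "integrable lborel (fejer r)" "(\<integral>u. fejer r u \<partial>lborel) = pi * \<bar>r\<bar>"
proof -
  have "integrable lborel (fejer r) \<and> (\<integral>u. fejer r u \<partial>lborel) = pi * \<bar>r\<bar>"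
  proof (cases "r = 0")
    case True thus ?thesis by (simp add: fejer_def[abs_def])
  next
    case False
    have eq: "fejer r u = r\<^sup>2 * fejer 1 (0 + r * u)" for u
      using False by (simp add: fejer_def power_mult_distrib)
    have i: "integrable lborel (\<lambda>u. fejer 1 (0 + r * u))"
      by (rule lborel_integrable_real_affine[OF fejer_1(1)]) (use False in auto)
    have "pi = \<bar>r\<bar> * (\<integral>u. fejer 1 (0 + r * u) \<partial>lborel)"
      using lborel_integral_real_affine[of r "fejer 1" 0] False fejer_1(2) by simp
    hence v: "(\<integral>u. fejer 1 (0 + r * u) \<partial>lborel) = pi / \<bar>r\<bar>" using False by (simp add: field_simps)
    have "r\<^sup>2 * (pi / \<bar>r\<bar>) = pi * \<bar>r\<bar>" using False by (auto simp: power2_eq_square abs_if)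
    moreover have "integrable lborel (fejer r)" unfolding eq [abs_def] using i by simp
    moreover have "(\<integral>u. fejer r u \<partial>lborel) = r\<^sup>2 * (pi / \<bar>r\<bar>)" unfolding eq using i v by simp
    ultimately show ?thesis by simp
  qed
  thus "integrable lborel (fejer r)" "(\<integral>u. fejer r u \<partial>lborel) = pi * \<bar>r\<bar>" by auto
qed

text \<open>A product formula for cosines makes the integrand a second difference of Fejer kernels
  in the parameter l, so the integral is a second difference of the absolute value, which is a
  triangle.\<close>

lemma fejer_cos:
  assumes "r \<ge> 0"
  shows "integrable lborel (\<lambda>u. cos (l * u) * fejer r u)"
    and "(\<integral>u. cos (l * u) * fejer r u \<partial>lborel) = pi * max 0 (r - \<bar>l\<bar>)"
proof -
  have eq: "cos (l * u) * fejer r u = fejer (l + r) u / 2 + fejer (l - r) u / 2 - fejer l u" for u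
  proof -
    have "cos (l * u) * (1 - cos (r * u)) =
        (1 - cos ((l + r) * u)) / 2 + (1 - cos ((l - r) * u)) / 2 - (1 - cos (l * u))"
      by (simp add: distrib_right left_diff_distrib cos_add cos_diff field_simps)
    hence "cos (l * u) * (1 - cos (r * u)) * inverse (u\<^sup>2) =
       ((1 - cos ((l + r) * u)) / 2 + (1 - cos ((l - r) * u)) / 2 - (1 - cos (l * u))) * inverse (u\<^sup>2)"
      by (rule arg_cong)
    moreover have "fejer s u = (1 - cos (s * u)) * inverse (u\<^sup>2)" for s
      by (simp add: fejer_def divide_inverse)
    ultimately show ?thesis by (simp only: distrib_right left_diff_distrib mult.assoc times_divide_eq_left)
  qed
  show "integrable lborel (\<lambda>u. cos (l * u) * fejer r u)"
    unfolding eq by (intro Bochner_Integration.integrable_diff Bochner_Integration.integrable_add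
      integrable_divide fejer_integral)
  have "(\<integral>u. cos (l * u) * fejer r u \<partial>lborel) = pi * \<bar>l + r\<bar> / 2 + pi * \<bar>l - r\<bar> / 2 - pi * \<bar>l\<bar>"
    unfolding eq using fejer_integral by simp
  also have "\<dots> = pi * (\<bar>l + r\<bar> / 2 + \<bar>l - r\<bar> / 2 - \<bar>l\<bar>)" by (simp add: algebra_simps)
  also have "\<bar>l + r\<bar> / 2 + \<bar>l - r\<bar> / 2 - \<bar>l\<bar> = max 0 (r - \<bar>l\<bar>)"
    using assms by (auto simp: max_def abs_if field_simps)
  finally show "(\<integral>u. cos (l * u) * fejer r u \<partial>lborel) = pi * max 0 (r - \<bar>l\<bar>)" .
qed

lemma integral_cis_even:
  assumes K: "integrable lborel K" and even: "\<And>u. K (- u) = (K u :: real)"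
  shows "(\<integral>u. cis (l * u) * of_real (K u) \<partial>lborel) = of_real (\<integral>u. cos (l * u) * K u \<partial>lborel)"
proof -
  have [measurable]: "K \<in> borel_measurable borel" using K by auto
  have c: "integrable lborel (\<lambda>u. cos (l * u) * K u)"
    by (rule Bochner_Integration.integrable_bound[OF K])
       (auto simp: abs_mult intro!: mult_left_le_one_le)
  have s: "integrable lborel (\<lambda>u. sin (l * u) * K u)"
    by (rule Bochner_Integration.integrable_bound[OF K])
       (auto simp: abs_mult intro!: mult_left_le_one_le)
  have "(\<integral>u. sin (l * u) * K u \<partial>lborel) = (\<integral>u. sin (l * (- u)) * K (- u) \<partial>lborel)"
    using lborel_integral_real_affine[of "-1" "\<lambda>u. sin (l * u) * K u" 0] by simp
  also have "\<dots> = - (\<integral>u. sin (l * u) * K u \<partial>lborel)" by (simp add: even)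
  finally have z: "(\<integral>u. sin (l * u) * K u \<partial>lborel) = 0" by simp
  have "(\<integral>u. cis (l * u) * of_real (K u) \<partial>lborel) =
      (\<integral>u. of_real (cos (l * u) * K u) + \<i> * of_real (sin (l * u) * K u) \<partial>lborel)"
    by (intro Bochner_Integration.integral_cong refl) (simp add: complex_eq_iff)
  also have "\<dots> = of_real (\<integral>u. cos (l * u) * K u \<partial>lborel) + \<i> * of_real (\<integral>u. sin (l * u) * K u \<partial>lborel)"
    using c s by (subst Bochner_Integration.integral_add)
      (auto simp: integral_complex_of_real intro!: integrable_mult_right complex_of_real_integrable_eq[THEN iffD2] simp del: of_real_mult)
  finally show ?thesis using z by simp
qed

text \<open>The Fourier transform is \<open>1\<close> on \<open>[0, ln N]\<close> and \<open>0\<close> beyond \<open>ln (N + 1)\<close>, so integration against this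
  kernel cuts a Dirichlet series exactly at \<open>N\<close>.\<close>

definition trapezoid :: "nat \<Rightarrow> real \<Rightarrow> real" where
  "trapezoid N u = (fejer (ln (real (Suc N))) u - fejer (ln (real N)) u) / (pi * (ln (real (Suc N)) - ln (real N)))"

lemma trapezoid_measurable [measurable]: "trapezoid N \<in> borel_measurable borel"
  unfolding trapezoid_def [abs_def] by measurable

lemma trapezoid_even: "trapezoid N (- u) = trapezoid N u"
  by (simp add: trapezoid_def fejer_even)

lemma trapezoid_integrable: "integrable lborel (trapezoid N)"
  unfolding trapezoid_def [abs_def]
  by (intro integrable_divide Bochner_Integration.integrable_diff fejer_integral)

text \<open>No integer lies strictly between N and N + 1, so the sloping part of the transform is
  never sampled.\<close>

lemma trapezoid_cos:
  assumes "N \<ge> 1" "n \<ge> 1"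
  shows "(\<integral>u. cos (ln (real n) * u) * trapezoid N u \<partial>lborel) = (if n \<le> N then 1 else 0)"
proof -
  define d where "d = ln (real (Suc N)) - ln (real N)"
  have d: "d > 0" using assms by (simp add: d_def)
  have "(\<integral>u. cos (ln (real n) * u) * trapezoid N u \<partial>lborel) =
     (\<integral>u. (cos (ln (real n) * u) * fejer (ln (real (Suc N))) u - cos (ln (real n) * u) * fejer (ln (real N)) u) / (pi * d) \<partial>lborel)"
    by (intro Bochner_Integration.integral_cong refl) (simp add: trapezoid_def d_def field_simps)
  also have "\<dots> = (pi * max 0 (ln (real (Suc N)) - \<bar>ln (real n)\<bar>) - pi * max 0 (ln (real N) - \<bar>ln (real n)\<bar>)) / (pi * d)"
    using assms fejer_cos[of "ln (real (Suc N))" "ln (real n)"] fejer_cos[of "ln (real N)" "ln (real n)"]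
    by simp
  also have "\<dots> = (max 0 (ln (real (Suc N)) - ln (real n)) - max 0 (ln (real N) - ln (real n))) / d"
    using assms by (simp add: abs_of_nonneg flip: right_diff_distrib)
  also have "\<dots> = (if n \<le> N then 1 else 0)"
    using assms d by (auto simp: d_def max_def)
  finally show ?thesis .
qed

text \<open>Interpolates between the bounds x and 1 for the sine.\<close>

lemma sin_le_powr:
  fixes x \<theta> :: real
  assumes "x > 0" "0 \<le> \<theta>" "\<theta> \<le> 1"
  shows "\<bar>sin x\<bar> \<le> x powr \<theta>"
proof (cases "x \<le> 1")
  case True
  have "\<bar>sin x\<bar> \<le> x powr 1" using abs_sin_x_le_abs_x[of x] assms by simp
  also have "\<dots> \<le> x powr \<theta>" using assms True by (intro powr_mono') auto
  finally show ?thesis .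
next
  case False
  have "\<bar>sin x\<bar> \<le> 1" by simp
  also have "1 \<le> x powr \<theta>" using assms False by (intro ge_one_powr_ge_zero) auto
  finally show ?thesis .
qed

text \<open>The kernel is a product of two sines over u^2, with frequencies A (the mean of ln N and
  ln (N + 1)) and \<delta> (half their difference). On (0,1) the sines are bounded by
  \<open>(A * u) powr \<eta>\<close> and \<open>\<delta> * u\<close>, beyond 1 by 1 and
  \<open>(\<delta> * u) powr (1 - \<eta>)\<close>. The exponents make both pieces integrable and
  leave only the factors \<open>A powr \<eta>\<close> and
  \<open>\<delta> powr (- \<eta>)\<close>.\<close>

lemma trapezoid_L1:
  assumes \<eta>: "0 < \<eta>" "\<eta> \<le> 1"
  shows "\<exists>C\<ge>0. \<forall>N\<ge>1. (\<integral>u. \<bar>trapezoid N u\<bar> \<partial>lborel) \<le> C * real N powr \<eta>"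
\<comment> \<open>The 2 comes from evenness, 1 and \<open>4 powr \<eta>\<close> from
  \<open>A \<le> N\<close> and \<open>\<delta> \<ge> 1 / (4 * N)\<close>, and
  \<open>pi * \<eta>\<close> from the two power integrals.\<close>
proof (intro exI[of _ "2 * (1 + 4 powr \<eta>) / (pi * \<eta>)"] conjI allI impI)
  show "0 \<le> 2 * (1 + 4 powr \<eta>) / (pi * \<eta>)" using \<eta> by (intro divide_nonneg_nonneg) auto
  fix N :: nat assume N: "N \<ge> 1"
  define A where "A = (ln (real (Suc N)) + ln (real N)) / 2"
  define \<delta> where "\<delta> = (ln (real (Suc N)) - ln (real N)) / 2"
  have A: "0 < A" "A \<le> real N"
  proof -
    have "0 < ln (real (Suc N))" "0 \<le> ln (real N)" using N by auto
    thus "0 < A" unfolding A_def by (intro divide_pos_pos add_pos_nonneg) auto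
    have "ln (real (Suc N)) \<le> real (Suc N) - 1" "ln (real N) \<le> real N - 1"
      using N by (intro ln_le_minus_one; simp)+
    thus "A \<le> real N" by (simp add: A_def)
  qed
  have \<delta>: "0 < \<delta>" "1 / (4 * real N) \<le> \<delta>"
  proof -
    show "0 < \<delta>" using N by (simp add: \<delta>_def)
    have "ln (real N / real (Suc N)) \<le> real N / real (Suc N) - 1"
      using N by (intro ln_le_minus_one) auto
    hence "ln (real N) - ln (real (Suc N)) \<le> real N / real (Suc N) - 1"
      using N by (simp add: ln_div)
    also have "\<dots> = - 1 / real (Suc N)" by (simp add: field_simps)
    finally have "1 / real (Suc N) \<le> 2 * \<delta>" by (simp add: \<delta>_def)
    moreover have "1 / (2 * real N) \<le> 1 / real (Suc N)"
      using N by (intro divide_left_mono) auto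
    moreover have "1 / (4 * real N) = (1 / (2 * real N)) / 2" by simp
    ultimately show "1 / (4 * real N) \<le> \<delta>" by linarith
  qed
  have form: "trapezoid N u = sin (A * u) * sin (\<delta> * u) / (pi * \<delta> * u\<^sup>2)" for u
  proof -
    have "cos (ln (real N) * u) - cos (ln (real (Suc N)) * u) = 2 * (sin (A * u) * sin (\<delta> * u))"
      unfolding cos_diff_cos by (simp add: A_def \<delta>_def field_simps)
    moreover have "trapezoid N u = (cos (ln (real N) * u) - cos (ln (real (Suc N)) * u)) / (pi * (2 * \<delta>) * u\<^sup>2)"
    proof -
      have d: "ln (real (Suc N)) - ln (real N) = 2 * \<delta>" by (simp add: \<delta>_def)
      show ?thesis unfolding trapezoid_def fejer_def d
        by (simp add: diff_divide_distrib[symmetric] mult_ac del: of_nat_Suc)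
    qed
    ultimately show ?thesis by simp
  qed
  \<comment> \<open>The majorant on u > 0. At u = 1 it is 0, so the comparison holds only almost
    everywhere.\<close>
  define H where "H u = indicator {0<..<1} u * (A powr \<eta> / pi * u powr (\<eta> - 1)) +
      indicator {1<..} u * (\<delta> powr (-\<eta>) / pi * u powr (- 1 - \<eta>))" for u
  have I1: "integrable lborel (\<lambda>u. indicator {0<..<1} u * (A powr \<eta> / pi * u powr (\<eta> - 1)))"
       "(\<integral>u. indicator {0<..<1} u * (A powr \<eta> / pi * u powr (\<eta> - 1)) \<partial>lborel) = A powr \<eta> / (pi * \<eta>) - 0"
  proof -
    have D: "((\<lambda>u. A powr \<eta> / (pi * \<eta>) * u powr \<eta>) has_real_derivative A powr \<eta> / pi * u powr (\<eta> - 1)) (at u)"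
      if "u > 0" for u
    proof -
      have "((\<lambda>u. A powr \<eta> / (pi * \<eta>) * u powr \<eta>) has_real_derivative A powr \<eta> / (pi * \<eta>) * (\<eta> * u powr (\<eta> - 1))) (at u)"
        using that by (intro derivative_eq_intros refl) auto
      thus ?thesis using \<eta> by simp
    qed
    have l0: "((\<lambda>u. A powr \<eta> / (pi * \<eta>) * u powr \<eta>) \<longlongrightarrow> 0) (at_right 0)"
    proof -
      have "((\<lambda>u. u powr \<eta>) \<longlongrightarrow> 0) (at_right (0::real))" using \<eta> by real_asymp
      from tendsto_mult_left[OF this, of "A powr \<eta> / (pi * \<eta>)"] show ?thesis by simp
    qed
    have l1: "((\<lambda>u. A powr \<eta> / (pi * \<eta>) * u powr \<eta>) \<longlongrightarrow> A powr \<eta> / (pi * \<eta>)) (at_left 1)"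
      using \<eta> by (auto intro!: tendsto_eq_intros)
    note ftc = FTC_Ioo_nonneg[OF _ D _ _ l0 l1]
    show "integrable lborel (\<lambda>u. indicator {0<..<1} u * (A powr \<eta> / pi * u powr (\<eta> - 1)))"
      by (rule ftc(1)) (auto intro!: continuous_intros)
    show "(\<integral>u. indicator {0<..<1} u * (A powr \<eta> / pi * u powr (\<eta> - 1)) \<partial>lborel) = A powr \<eta> / (pi * \<eta>) - 0"
      by (rule ftc(2)) (auto intro!: continuous_intros)
  qed
  have I2: "integrable lborel (\<lambda>u. indicator {1<..} u * (\<delta> powr (-\<eta>) / pi * u powr (- 1 - \<eta>)))"
       "(\<integral>u. indicator {1<..} u * (\<delta> powr (-\<eta>) / pi * u powr (- 1 - \<eta>)) \<partial>lborel) = 0 - (- (\<delta> powr (-\<eta>)) / (pi * \<eta>))"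
  proof -
    have D: "((\<lambda>u. - (\<delta> powr (-\<eta>)) / (pi * \<eta>) * u powr (-\<eta>)) has_real_derivative \<delta> powr (-\<eta>) / pi * u powr (- 1 - \<eta>)) (at u)"
      if "u > 1" for u
    proof -
      have "((\<lambda>u. - (\<delta> powr (-\<eta>)) / (pi * \<eta>) * u powr (-\<eta>)) has_real_derivative
         - (\<delta> powr (-\<eta>)) / (pi * \<eta>) * ((-\<eta>) * u powr (-\<eta> - 1))) (at u)"
        using that by (intro derivative_eq_intros refl) auto
      moreover have "- \<eta> - 1 = - 1 - \<eta>" by simp
      ultimately show ?thesis using \<eta> by simp
    qed
    have l0: "((\<lambda>u. - (\<delta> powr (-\<eta>)) / (pi * \<eta>) * u powr (-\<eta>)) \<longlongrightarrow> - (\<delta> powr (-\<eta>)) / (pi * \<eta>)) (at_right 1)"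
      using \<eta> by (auto intro!: tendsto_eq_intros)
    have l1: "((\<lambda>u. - (\<delta> powr (-\<eta>)) / (pi * \<eta>) * u powr (-\<eta>)) \<longlongrightarrow> 0) at_top"
    proof -
      have "((\<lambda>u::real. u powr (-\<eta>)) \<longlongrightarrow> 0) at_top" using \<eta> by real_asymp
      from tendsto_mult_left[OF this, of "- (\<delta> powr (-\<eta>)) / (pi * \<eta>)"] show ?thesis by simp
    qed
    note ftc = FTC_Ioi_nonneg[OF D _ _ l0 l1]
    show "integrable lborel (\<lambda>u. indicator {1<..} u * (\<delta> powr (-\<eta>) / pi * u powr (- 1 - \<eta>)))"
      by (rule ftc(1)) (auto intro!: continuous_intros)
    show "(\<integral>u. indicator {1<..} u * (\<delta> powr (-\<eta>) / pi * u powr (- 1 - \<eta>)) \<partial>lborel) = 0 - (- (\<delta> powr (-\<eta>)) / (pi * \<eta>))"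
      by (rule ftc(2)) (auto intro!: continuous_intros)
  qed
  have Hi: "integrable lborel H" unfolding H_def [abs_def]
    by (rule Bochner_Integration.integrable_add[OF I1(1) I2(1)])
  have Hv: "(\<integral>u. H u \<partial>lborel) = (A powr \<eta> + \<delta> powr (-\<eta>)) / (pi * \<eta>)"
    unfolding H_def Bochner_Integration.integral_add[OF I1(1) I2(1)] I1(2) I2(2)
    by (simp add: add_divide_distrib)
  have bnd: "\<bar>trapezoid N u\<bar> \<le> H u" if u: "u > 0" "u \<noteq> 1" for u
  proof -
    have den: "\<bar>pi * \<delta> * u\<^sup>2\<bar> = pi * \<delta> * u\<^sup>2" using \<delta> by (simp add: abs_mult)
    show ?thesis
  proof (cases "u < 1")
    case True
    have "\<bar>sin (A * u) * sin (\<delta> * u)\<bar> \<le> (A * u) powr \<eta> * (\<delta> * u)"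
      unfolding abs_mult using sin_le_powr[of "A * u" \<eta>] abs_sin_x_le_abs_x[of "\<delta> * u"] A \<delta> u \<eta>
      by (intro mult_mono) auto
    hence "\<bar>trapezoid N u\<bar> \<le> (A * u) powr \<eta> * (\<delta> * u) / (pi * \<delta> * u\<^sup>2)"
      unfolding form abs_divide den using \<delta> by (intro divide_right_mono) auto
    also have "\<dots> = A powr \<eta> / pi * (u powr \<eta> / u)"
      using A \<delta> u by (simp add: powr_mult power2_eq_square field_simps)
    also have "\<dots> = A powr \<eta> / pi * u powr (\<eta> - 1)"
      using u by (simp add: powr_diff)
    also have "\<dots> = H u" using True u by (simp add: H_def)
    finally show ?thesis .
  next
    case False
    have "\<bar>sin (A * u) * sin (\<delta> * u)\<bar> \<le> 1 * (\<delta> * u) powr (1 - \<eta>)"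
      unfolding abs_mult using sin_le_powr[of "\<delta> * u" "1 - \<eta>"] A \<delta> u \<eta>
      by (intro mult_mono) auto
    hence "\<bar>trapezoid N u\<bar> \<le> (\<delta> * u) powr (1 - \<eta>) / (pi * \<delta> * u\<^sup>2)"
      unfolding form abs_divide den using \<delta> by (intro divide_right_mono) auto
    also have "\<dots> = (\<delta> powr (1 - \<eta>) / \<delta>) / pi * (u powr (1 - \<eta>) / u powr 2)"
      using \<delta> u by (simp add: powr_mult field_simps)
    also have "\<dots> = \<delta> powr (- \<eta>) / pi * u powr (- 1 - \<eta>)"
    proof -
      have "\<delta> powr (1 - \<eta>) / \<delta> = \<delta> powr (- \<eta>)"
        using \<delta> powr_diff[of \<delta> "1 - \<eta>" 1] by simp
      moreover have "u powr (1 - \<eta>) / u powr 2 = u powr (1 - \<eta> - 2)"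
        by (rule powr_diff[symmetric])
      moreover have "1 - \<eta> - 2 = - 1 - \<eta>" by simp
      ultimately show ?thesis by metis
    qed
    also have "\<dots> = H u" using False u by (simp add: H_def)
    finally show ?thesis .
  qed
  qed
  have ev: "(\<integral>u. \<bar>trapezoid N u\<bar> \<partial>lborel) = 2 * (\<integral>u. indicator {0<..} u * \<bar>trapezoid N u\<bar> \<partial>lborel)"
  proof (rule integral_even(2))
    show "integrable lborel (\<lambda>x. indicator {0<..} x * \<bar>trapezoid N x\<bar>)"
      by (rule Bochner_Integration.integrable_bound[OF trapezoid_integrable[of N]])
         (auto simp: abs_mult indicator_def)
  qed (auto simp: trapezoid_even)
  have "(\<integral>u. indicator {0<..} u * \<bar>trapezoid N u\<bar> \<partial>lborel) \<le> (\<integral>u. H u \<partial>lborel)"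
  proof (rule integral_mono_AE[OF _ Hi])
    show "integrable lborel (\<lambda>x. indicator {0<..} x * \<bar>trapezoid N x\<bar>)"
      by (rule Bochner_Integration.integrable_bound[OF trapezoid_integrable[of N]])
         (auto simp: abs_mult indicator_def)
    show "AE u in lborel. indicator {0<..} u * \<bar>trapezoid N u\<bar> \<le> H u"
      using AE_lborel_singleton[of 1]
    proof eventually_elim
      case (elim u)
      show ?case
      proof (cases "u > 0")
        case True thus ?thesis using bnd[of u] elim by simp
      next
        case False thus ?thesis by (simp add: H_def)
      qed
    qed
  qed
  also have "\<dots> \<le> (real N powr \<eta> + (4 * real N) powr \<eta>) / (pi * \<eta>)"
    unfolding Hv
  proof (intro divide_right_mono add_mono)
    show "A powr \<eta> \<le> real N powr \<eta>" using A \<eta> by (intro powr_mono2) auto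
    have "\<delta> powr (- \<eta>) = (1 / \<delta>) powr \<eta>" using \<delta> by (simp add: powr_minus powr_divide inverse_eq_divide)
    also have "\<dots> \<le> (4 * real N) powr \<eta>"
      using \<delta> N \<eta> by (intro powr_mono2) (auto simp: field_simps)
    finally show "\<delta> powr (- \<eta>) \<le> (4 * real N) powr \<eta>" .
  qed (use \<eta> in auto)
  also have "\<dots> = (1 + 4 powr \<eta>) / (pi * \<eta>) * real N powr \<eta>"
    by (simp add: powr_mult field_simps)
  finally have "2 * (\<integral>u. indicator {0<..} u * \<bar>trapezoid N u\<bar> \<partial>lborel) \<le>
      2 * ((1 + 4 powr \<eta>) / (pi * \<eta>) * real N powr \<eta>)" by simp
  also have "\<dots> = 2 * (1 + 4 powr \<eta>) / (pi * \<eta>) * real N powr \<eta>"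
    by (simp only: times_divide_eq_left times_divide_eq_right mult.assoc)
  finally show "(\<integral>u. \<bar>trapezoid N u\<bar> \<partial>lborel) \<le> 2 * (1 + 4 powr \<eta>) / (pi * \<eta>) * real N powr \<eta>"
    unfolding ev .
qed

section \<open>The Poisson kernel and its transform\<close>

definition poisson :: "real \<Rightarrow> real \<Rightarrow> real" where
  "poisson \<sigma> u = \<sigma> / (pi * (\<sigma>\<^sup>2 + u\<^sup>2))"

lemma poisson_measurable [measurable]: "poisson \<sigma> \<in> borel_measurable borel"
  unfolding poisson_def [abs_def] by measurable

lemma poisson_even: "poisson \<sigma> (- u) = poisson \<sigma> u"
  by (simp add: poisson_def)

lemma poisson_nonneg: "\<sigma> > 0 \<Longrightarrow> poisson \<sigma> u \<ge> 0"
  by (simp add: poisson_def)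

lemma integrable_cauchy_weight: "integrable lborel (\<lambda>u::real. 1 / (1 + u\<^sup>2))"
  using integrable_inverse_1_plus_square
  by (simp add: set_integrable_def einterval_def inverse_eq_divide)

text \<open>Makes the kernel admissible for the common weight of \<open>boundary_function\<close>.
  The constant blows up as \<sigma> tends to 0, which is harmless because it is used at fixed
  \<sigma>.\<close>

lemma poisson_le_weight:
  assumes "\<sigma> > 0"
  shows "poisson \<sigma> u \<le> ((\<sigma> + 1 / \<sigma>) / pi) * (1 / (1 + u\<^sup>2))"
proof -
  have p: "\<sigma>\<^sup>2 + u\<^sup>2 > 0" "1 + u\<^sup>2 > 0" using assms by (auto intro: add_pos_nonneg)
  have "(\<sigma> + 1 / \<sigma>) * (\<sigma>\<^sup>2 + u\<^sup>2) = \<sigma> * (1 + u\<^sup>2) + (\<sigma> ^ 3 + u\<^sup>2 / \<sigma>)"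
    using assms by (simp add: field_simps power2_eq_square power3_eq_cube)
  moreover have "\<sigma> ^ 3 + u\<^sup>2 / \<sigma> \<ge> 0" using assms by simp
  ultimately have "\<sigma> * (1 + u\<^sup>2) \<le> (\<sigma> + 1 / \<sigma>) * (\<sigma>\<^sup>2 + u\<^sup>2)" by linarith
  hence "\<sigma> / (\<sigma>\<^sup>2 + u\<^sup>2) \<le> (\<sigma> + 1 / \<sigma>) / (1 + u\<^sup>2)"
    using p by (simp add: divide_le_eq pos_le_divide_eq mult.commute)
  hence "\<sigma> / (\<sigma>\<^sup>2 + u\<^sup>2) / pi \<le> (\<sigma> + 1 / \<sigma>) / (1 + u\<^sup>2) / pi"
    by (intro divide_right_mono) auto
  thus ?thesis by (simp add: poisson_def mult.commute)
qed

lemma poisson_integrable: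
  assumes "\<sigma> > 0"
  shows "integrable lborel (poisson \<sigma>)"
proof (rule Bochner_Integration.integrable_bound)
  show "integrable lborel (\<lambda>u. ((\<sigma> + 1 / \<sigma>) / pi) * (1 / (1 + u\<^sup>2)))"
    by (rule integrable_mult_right[OF integrable_cauchy_weight])
  show "AE u in lborel. norm (poisson \<sigma> u) \<le> norm (((\<sigma> + 1 / \<sigma>) / pi) * (1 / (1 + u\<^sup>2)))"
    using poisson_le_weight[OF assms] poisson_nonneg[OF assms]
    by (intro AE_I2) (metis abs_of_nonneg order_trans real_norm_def)
qed measurable

text \<open>The Poisson kernel is a mixture of Fejer kernels, because its Fourier transform is a
  mixture of triangles.\<close>

lemma poisson_fejer:
  assumes \<sigma>: "\<sigma> > 0" and u: "u \<noteq> 0"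
  shows "integrable lborel (\<lambda>r. indicator {0<..} r * (\<sigma>\<^sup>2 * exp (- \<sigma> * r) * fejer r u / pi))"
    and "(\<integral>r. indicator {0<..} r * (\<sigma>\<^sup>2 * exp (- \<sigma> * r) * fejer r u / pi) \<partial>lborel) = poisson \<sigma> u"
proof -
  define s where "s = \<sigma>\<^sup>2 + u\<^sup>2"
  have s: "s > 0" using \<sigma> by (auto simp: s_def intro: add_pos_nonneg)
  \<comment> \<open>Antiderivative in r: the first term integrates the exponential, the second the
    exponential times \<open>cos (r * u)\<close>, where s is the squared modulus of the complex
    rate.\<close>
  define F where "F r = \<sigma>\<^sup>2 / (pi * u\<^sup>2) * (- exp (- \<sigma> * r) / \<sigma> - exp (- \<sigma> * r) * (u * sin (r * u) - \<sigma> * cos (r * u)) / s)" for r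
  have D: "(F has_real_derivative \<sigma>\<^sup>2 * exp (- \<sigma> * r) * fejer r u / pi) (at r)" for r
  proof -
    have "(F has_real_derivative \<sigma>\<^sup>2 / (pi * u\<^sup>2) * (exp (- \<sigma> * r)
        - (exp (- \<sigma> * r) * (u * (u * cos (r * u)) + \<sigma> * (u * sin (r * u)))
           - \<sigma> * exp (- \<sigma> * r) * (u * sin (r * u) - \<sigma> * cos (r * u))) / s)) (at r)"
    proof -
      have e: "((\<lambda>r. exp (- \<sigma> * r)) has_real_derivative - \<sigma> * exp (- \<sigma> * r)) (at r)"
        by (auto intro!: derivative_eq_intros)
      have w: "((\<lambda>r. u * sin (r * u) - \<sigma> * cos (r * u)) has_real_derivative
          u * (u * cos (r * u)) + \<sigma> * (u * sin (r * u))) (at r)"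
        by (auto intro!: derivative_eq_intros simp: algebra_simps)
      have "(F has_real_derivative \<sigma>\<^sup>2 / (pi * u\<^sup>2) * (- (- \<sigma> * exp (- \<sigma> * r)) / \<sigma>
        - (- \<sigma> * exp (- \<sigma> * r) * (u * sin (r * u) - \<sigma> * cos (r * u))
           + (u * (u * cos (r * u)) + \<sigma> * (u * sin (r * u))) * exp (- \<sigma> * r)) / s)) (at r)"
        unfolding F_def
        by (intro DERIV_cmult DERIV_diff DERIV_cdivide DERIV_minus DERIV_mult e w)
      moreover have "- (- \<sigma> * exp (- \<sigma> * r)) / \<sigma> = exp (- \<sigma> * r)" using \<sigma> by simp
      ultimately show ?thesis by (simp only:) (simp add: algebra_simps)
    qed
    also have "exp (- \<sigma> * r) * (u * (u * cos (r * u)) + \<sigma> * (u * sin (r * u)))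
           - \<sigma> * exp (- \<sigma> * r) * (u * sin (r * u) - \<sigma> * cos (r * u)) = s * (exp (- \<sigma> * r) * cos (r * u))"
      by (simp add: s_def power2_eq_square algebra_simps)
    also have "s * (exp (- \<sigma> * r) * cos (r * u)) / s = exp (- \<sigma> * r) * cos (r * u)"
      using s by simp
    also have "\<sigma>\<^sup>2 / (pi * u\<^sup>2) * (exp (- \<sigma> * r) - exp (- \<sigma> * r) * cos (r * u)) = \<sigma>\<^sup>2 * exp (- \<sigma> * r) * fejer r u / pi"
      using u by (simp add: fejer_def field_simps)
    finally show ?thesis .
  qed
  have A: "(F \<longlongrightarrow> F 0) (at_right 0)"
    using DERIV_isCont[OF D[of 0]] by (auto simp: isCont_def intro: filterlim_mono[OF _ order_refl at_le])
  have B: "(F \<longlongrightarrow> 0) at_top"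
  proof -
    have e: "((\<lambda>r. exp (- \<sigma> * r)) \<longlongrightarrow> 0) at_top" using \<sigma> by real_asymp
    have "((\<lambda>r. exp (- \<sigma> * r) * (u * sin (r * u) - \<sigma> * cos (r * u))) \<longlongrightarrow> 0) at_top"
    proof (rule Lim_null_comparison)
      have "norm (exp (- \<sigma> * r) * (u * sin (r * u) - \<sigma> * cos (r * u))) \<le> exp (- \<sigma> * r) * (\<bar>u\<bar> + \<bar>\<sigma>\<bar>)" for r
      proof -
        have "\<bar>u * sin (r * u) - \<sigma> * cos (r * u)\<bar> \<le> \<bar>u * sin (r * u)\<bar> + \<bar>\<sigma> * cos (r * u)\<bar>"
          by (rule abs_triangle_ineq4)
        also have "\<dots> \<le> \<bar>u\<bar> + \<bar>\<sigma>\<bar>"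
          by (intro add_mono) (auto simp: abs_mult intro!: mult_left_le)
        finally show ?thesis by (simp add: abs_mult)
      qed
      thus "\<forall>\<^sub>F r in at_top. norm (exp (- \<sigma> * r) * (u * sin (r * u) - \<sigma> * cos (r * u))) \<le> exp (- \<sigma> * r) * (\<bar>u\<bar> + \<bar>\<sigma>\<bar>)"
        by simp
      show "((\<lambda>r. exp (- \<sigma> * r) * (\<bar>u\<bar> + \<bar>\<sigma>\<bar>)) \<longlongrightarrow> 0) at_top"
        using tendsto_mult_right[OF e, of "\<bar>u\<bar> + \<bar>\<sigma>\<bar>"] by simp
    qed
    hence "(F \<longlongrightarrow> \<sigma>\<^sup>2 / (pi * u\<^sup>2) * (- 0 / \<sigma> - 0 / s)) at_top"
      unfolding F_def using e \<sigma> s by (intro tendsto_intros) auto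
    thus ?thesis by simp
  qed
  have c: "isCont (\<lambda>r. \<sigma>\<^sup>2 * exp (- \<sigma> * r) * fejer r u / pi) r" for r
    unfolding fejer_def using u by (intro continuous_intros) auto
  have nn: "\<sigma>\<^sup>2 * exp (- \<sigma> * r) * fejer r u / pi \<ge> 0" for r by (simp add: fejer_nonneg)
  note ftc = FTC_Ioi_nonneg[OF D c nn A B]
  show "integrable lborel (\<lambda>r. indicator {0<..} r * (\<sigma>\<^sup>2 * exp (- \<sigma> * r) * fejer r u / pi))"
    by (rule ftc(1))
  have "0 - F 0 = poisson \<sigma> u"
  proof -
    have alg: "0 - c * (- a - (- b)) = c * (a - b)" for a b c :: real by algebra
    have F0: "F 0 = \<sigma>\<^sup>2 / (pi * u\<^sup>2) * (- (1 / \<sigma>) - (- (\<sigma> / s)))" by (simp add: F_def)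
    have "0 - F 0 = \<sigma>\<^sup>2 / (pi * u\<^sup>2) * (1 / \<sigma> - \<sigma> / s)" unfolding F0 by (rule alg)
    also have "1 / \<sigma> - \<sigma> / s = u\<^sup>2 / (\<sigma> * s)"
      using \<sigma> s by (simp add: field_simps) (simp add: s_def power2_eq_square algebra_simps)
    also have "\<sigma>\<^sup>2 / (pi * u\<^sup>2) * (u\<^sup>2 / (\<sigma> * s)) = \<sigma> / (pi * s)"
      using u \<sigma> s by (simp add: field_simps power2_eq_square)
    finally show ?thesis by (simp add: poisson_def s_def)
  qed
  thus "(\<integral>r. indicator {0<..} r * (\<sigma>\<^sup>2 * exp (- \<sigma> * r) * fejer r u / pi) \<partial>lborel) = poisson \<sigma> u"
    using ftc(2) by simp
qed

text \<open>Taylor's formula at infinity: a convex function decaying at infinity is the mixture of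
  the functions \<open>max 0 (r - l)\<close> of l with its second derivative as density; for
  \<open>exp (- \<sigma> * r)\<close> that density is \<sigma>^2 times the function itself.\<close>

lemma exp_triangle_integral:
  fixes \<sigma> l :: real
  assumes \<sigma>: "\<sigma> > 0" and l: "l \<ge> 0"
  shows "integrable lborel (\<lambda>r. indicator {0<..} r * (\<sigma>\<^sup>2 * exp (- \<sigma> * r) * max 0 (r - l)))"
    and "(\<integral>r. indicator {0<..} r * (\<sigma>\<^sup>2 * exp (- \<sigma> * r) * max 0 (r - l)) \<partial>lborel) = exp (- \<sigma> * l)"
proof -
  define F where "F r = - \<sigma> * exp (- \<sigma> * r) * (r - l) - exp (- \<sigma> * r)" for r
  have D: "(F has_real_derivative \<sigma>\<^sup>2 * exp (- \<sigma> * r) * (r - l)) (at r)" for r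
    unfolding F_def by (auto intro!: derivative_eq_intros simp: field_simps power2_eq_square)
  have A: "(F \<longlongrightarrow> F l) (at_right l)"
    using DERIV_isCont[OF D[of l]] by (auto simp: isCont_def intro: filterlim_mono[OF _ order_refl at_le])
  have B: "(F \<longlongrightarrow> 0) at_top"
    unfolding F_def using \<sigma> by real_asymp
  have c: "isCont (\<lambda>r. \<sigma>\<^sup>2 * exp (- \<sigma> * r) * (r - l)) r" for r
    by (intro continuous_intros)
  note ftc = FTC_Ioi_nonneg[OF D c _ A B]
  have eq: "indicator {0<..} r * (\<sigma>\<^sup>2 * exp (- \<sigma> * r) * max 0 (r - l)) =
      indicator {l<..} r * (\<sigma>\<^sup>2 * exp (- \<sigma> * r) * (r - l))" for r
    using l by (auto simp: indicator_def max_def)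
  show "integrable lborel (\<lambda>r. indicator {0<..} r * (\<sigma>\<^sup>2 * exp (- \<sigma> * r) * max 0 (r - l)))"
    unfolding eq by (rule ftc(1)) auto
  have "(\<integral>r. indicator {0<..} r * (\<sigma>\<^sup>2 * exp (- \<sigma> * r) * max 0 (r - l)) \<partial>lborel) = 0 - F l"
    unfolding eq by (rule ftc(2)) auto
  thus "(\<integral>r. indicator {0<..} r * (\<sigma>\<^sup>2 * exp (- \<sigma> * r) * max 0 (r - l)) \<partial>lborel) = exp (- \<sigma> * l)"
    by (simp add: F_def)
qed

text \<open>Fubini's theorem exchanges the mixing parameter r with the variable u; inside, each
  Fejer kernel gives a triangle, and the mixture of triangles is the exponential. Absolute
  integrability is the case l = 0, as the Fejer kernels are nonnegative.\<close>

lemma poisson_cos: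
  assumes \<sigma>: "\<sigma> > 0" and l: "l \<ge> 0"
  shows "(\<integral>u. cos (l * u) * poisson \<sigma> u \<partial>lborel) = exp (- \<sigma> * l)"
proof -
  define f where "f = (\<lambda>(r, u). cos (l * u) * (indicator {0<..} r * (\<sigma>\<^sup>2 * exp (- \<sigma> * r) * fejer r u / pi)))"
  have [measurable]: "f \<in> borel_measurable (lborel \<Otimes>\<^sub>M lborel)"
    unfolding f_def by measurable
  have inner: "(\<integral>u. f (r, u) \<partial>lborel) = indicator {0<..} r * (\<sigma>\<^sup>2 * exp (- \<sigma> * r) * max 0 (r - l))"
    "integrable lborel (\<lambda>u. f (r, u))"
    "(\<integral>u. norm (f (r, u)) \<partial>lborel) \<le> indicator {0<..} r * (\<sigma>\<^sup>2 * exp (- \<sigma> * r) * max 0 (r - 0))" for r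
  proof -
    have "integrable lborel (\<lambda>u. f (r, u)) \<and>
       (\<integral>u. f (r, u) \<partial>lborel) = indicator {0<..} r * (\<sigma>\<^sup>2 * exp (- \<sigma> * r) * max 0 (r - l)) \<and>
       (\<integral>u. norm (f (r, u)) \<partial>lborel) \<le> indicator {0<..} r * (\<sigma>\<^sup>2 * exp (- \<sigma> * r) * max 0 (r - 0))"
    proof (cases "r > 0")
      case False thus ?thesis by (simp add: f_def)
    next
      case True
      have eq: "f (r, u) = (\<sigma>\<^sup>2 * exp (- \<sigma> * r) / pi) * (cos (l * u) * fejer r u)" for u
        using True by (simp add: f_def)
      have i: "integrable lborel (\<lambda>u. f (r, u))"
        unfolding eq using fejer_cos(1)[of r l] True by (intro integrable_mult_right) auto
      moreover have "(\<integral>u. f (r, u) \<partial>lborel) = (\<sigma>\<^sup>2 * exp (- \<sigma> * r) / pi) * (pi * max 0 (r - l))"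
        unfolding eq using fejer_cos[of r l] True l by simp
      moreover have "(\<integral>u. norm (f (r, u)) \<partial>lborel) \<le> (\<integral>u. (\<sigma>\<^sup>2 * exp (- \<sigma> * r) / pi) * fejer r u \<partial>lborel)"
      proof (rule integral_mono)
        show "integrable lborel (\<lambda>u. norm (f (r, u)))" using i by simp
        show "integrable lborel (\<lambda>u. (\<sigma>\<^sup>2 * exp (- \<sigma> * r) / pi) * fejer r u)"
          by (intro integrable_mult_right fejer_integral)
        show "norm (f (r, u)) \<le> (\<sigma>\<^sup>2 * exp (- \<sigma> * r) / pi) * fejer r u" for u
          unfolding eq norm_mult by (intro mult_mono) (auto simp: fejer_nonneg intro!: mult_left_le_one_le)
      qed
      moreover have "(\<integral>u. (\<sigma>\<^sup>2 * exp (- \<sigma> * r) / pi) * fejer r u \<partial>lborel) = (\<sigma>\<^sup>2 * exp (- \<sigma> * r) / pi) * (pi * r)"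
        using fejer_integral[of r] True by simp
      ultimately show ?thesis using True by simp
    qed
    thus "integrable lborel (\<lambda>u. f (r, u))"
       "(\<integral>u. f (r, u) \<partial>lborel) = indicator {0<..} r * (\<sigma>\<^sup>2 * exp (- \<sigma> * r) * max 0 (r - l))"
       "(\<integral>u. norm (f (r, u)) \<partial>lborel) \<le> indicator {0<..} r * (\<sigma>\<^sup>2 * exp (- \<sigma> * r) * max 0 (r - 0))" by auto
  qed
  have fi: "integrable (lborel \<Otimes>\<^sub>M lborel) f"
  proof (rule lborel_pair.Fubini_integrable)
    show "integrable lborel (\<lambda>r. \<integral>u. norm (f (r, u)) \<partial>lborel)"
    proof (rule Bochner_Integration.integrable_bound[OF exp_triangle_integral(1)[OF \<sigma> order_refl]])
      show "AE r in lborel. norm (\<integral>u. norm (f (r, u)) \<partial>lborel) \<le>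
          norm (indicator {0<..} r * (\<sigma>\<^sup>2 * exp (- \<sigma> * r) * max 0 (r - 0)))"
      proof (intro AE_I2)
        fix r
        have "norm (\<integral>u. norm (f (r, u)) \<partial>lborel) = (\<integral>u. norm (f (r, u)) \<partial>lborel)" by simp
        also note inner(3)[of r]
        finally show "norm (\<integral>u. norm (f (r, u)) \<partial>lborel) \<le>
          norm (indicator {0<..} r * (\<sigma>\<^sup>2 * exp (- \<sigma> * r) * max 0 (r - 0)))"
          by (rule order_trans) (simp only: real_norm_def abs_ge_self)
      qed
    qed measurable
  qed (auto simp: inner)
  have "(\<integral>u. cos (l * u) * poisson \<sigma> u \<partial>lborel) = (\<integral>u. \<integral>r. f (r, u) \<partial>lborel \<partial>lborel)"
  proof (rule integral_cong_AE)
    show "AE u in lborel. cos (l * u) * poisson \<sigma> u = (\<integral>r. f (r, u) \<partial>lborel)"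
      using AE_lborel_singleton[of 0]
    proof eventually_elim
      case (elim u)
      show ?case unfolding f_def prod.case integral_mult_right_zero poisson_fejer(2)[OF \<sigma> elim] ..
    qed
  qed measurable
  also have "\<dots> = (\<integral>r. \<integral>u. f (r, u) \<partial>lborel \<partial>lborel)"
    using lborel_pair.Fubini_integral[of "\<lambda>r u. f (r, u)"] fi by simp
  also have "\<dots> = exp (- \<sigma> * l)"
    unfolding inner by (rule exp_triangle_integral(2)[OF \<sigma> l])
  finally show ?thesis .
qed

lemma poisson_integral: "\<sigma> > 0 \<Longrightarrow> (\<integral>u. poisson \<sigma> u \<partial>lborel) = 1"
  using poisson_cos[of \<sigma> 0] by simp

text \<open>The density is minus the derivative of the kernel at h, so the kernel is a superposition
  of indicators of the intervals (-h, h).\<close>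

lemma poisson_layer_cake:
  assumes \<sigma>: "\<sigma> > 0" 
  shows "integrable lborel (\<lambda>h. indicator {\<bar>u\<bar><..} h * (2 * \<sigma> * h / (pi * (\<sigma>\<^sup>2 + h\<^sup>2)\<^sup>2)))"
    and "(\<integral>h. indicator {\<bar>u\<bar><..} h * (2 * \<sigma> * h / (pi * (\<sigma>\<^sup>2 + h\<^sup>2)\<^sup>2)) \<partial>lborel) = poisson \<sigma> u"
proof -
  define F where "F h = - \<sigma> / (pi * (\<sigma>\<^sup>2 + h\<^sup>2))" for h
  have pos: "\<sigma>\<^sup>2 + h\<^sup>2 > 0" for h using \<sigma> by (auto intro: add_pos_nonneg)
  have D: "(F has_real_derivative 2 * \<sigma> * h / (pi * (\<sigma>\<^sup>2 + h\<^sup>2)\<^sup>2)) (at h)" for h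
  proof -
    have "((\<lambda>h. 1 / (\<sigma>\<^sup>2 + h\<^sup>2)) has_real_derivative - (2 * h) / (\<sigma>\<^sup>2 + h\<^sup>2)\<^sup>2) (at h)"
      using pos[of h] by (auto intro!: derivative_eq_intros simp: power2_eq_square)
    from DERIV_cmult[OF this, of "- \<sigma> / pi"]
    show ?thesis by (simp add: F_def [abs_def] mult_ac)
  qed
  have A: "(F \<longlongrightarrow> F \<bar>u\<bar>) (at_right \<bar>u\<bar>)"
    using DERIV_isCont[OF D[of "\<bar>u\<bar>"]] by (auto simp: isCont_def intro: filterlim_mono[OF _ order_refl at_le])
  have B: "(F \<longlongrightarrow> 0) at_top" unfolding F_def using \<sigma> by real_asymp
  have c: "isCont (\<lambda>h. 2 * \<sigma> * h / (pi * (\<sigma>\<^sup>2 + h\<^sup>2)\<^sup>2)) h" for h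
    using pos[of h] by (intro continuous_intros) auto
  note ftc = FTC_Ioi_nonneg[OF D c _ A B]
  show "integrable lborel (\<lambda>h. indicator {\<bar>u\<bar><..} h * (2 * \<sigma> * h / (pi * (\<sigma>\<^sup>2 + h\<^sup>2)\<^sup>2)))"
    by (rule ftc(1)) (use \<sigma> in auto)
  have "(\<integral>h. indicator {\<bar>u\<bar><..} h * (2 * \<sigma> * h / (pi * (\<sigma>\<^sup>2 + h\<^sup>2)\<^sup>2)) \<partial>lborel) = 0 - F \<bar>u\<bar>"
    by (rule ftc(2)) (use \<sigma> in auto)
  thus "(\<integral>h. indicator {\<bar>u\<bar><..} h * (2 * \<sigma> * h / (pi * (\<sigma>\<^sup>2 + h\<^sup>2)\<^sup>2)) \<partial>lborel) = poisson \<sigma> u"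
    by (simp add: F_def poisson_def)
qed

section \<open>Radial limits of Poisson integrals\<close>

lemma bounded_set_integrable:
  fixes g :: "real \<Rightarrow> complex"
  assumes [measurable]: "g \<in> borel_measurable borel" and M: "\<And>u. cmod (g u) \<le> M"
  shows "set_integrable lborel {a..b} g"
proof -
  have "integrable lborel (\<lambda>u. indicator {a..b} u * M)"
    by (intro integrable_mult_left integrable_real_indicator) (auto simp: emeasure_lborel_Icc_eq)
  thus ?thesis unfolding set_integrable_def
    by (rule Bochner_Integration.integrable_bound)
       (auto simp: indicator_def intro: order_trans[OF M abs_ge_self])
qed

text \<open>Lebesgue differentiation over right-hand intervals. The norm stands outside the
  integral: this is differentiability of the primitive, weaker than being a Lebesgue point, and
  enough for \<open>poisson_limit\<close>.\<close>

lemma bounded_differentiation_right: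
  fixes g :: "real \<Rightarrow> complex"
  assumes [measurable]: "g \<in> borel_measurable borel" and M: "\<And>u. cmod (g u) \<le> M"
  shows "AE t in lborel. \<forall>e>0. \<exists>d>0. \<forall>h. 0 < h \<and> h < d \<longrightarrow>
           cmod ((\<integral>u. indicator {t..t+h} u *\<^sub>R (g u - g t) \<partial>lborel)) \<le> h * e"
proof -
  note si = bounded_set_integrable[OF assms]
  have "g integrable_on cbox a b" for a b
    using set_borel_integral_eq_integral(1)[OF si] by simp
  then obtain N where N: "negligible N"
    "\<And>x e. x \<notin> N \<Longrightarrow> 0 < e \<Longrightarrow> \<exists>d>0. \<forall>h. 0 < h \<and> h < d \<longrightarrow>
        norm (integral (cbox x (x + h *\<^sub>R One)) g /\<^sub>R h ^ DIM(real) - g x) < e"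
    using integrable_ccontinuous_explicit[of g] by metis
  have "AE t in lebesgue. t \<notin> N"
    using N(1) by (auto simp: negligible_iff_null_sets intro: AE_not_in)
  hence "AE t in lborel. t \<notin> N" by (simp add: AE_completion_iff)
  thus ?thesis
  proof (eventually_elim, intro allI impI)
    fix t e :: real assume t: "t \<notin> N" and e: "e > 0"
    obtain d where d: "d > 0" "\<And>h. 0 < h \<Longrightarrow> h < d \<Longrightarrow>
        norm (integral {t..t+h} g /\<^sub>R h - g t) < e" using N(2)[OF t e] by auto
    have "cmod (\<integral>u. indicator {t..t+h} u *\<^sub>R (g u - g t) \<partial>lborel) \<le> h * e" if h: "0 < h" "h < d" for h
    proof -
      have "(\<integral>u. indicator {t..t+h} u *\<^sub>R (g u - g t) \<partial>lborel) =
            (\<integral>u. indicator {t..t+h} u *\<^sub>R g u \<partial>lborel) - (\<integral>u. indicator {t..t+h} u *\<^sub>R g t \<partial>lborel)"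
        unfolding scaleR_diff_right using si[of t "t+h"]
        by (intro Bochner_Integration.integral_diff integrable_scaleR_left integrable_real_indicator)
           (auto simp: set_integrable_def emeasure_lborel_Icc_eq)
      also have "(\<integral>u. indicator {t..t+h} u *\<^sub>R g u \<partial>lborel) = integral {t..t+h} g"
        using set_borel_integral_eq_integral(2)[OF si[of t "t+h"]] by (simp add: set_lebesgue_integral_def)
      also have "(\<integral>u. indicator {t..t+h} u *\<^sub>R g t \<partial>lborel) = h *\<^sub>R g t" using h by simp
      also have "integral {t..t+h} g - h *\<^sub>R g t = h *\<^sub>R (integral {t..t+h} g /\<^sub>R h - g t)"
        using h by (simp add: scaleR_diff_right)
      also have "cmod \<dots> \<le> h * e"
        using d(2)[OF h] h by simp
      finally show ?thesis .
    qed
    thus "\<exists>d>0. \<forall>h. 0 < h \<and> h < d \<longrightarrow>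
           cmod ((\<integral>u. indicator {t..t+h} u *\<^sub>R (g u - g t) \<partial>lborel)) \<le> h * e"
      using d(1) by blast
  qed
qed

lemma AE_lborel_reflect:
  assumes "AE t in lborel. P (t::real)"
  shows "AE t in lborel. P (- t)"
proof -
  have "AE t in distr lborel borel uminus. P t"
    by (subst lborel_distr_uminus) (rule assms)
  thus ?thesis by (rule AE_distrD[rotated]) simp
qed

text \<open>A left-hand interval at t is a right-hand interval at -t for the reflected function, so
  two one-sided estimates add up to the symmetric one.\<close>

lemma bounded_differentiation:
  fixes g :: "real \<Rightarrow> complex"
  assumes [measurable]: "g \<in> borel_measurable borel" and M: "\<And>u. cmod (g u) \<le> M"
  shows "AE t in lborel. \<forall>e>0. \<exists>d>0. \<forall>h. 0 < h \<and> h < d \<longrightarrow>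
           cmod ((\<integral>u. indicator {-h<..<h} u *\<^sub>R (g (t + u) - g t) \<partial>lborel)) \<le> 2 * h * e"
proof -
  let ?g = "\<lambda>u. g (- u)"
  have R: "AE t in lborel. \<forall>e>0. \<exists>d>0. \<forall>h. 0 < h \<and> h < d \<longrightarrow>
           cmod ((\<integral>u. indicator {t..t+h} u *\<^sub>R (g u - g t) \<partial>lborel)) \<le> h * e"
    by (rule bounded_differentiation_right[OF assms])
  have L: "AE t in lborel. \<forall>e>0. \<exists>d>0. \<forall>h. 0 < h \<and> h < d \<longrightarrow>
           cmod ((\<integral>u. indicator {-t..-t+h} u *\<^sub>R (?g u - ?g (-t)) \<partial>lborel)) \<le> h * e"
    by (rule AE_lborel_reflect[OF bounded_differentiation_right[of ?g M]]) (use M in auto)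
  show ?thesis using R L
  proof (eventually_elim, intro allI impI)
    fix t e :: real
    assume r: "\<forall>e>0. \<exists>d>0. \<forall>h. 0 < h \<and> h < d \<longrightarrow>
           cmod ((\<integral>u. indicator {t..t+h} u *\<^sub>R (g u - g t) \<partial>lborel)) \<le> h * e"
      and l: "\<forall>e>0. \<exists>d>0. \<forall>h. 0 < h \<and> h < d \<longrightarrow>
           cmod ((\<integral>u. indicator {-t..-t+h} u *\<^sub>R (?g u - ?g (-t)) \<partial>lborel)) \<le> h * e"
      and e: "e > 0"
    obtain d1 where d1: "d1 > 0" "\<forall>h. 0 < h \<and> h < d1 \<longrightarrow>
           cmod ((\<integral>u. indicator {t..t+h} u *\<^sub>R (g u - g t) \<partial>lborel)) \<le> h * e"
      using r[THEN spec, THEN mp, OF e] by (elim exE conjE) (rule that)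
    obtain d2 where d2: "d2 > 0" "\<forall>h. 0 < h \<and> h < d2 \<longrightarrow>
           cmod ((\<integral>u. indicator {-t..-t+h} u *\<^sub>R (?g u - ?g (-t)) \<partial>lborel)) \<le> h * e"
      using l[THEN spec, THEN mp, OF e] by (elim exE conjE) (rule that)
    have "cmod ((\<integral>u. indicator {-h<..<h} u *\<^sub>R (g (t + u) - g t) \<partial>lborel)) \<le> 2 * h * e"
      if h: "0 < h" "h < min d1 d2" for h
    proof -
      have b: "cmod (g x - g y) \<le> 2 * M" for x y
        using norm_triangle_ineq4[of "g x" "g y"] M[of x] M[of y] by linarith
      have i1: "integrable lborel (\<lambda>u. indicator {0..h} u *\<^sub>R (g (t + u) - g t))"
        using bounded_set_integrable[of "\<lambda>u. g (t + u) - g t" "2 * M" 0 h] b by (simp add: set_integrable_def)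
      have i2: "integrable lborel (\<lambda>u. indicator {-h..0} u *\<^sub>R (g (t + u) - g t))"
        using bounded_set_integrable[of "\<lambda>u. g (t + u) - g t" "2 * M" "-h" 0] b by (simp add: set_integrable_def)
      have "(\<integral>u. indicator {-h<..<h} u *\<^sub>R (g (t + u) - g t) \<partial>lborel) =
         (\<integral>u. indicator {0..h} u *\<^sub>R (g (t + u) - g t) + indicator {-h..0} u *\<^sub>R (g (t + u) - g t) \<partial>lborel)"
      proof (rule integral_cong_AE)
        show "AE u in lborel. indicator {-h<..<h} u *\<^sub>R (g (t + u) - g t) =
            indicator {0..h} u *\<^sub>R (g (t + u) - g t) + indicator {-h..0} u *\<^sub>R (g (t + u) - g t)"
          using AE_lborel_singleton[of 0] AE_lborel_singleton[of h] AE_lborel_singleton[of "-h"]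
          by eventually_elim (auto simp: indicator_def)
      qed measurable
      also have "\<dots> = (\<integral>u. indicator {0..h} u *\<^sub>R (g (t + u) - g t) \<partial>lborel) +
           (\<integral>u. indicator {-h..0} u *\<^sub>R (g (t + u) - g t) \<partial>lborel)"
        by (rule Bochner_Integration.integral_add[OF i1 i2])
      also have "(\<integral>u. indicator {0..h} u *\<^sub>R (g (t + u) - g t) \<partial>lborel) =
          (\<integral>u. indicator {t..t+h} u *\<^sub>R (g u - g t) \<partial>lborel)"
        using lborel_integral_real_affine[of 1 "\<lambda>u. indicator {t..t+h} u *\<^sub>R (g u - g t)" t]
        by (simp add: indicator_def)
      also have "(\<integral>u. indicator {-h..0} u *\<^sub>R (g (t + u) - g t) \<partial>lborel) =
          (\<integral>u. indicator {-t..-t+h} u *\<^sub>R (?g u - ?g (-t)) \<partial>lborel)"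
      proof -
        have "indicator {-t..-t+h} (- t + - 1 * u) = (indicator {-h..0} u :: real)" for u
          by (auto simp: indicator_def)
        thus ?thesis
          using lborel_integral_real_affine[of "-1" "\<lambda>u. indicator {-t..-t+h} u *\<^sub>R (?g u - ?g (-t))" "-t"]
          by (simp add: add.commute)
      qed
      also have "cmod ((\<integral>u. indicator {t..t+h} u *\<^sub>R (g u - g t) \<partial>lborel) +
          (\<integral>u. indicator {-t..-t+h} u *\<^sub>R (?g u - ?g (-t)) \<partial>lborel)) \<le> h * e + h * e"
        using h by (intro norm_triangle_le add_mono d1(2)[rule_format] d2(2)[rule_format]) auto
      finally show ?thesis by (simp add: mult_ac)
    qed
    thus "\<exists>d>0. \<forall>h. 0 < h \<and> h < d \<longrightarrow>
           cmod ((\<integral>u. indicator {-h<..<h} u *\<^sub>R (g (t + u) - g t) \<partial>lborel)) \<le> 2 * h * e"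
      using d1(1) d2(1) by (intro exI[of _ "min d1 d2"]) auto
  qed
qed

text \<open>The lengths 2h of the layers (-h, h), weighted with their density, add up to the mass 1
  of the Poisson kernel. An antiderivative is found from the arctangent by integration by
  parts.\<close>

lemma layer_weight:
  assumes \<sigma>: "\<sigma> > 0"
  shows "integrable lborel (\<lambda>h. indicator {0<..} h * (2 * h * (2 * \<sigma> * h / (pi * (\<sigma>\<^sup>2 + h\<^sup>2)\<^sup>2))))"
    and "(\<integral>h. indicator {0<..} h * (2 * h * (2 * \<sigma> * h / (pi * (\<sigma>\<^sup>2 + h\<^sup>2)\<^sup>2))) \<partial>lborel) = 1"
proof -
  define F where "F h = (2 / pi) * (arctan (h / \<sigma>) - \<sigma> * h * (1 / (\<sigma>\<^sup>2 + h\<^sup>2)))" for h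
  have pos: "\<sigma>\<^sup>2 + h\<^sup>2 > 0" for h using \<sigma> by (auto intro: add_pos_nonneg)
  have D: "(F has_real_derivative 2 * h * (2 * \<sigma> * h / (pi * (\<sigma>\<^sup>2 + h\<^sup>2)\<^sup>2))) (at h)" for h
  proof -
    define q where "q = \<sigma>\<^sup>2 + h\<^sup>2"
    have q: "q > 0" using pos by (simp add: q_def)
    have 1: "((\<lambda>h. 1 / (\<sigma>\<^sup>2 + h\<^sup>2)) has_real_derivative - (2 * h) / q\<^sup>2) (at h)"
      using pos[of h] by (auto intro!: derivative_eq_intros simp: power2_eq_square q_def)
    have 2: "((\<lambda>h. arctan (h / \<sigma>)) has_real_derivative \<sigma> / q) (at h)"
    proof -
      have "((\<lambda>h. arctan (h / \<sigma>)) has_real_derivative (1 / \<sigma>) / (1 + (h / \<sigma>)\<^sup>2)) (at h)"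
        using \<sigma> by (auto intro!: derivative_eq_intros simp: divide_inverse)
      moreover have "(1 / \<sigma>) / (1 + (h / \<sigma>)\<^sup>2) = \<sigma> / q"
        using \<sigma> q by (simp add: q_def field_simps power2_eq_square)
      ultimately show ?thesis by simp
    qed
    have "(F has_real_derivative (2 / pi) * (\<sigma> / q - (\<sigma> * h * (- (2 * h) / q\<^sup>2) + \<sigma> * (1 / q)))) (at h)"
      unfolding F_def
      by (rule DERIV_cmult, rule DERIV_diff[OF 2], rule DERIV_cong[OF DERIV_mult[OF DERIV_cmult_Id 1]])
         (simp add: q_def)
    moreover have "(2 / pi) * (\<sigma> / q - (\<sigma> * h * (- (2 * h) / q\<^sup>2) + \<sigma> * (1 / q))) = 2 * h * (2 * \<sigma> * h / (pi * q\<^sup>2))"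
      by simp
    ultimately show ?thesis by (simp add: q_def mult_ac)
  qed
  have A: "(F \<longlongrightarrow> F 0) (at_right 0)"
    using DERIV_isCont[OF D[of 0]] by (auto simp: isCont_def intro: filterlim_mono[OF _ order_refl at_le])
  have B: "(F \<longlongrightarrow> (2 / pi) * (pi / 2 - 0)) at_top"
  proof -
    have "((\<lambda>h. arctan (h / \<sigma>)) \<longlongrightarrow> pi / 2) at_top" using \<sigma> by real_asymp
    moreover have "((\<lambda>h. \<sigma> * h * (1 / (\<sigma>\<^sup>2 + h\<^sup>2))) \<longlongrightarrow> 0) at_top" using \<sigma> by real_asymp
    ultimately show ?thesis unfolding F_def by (intro tendsto_intros)
  qed
  have c: "isCont (\<lambda>h. 2 * h * (2 * \<sigma> * h / (pi * (\<sigma>\<^sup>2 + h\<^sup>2)\<^sup>2))) h" for h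
    using pos[of h] by (intro continuous_intros) auto
  note ftc = FTC_Ioi_nonneg[OF D c _ A B]
  show "integrable lborel (\<lambda>h. indicator {0<..} h * (2 * h * (2 * \<sigma> * h / (pi * (\<sigma>\<^sup>2 + h\<^sup>2)\<^sup>2))))"
    by (rule ftc(1)) (use \<sigma> in auto)
  have "(\<integral>h. indicator {0<..} h * (2 * h * (2 * \<sigma> * h / (pi * (\<sigma>\<^sup>2 + h\<^sup>2)\<^sup>2))) \<partial>lborel) = (2 / pi) * (pi / 2 - 0) - F 0"
    by (rule ftc(2)) (use \<sigma> in auto)
  thus "(\<integral>h. indicator {0<..} h * (2 * h * (2 * \<sigma> * h / (pi * (\<sigma>\<^sup>2 + h\<^sup>2)\<^sup>2))) \<partial>lborel) = 1"
    by (simp add: F_def)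
qed

lemma inverse_square_integral:
  assumes "d > (0::real)"
  shows "integrable lborel (\<lambda>h. indicator {d<..} h * (1 / h\<^sup>2))"
    "(\<integral>h. indicator {d<..} h * (1 / h\<^sup>2) \<partial>lborel) = 1 / d"
proof -
  have D: "((\<lambda>h. - 1 / h) has_real_derivative 1 / h\<^sup>2) (at h)" if "h > d" for h
    using assms that by (auto intro!: derivative_eq_intros simp: power2_eq_square)
  have A: "((\<lambda>h. - 1 / h) \<longlongrightarrow> - 1 / d) (at_right d)"
    using assms by (auto intro!: tendsto_eq_intros)
  have B: "((\<lambda>h::real. - 1 / h) \<longlongrightarrow> 0) at_top" by real_asymp
  have c: "isCont (\<lambda>h. 1 / h\<^sup>2) h" if "h > d" for h
    using assms that by (intro continuous_intros) auto
  note ftc = FTC_Ioi_nonneg[OF D c _ A B]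
  show "integrable lborel (\<lambda>h. indicator {d<..} h * (1 / h\<^sup>2))" by (rule ftc(1)) auto
  have "(\<integral>h. indicator {d<..} h * (1 / h\<^sup>2) \<partial>lborel) = 0 - (- 1 / d)" by (rule ftc(2)) auto
  thus "(\<integral>h. indicator {d<..} h * (1 / h\<^sup>2) \<partial>lborel) = 1 / d" by simp
qed

text \<open>The Poisson kernel is an average of indicators of symmetric intervals, so symmetric
  differentiability of the integral of \<open>g\<close> suffices.\<close>

theorem poisson_limit:
  fixes g :: "real \<Rightarrow> complex"
  assumes [measurable]: "g \<in> borel_measurable borel" and M: "\<And>u. cmod (g u) \<le> M"
    and diff: "\<forall>e>0. \<exists>d>0. \<forall>h. 0 < h \<and> h < d \<longrightarrow>
           cmod ((\<integral>u. indicator {-h<..<h} u *\<^sub>R (g (t + u) - g t) \<partial>lborel)) \<le> 2 * h * e"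
  shows "((\<lambda>\<sigma>. \<integral>u. g (t + u) * of_real (poisson \<sigma> u) \<partial>lborel) \<longlongrightarrow> g t) (at_right 0)"
proof -
  define k where "k u = g (t + u) - g t" for u
  have k [measurable]: "k \<in> borel_measurable borel" unfolding k_def by measurable
  have kM: "cmod (k u) \<le> 2 * M" for u
    using norm_triangle_ineq4[of "g (t + u)" "g t"] M[of "t + u"] M[of t] unfolding k_def by linarith
  have M0: "M \<ge> 0" using M[of 0] norm_ge_zero order_trans by blast
  \<comment> \<open>With \<open>q\<close> the layer density from \<open>poisson_layer_cake\<close>,
    the Poisson integral of \<open>k\<close> becomes the integral of
    \<open>q \<sigma> h * K h\<close> over h > 0.\<close>
  define K where "K h = (\<integral>u. indicator {-h<..<h} u *\<^sub>R k u \<partial>lborel)" for h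
  define q where "q \<sigma> h = 2 * \<sigma> * h / (pi * (\<sigma>\<^sup>2 + h\<^sup>2)\<^sup>2)" for \<sigma> h :: real
  have qm [measurable]: "q \<sigma> \<in> borel_measurable borel" for \<sigma> unfolding q_def [abs_def] by measurable
  have q0: "q \<sigma> h \<ge> 0" if "\<sigma> > 0" "h > 0" for \<sigma> h using that by (simp add: q_def)
  have K4: "cmod (K h) \<le> 4 * M * h" if "h > 0" for h
  proof -
    have "cmod (K h) \<le> (\<integral>u. indicator {-h<..<h} u * (2 * M) \<partial>lborel)"
      unfolding K_def
    proof (rule Bochner_Integration.integral_norm_bound_integral)
      show "integrable lborel (\<lambda>u. indicator {-h<..<h} u *\<^sub>R k u)"
      proof (rule Bochner_Integration.integrable_bound)
        show "integrable lborel (\<lambda>u. indicator {-h<..<h} u * (2 * M))"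
          using that by (intro integrable_mult_left integrable_real_indicator) auto
        show "AE u in lborel. norm (indicator {-h<..<h} u *\<^sub>R k u) \<le> norm (indicator {-h<..<h} u * (2 * M))"
          using kM M0 by (intro AE_I2) (auto simp: indicator_def)
      qed measurable
      show "integrable lborel (\<lambda>u. indicator {-h<..<h} u * (2 * M))"
        using that by (intro integrable_mult_left integrable_real_indicator) auto
    qed (use kM in \<open>auto simp: indicator_def\<close>)
    also have "\<dots> = 4 * M * h" using that by simp
    finally show ?thesis .
  qed
  have main: "(\<integral>u. g (t + u) * of_real (poisson \<sigma> u) \<partial>lborel) - g t =
      (\<integral>h. of_real (indicator {0<..} h * q \<sigma> h) * K h \<partial>lborel) \<and>
      integrable lborel (\<lambda>h. of_real (indicator {0<..} h * q \<sigma> h) * K h)" if \<sigma>: "\<sigma> > 0" for \<sigma>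
  proof -
    define f where "f = (\<lambda>(u, h). k u * of_real (indicator {\<bar>u\<bar><..} h * q \<sigma> h))"
    have ind: "(indicator {\<bar>u\<bar><..} h :: real) = (if \<bar>u\<bar> < h then 1 else 0)" for u h :: real
      by (auto simp: indicator_def)
    have [measurable]: "f \<in> borel_measurable (lborel \<Otimes>\<^sub>M lborel)"
      unfolding f_def ind by measurable
    note lc = poisson_layer_cake[OF \<sigma>, folded q_def]
    have in1: "integrable lborel (\<lambda>h. f (u, h))" for u
      unfolding f_def prod.case by (intro integrable_mult_right integrable_of_real lc(1))
    have in2: "(\<integral>h. f (u, h) \<partial>lborel) = k u * of_real (poisson \<sigma> u)" for u
      unfolding f_def prod.case integral_mult_right_zero integral_complex_of_real lc(2) ..
    have in3: "(\<integral>h. norm (f (u, h)) \<partial>lborel) = cmod (k u) * poisson \<sigma> u" for u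
    proof -
      have "norm (f (u, h)) = cmod (k u) * (indicator {\<bar>u\<bar><..} h * q \<sigma> h)" for h
      proof -
        have "indicator {\<bar>u\<bar><..} h * q \<sigma> h \<ge> 0" using q0[OF \<sigma>, of h] by (auto simp: indicator_def)
        thus ?thesis unfolding f_def prod.case norm_mult norm_of_real by (simp only: abs_of_nonneg)
      qed
      thus ?thesis by (simp only: integral_mult_right_zero lc(2))
    qed
    have kp: "integrable lborel (\<lambda>u. cmod (k u) * poisson \<sigma> u)"
    proof (rule Bochner_Integration.integrable_bound)
      show "integrable lborel (\<lambda>u. 2 * M * poisson \<sigma> u)" using poisson_integrable[OF \<sigma>] by simp
      show "AE u in lborel. norm (cmod (k u) * poisson \<sigma> u) \<le> norm (2 * M * poisson \<sigma> u)"
        using kM M0 poisson_nonneg[OF \<sigma>] by (intro AE_I2) (auto simp: abs_mult intro!: mult_right_mono)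
    qed measurable
    have fi: "integrable (lborel \<Otimes>\<^sub>M lborel) f"
      by (rule lborel_pair.Fubini_integrable) (auto simp: in1 in3 kp)
    have fi': "integrable (lborel \<Otimes>\<^sub>M lborel) (case_prod (\<lambda>u h. f (u, h)))" using fi by simp
    have eqK: "(\<integral>u. f (u, h) \<partial>lborel) = of_real (indicator {0<..} h * q \<sigma> h) * K h" for h
    proof (cases "h > 0")
      case True
      have fe: "f (u, h) = of_real (q \<sigma> h) * (indicator {-h<..<h} u *\<^sub>R k u)" for u
        by (auto simp: f_def indicator_def)
      show ?thesis unfolding fe integral_mult_right_zero using True by (simp add: K_def)
    next
      case False
      hence "f (u, h) = 0" for u by (auto simp: f_def indicator_def)
      thus ?thesis using False by simp
    qed
    have gp: "integrable lborel (\<lambda>u. g (t + u) * of_real (poisson \<sigma> u))"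
    proof (rule Bochner_Integration.integrable_bound)
      show "integrable lborel (\<lambda>u. M * poisson \<sigma> u)" using poisson_integrable[OF \<sigma>] by simp
      show "AE u in lborel. norm (g (t + u) * of_real (poisson \<sigma> u)) \<le> norm (M * poisson \<sigma> u)"
        using M M0 poisson_nonneg[OF \<sigma>] by (intro AE_I2) (auto simp: norm_mult abs_mult intro!: mult_right_mono)
    qed measurable
    have cp: "integrable lborel (\<lambda>u. g t * of_real (poisson \<sigma> u))"
      by (intro integrable_mult_right integrable_of_real poisson_integrable \<sigma>)
    have "(\<integral>u. k u * of_real (poisson \<sigma> u) \<partial>lborel) =
       (\<integral>u. g (t + u) * of_real (poisson \<sigma> u) \<partial>lborel) - (\<integral>u. g t * of_real (poisson \<sigma> u) \<partial>lborel)"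
      unfolding k_def left_diff_distrib by (rule Bochner_Integration.integral_diff[OF gp cp])
    also have "(\<integral>u. g t * of_real (poisson \<sigma> u) \<partial>lborel) = g t"
      unfolding integral_mult_right_zero integral_complex_of_real poisson_integral[OF \<sigma>] by simp
    finally have "(\<integral>u. g (t + u) * of_real (poisson \<sigma> u) \<partial>lborel) - g t = (\<integral>u. \<integral>h. f (u, h) \<partial>lborel \<partial>lborel)"
      unfolding in2 by simp
    also have "\<dots> = (\<integral>h. \<integral>u. f (u, h) \<partial>lborel \<partial>lborel)"
      using lborel_pair.Fubini_integral[OF fi'] by simp
    also have "\<dots> = (\<integral>h. of_real (indicator {0<..} h * q \<sigma> h) * K h \<partial>lborel)" unfolding eqK ..
    finally show ?thesis
      using lborel_pair.integrable_snd[OF fi'] unfolding eqK by simp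
  qed
  \<comment> \<open>Layers with h < d contribute at most e by the hypothesis and
    \<open>layer_weight\<close>. For the others the crude bound 4Mh on \<open>K\<close> and the
    decay of \<open>q\<close> give a term linear in \<sigma>, which disappears in the limit for
    fixed d.\<close>
  have est: "\<exists>d>0. \<forall>\<sigma>>0. cmod ((\<integral>u. g (t + u) * of_real (poisson \<sigma> u) \<partial>lborel) - g t) \<le> e + 8 * M * \<sigma> / (pi * d)"
    if e: "e > 0" for e
  proof -
    obtain d where d: "d > 0" "\<forall>h. 0 < h \<and> h < d \<longrightarrow> cmod (K h) \<le> 2 * h * e"
      using diff[folded k_def, folded K_def, THEN spec, THEN mp, OF e] by (elim exE conjE) (rule that)
    show ?thesis
    \<comment> \<open>Halving d makes the open ray \<open>{d/2<..}\<close> contain the borderline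
      case h = d.\<close>
    proof (intro exI[of _ "d / 2"] conjI allI impI)
      show "d / 2 > 0" using d by simp
      fix \<sigma> :: real assume \<sigma>: "\<sigma> > 0"
      let ?W = "\<lambda>h. e * (indicator {0<..} h * (2 * h * q \<sigma> h)) + (8 * M * \<sigma> / pi) * (indicator {d/2<..} h * (1 / h\<^sup>2))"
      note lw = layer_weight[OF \<sigma>, folded q_def]
      have d2: "d / 2 > 0" using d by simp
      note isq = inverse_square_integral[OF d2]
      have i1: "integrable lborel (\<lambda>h. e * (indicator {0<..} h * (2 * h * q \<sigma> h)))"
        by (intro integrable_mult_right lw)
      have i2: "integrable lborel (\<lambda>h. (8 * M * \<sigma> / pi) * (indicator {d/2<..} h * (1 / h\<^sup>2)))"
        by (intro integrable_mult_right isq)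
      have "cmod (\<integral>h. of_real (indicator {0<..} h * q \<sigma> h) * K h \<partial>lborel) \<le> (\<integral>h. ?W h \<partial>lborel)"
      proof (rule Bochner_Integration.integral_norm_bound_integral)
        show "integrable lborel ?W" by (rule Bochner_Integration.integrable_add[OF i1 i2])
        show "integrable lborel (\<lambda>h. of_real (indicator {0<..} h * q \<sigma> h) * K h)" using main[OF \<sigma>] by simp
        fix h :: real
        show "norm (of_real (indicator {0<..} h * q \<sigma> h) * K h) \<le> ?W h"
        proof (cases "h > 0")
          case False
          hence "?W h = 0" using d by (auto simp: indicator_def)
          moreover have "norm (of_real (indicator {0<..} h * q \<sigma> h) * K h) = 0" using False by simp
          ultimately show ?thesis by (simp only: order_refl)
        next
          case h: True
          have n: "norm (of_real (indicator {0<..} h * q \<sigma> h) * K h) = q \<sigma> h * cmod (K h)"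
            using h q0[OF \<sigma> h] by (simp add: norm_mult)
          show ?thesis
          proof (cases "h < d")
            case True
            have "q \<sigma> h * cmod (K h) \<le> q \<sigma> h * (2 * h * e)"
              using d(2)[rule_format, of h] h True q0[OF \<sigma> h] by (intro mult_left_mono) auto
            also have "\<dots> \<le> ?W h" using h \<sigma> M0 by (simp add: mult_ac)
            finally show ?thesis unfolding n .
          next
            case False
            have "q \<sigma> h \<le> 2 * \<sigma> * h / (pi * (h\<^sup>2)\<^sup>2)"
              unfolding q_def using \<sigma> h by (intro divide_left_mono mult_left_mono power_mono mult_pos_pos zero_less_power) (auto intro: add_pos_pos)
            hence "q \<sigma> h * cmod (K h) \<le> 2 * \<sigma> * h / (pi * (h\<^sup>2)\<^sup>2) * (4 * M * h)"
              using K4[OF h] q0[OF \<sigma> h] h \<sigma> by (intro mult_mono) auto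
            also have "\<dots> = (8 * M * \<sigma> / pi) * (1 / h\<^sup>2)"
              using h by (simp add: field_simps power2_eq_square)
            also have "\<dots> \<le> ?W h" using h False d e q0[OF \<sigma> h] by (simp add: indicator_def)
            finally show ?thesis unfolding n .
          qed
        qed
      qed
      also have "(\<integral>h. ?W h \<partial>lborel) = e + 8 * M * \<sigma> / (pi * (d / 2))"
        unfolding Bochner_Integration.integral_add[OF i1 i2] integral_mult_right_zero lw(2) isq(2)
        using d by simp
      finally show "cmod ((\<integral>u. g (t + u) * of_real (poisson \<sigma> u) \<partial>lborel) - g t) \<le> e + 8 * M * \<sigma> / (pi * (d / 2))"
        using main[OF \<sigma>] by simp
    qed
  qed
  show ?thesis
  proof (rule tendstoI)
    fix e :: real assume e: "e > 0"
    obtain d where d: "d > 0" "\<And>\<sigma>. \<sigma> > 0 \<Longrightarrow>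
        cmod ((\<integral>u. g (t + u) * of_real (poisson \<sigma> u) \<partial>lborel) - g t) \<le> e / 2 + 8 * M * \<sigma> / (pi * d)"
      using est[of "e / 2"] e by auto
    have "((\<lambda>\<sigma>. e / 2 + 8 * M * \<sigma> / (pi * d)) \<longlongrightarrow> e / 2 + 8 * M * 0 / (pi * d)) (at_right 0)"
      using d by (intro tendsto_intros) auto
    hence "\<forall>\<^sub>F \<sigma> in at_right 0. e / 2 + 8 * M * \<sigma> / (pi * d) < e"
      by (rule order_tendstoD(2)) (use e in simp)
    moreover have "\<forall>\<^sub>F \<sigma> in at_right (0::real). \<sigma> > 0" by (simp add: eventually_at_filter)
    ultimately show "\<forall>\<^sub>F \<sigma> in at_right 0. dist (\<integral>u. g (t + u) * of_real (poisson \<sigma> u) \<partial>lborel) (g t) < e"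
      by eventually_elim (use d(2) in \<open>fastforce simp: dist_norm\<close>)
  qed
qed

section \<open>Dirichlet series with a bounded boundary function\<close>

definition coeff_sum :: "(nat \<Rightarrow> complex) \<Rightarrow> nat \<Rightarrow> complex" where
  "coeff_sum b N = (\<Sum>n=1..N. b n)"

lemma dirichlet_term_vertical:
  "dirichlet_term (twist b (vertical t)) s n = dirichlet_term b (s + \<i> * of_real t) n"
proof -
  have "vertical t (Suc n) = of_nat (Suc n) powr (- (\<i> * of_real t))"
  proof -
    have "of_nat (Suc n) powr (- (\<i> * of_real t)) = exp (- (\<i> * of_real t) * ln (of_nat (Suc n)))"
      by (simp add: powr_def del: of_nat_Suc)
    also have "ln (of_nat (Suc n) :: complex) = of_real (ln (real (Suc n)))"
      using Ln_of_real[of "real (Suc n)"] by simp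
    finally show ?thesis
      by (simp add: vertical_def cis_conv_exp mult_ac del: of_nat_Suc)
  qed
  moreover have "- (s + \<i> * of_real t) = - (\<i> * of_real t) + - s" by simp
  ultimately show ?thesis
    unfolding dirichlet_term_def twist_def by (simp only: powr_add mult.assoc)
qed

text \<open>\<open>dirichlet_term\<close> counts from 0, so N terms carry the coefficients 1 to N
  and the boundary factor sits at N + 1.\<close>

lemma abel_summation:
  "(\<Sum>n<N. dirichlet_term b s n) = coeff_sum b N * of_nat (Suc N) powr (- s) +
     (\<Sum>n<N. coeff_sum b (Suc n) * (of_nat (Suc n) powr (- s) - of_nat (Suc (Suc n)) powr (- s)))"
proof (induction N)
  case 0 thus ?case by (simp add: coeff_sum_def)
next
  case (Suc N)
  have "coeff_sum b (Suc N) = coeff_sum b N + b (Suc N)"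
    by (simp add: coeff_sum_def)
  thus ?case using Suc by (simp add: dirichlet_term_def algebra_simps del: of_nat_Suc)
qed

text \<open>Mean value inequality on the segment from k to k + 1, where the derivative is largest in
  modulus at k.\<close>

lemma powr_diff_bound:
  assumes k: "k \<ge> 1" and s: "Re s \<ge> 0"
  shows "cmod (of_nat k powr (- s) - of_nat (Suc k) powr (- s)) \<le> cmod s * real k powr (- Re s - 1)"
proof -
  let ?S = "closed_segment (of_nat k :: complex) (of_nat (Suc k))"
  have seg: "z \<in> \<real> \<and> Re z \<ge> real k" if "z \<in> ?S" for z
  proof -
    from that obtain u where u: "0 \<le> u" "u \<le> 1" "z = (1 - u) *\<^sub>R of_nat k + u *\<^sub>R of_nat (Suc k)"
      by (auto simp: in_segment)
    have "z = of_real (real k + u)" by (simp add: u(3) complex_eq_iff algebra_simps)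
    thus ?thesis using u by auto
  qed
  have "cmod (of_nat k powr (- s) - of_nat (Suc k) powr (- s)) \<le>
      (cmod s * real k powr (- Re s - 1)) * cmod (of_nat k - of_nat (Suc k))"
  proof (rule field_differentiable_bound[where f = "\<lambda>z. z powr (- s)" and f' = "\<lambda>z. (- s) * z powr (- s - 1)" and S = ?S])
    fix z assume z: "z \<in> ?S"
    have r: "z \<in> \<real>" "Re z \<ge> real k" "Re z > 0" using seg[OF z] k by auto
    hence "z \<notin> \<real>\<^sub>\<le>\<^sub>0" by (auto simp: complex_nonpos_Reals_iff)
    thus "((\<lambda>z. z powr (- s)) has_field_derivative (- s) * z powr (- s - 1)) (at z within ?S)"
      by (rule has_field_derivative_at_within[OF has_field_derivative_powr])
    have "cmod (z powr (- s - 1)) = Re z powr (- Re s - 1)"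
      using r by (simp add: norm_powr_real_powr)
    also have "\<dots> \<le> real k powr (- Re s - 1)"
      using r k s by (intro powr_mono2') auto
    finally show "cmod (- s * z powr (- s - 1)) \<le> cmod s * real k powr (- Re s - 1)"
      by (simp add: norm_mult mult_left_mono)
  qed auto
  also have "cmod (of_nat k - of_nat (Suc k) :: complex) = 1" by simp
  finally show ?thesis by simp
qed

lemma abel_term_bound:
  assumes S: "\<And>N. N \<ge> 1 \<Longrightarrow> cmod (coeff_sum b N) \<le> C * real N powr \<eta>" and C: "C \<ge> 0" and s: "Re s \<ge> 0"
  shows "cmod (coeff_sum b (Suc n) * (of_nat (Suc n) powr (- s) - of_nat (Suc (Suc n)) powr (- s)))
     \<le> C * cmod s * real (Suc n) powr (\<eta> - Re s - 1)"
proof -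
  have "cmod (coeff_sum b (Suc n) * (of_nat (Suc n) powr (- s) - of_nat (Suc (Suc n)) powr (- s)))
     \<le> (C * real (Suc n) powr \<eta>) * (cmod s * real (Suc n) powr (- Re s - 1))"
    unfolding norm_mult by (intro mult_mono S powr_diff_bound) (use C s in auto)
  also have "\<dots> = C * cmod s * (real (Suc n) powr \<eta> * real (Suc n) powr (- Re s - 1))"
    by (simp only: mult_ac)
  also have "real (Suc n) powr \<eta> * real (Suc n) powr (- Re s - 1) = real (Suc n) powr (\<eta> - Re s - 1)"
    by (subst powr_add[symmetric]) (simp add: algebra_simps)
  finally show ?thesis .
qed

lemma summable_powr_Suc: "x < -1 \<Longrightarrow> summable (\<lambda>n. real (Suc n) powr x)"
  using summable_real_powr_iff[of x] summable_Suc_iff[of "\<lambda>n. real n powr x"]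
  by (simp del: of_nat_Suc)

text \<open>The boundary term is of order N^(\<eta> - Re s), and the transformed terms of order
  n^(\<eta> - Re s - 1) are absolutely summable.\<close>

lemma dirichlet_abel:
  assumes S: "\<And>N. N \<ge> 1 \<Longrightarrow> cmod (coeff_sum b N) \<le> C * real N powr \<eta>" and C: "C \<ge> 0"
    and s: "0 \<le> \<eta>" "\<eta> < Re s"
  shows "dirichlet_term b s sums (\<Sum>n. coeff_sum b (Suc n) * (of_nat (Suc n) powr (- s) - of_nat (Suc (Suc n)) powr (- s)))"
proof -
  let ?T = "\<lambda>n. coeff_sum b (Suc n) * (of_nat (Suc n) powr (- s) - of_nat (Suc (Suc n)) powr (- s))"
  have "summable ?T"
  proof (rule summable_comparison_test')
    show "summable (\<lambda>n. C * cmod s * real (Suc n) powr (\<eta> - Re s - 1))"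
      by (intro summable_mult summable_powr_Suc) (use s in auto)
    show "cmod (?T n) \<le> C * cmod s * real (Suc n) powr (\<eta> - Re s - 1)" if "n \<ge> 0" for n
      by (rule abel_term_bound[OF S C]) (use s in auto)
  qed
  hence T: "(\<lambda>N. \<Sum>n<N. ?T n) \<longlonglongrightarrow> suminf ?T" by (rule summable_LIMSEQ)
  have "(\<lambda>N. coeff_sum b N * of_nat (Suc N) powr (- s)) \<longlonglongrightarrow> 0"
  proof (rule Lim_null_comparison)
    show "\<forall>\<^sub>F N in sequentially. cmod (coeff_sum b N * of_nat (Suc N) powr (- s)) \<le> C * real N powr (\<eta> - Re s)"
      using eventually_ge_at_top[of 1]
    proof eventually_elim
      case (elim N)
      have "cmod (of_nat (Suc N) powr (- s)) = real (Suc N) powr (- Re s)"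
        using norm_powr_real_powr[of "of_nat (Suc N)" "- s"] by simp
      also have "\<dots> \<le> real N powr (- Re s)"
        using elim s by (intro powr_mono2') auto
      finally have "cmod (coeff_sum b N * of_nat (Suc N) powr (- s)) \<le> (C * real N powr \<eta>) * real N powr (- Re s)"
        unfolding norm_mult using S[OF elim] C by (intro mult_mono) auto
      also have "\<dots> = C * real N powr (\<eta> - Re s)"
        by (simp add: powr_add[symmetric] mult.assoc)
      finally show ?case .
    qed
    have "(\<lambda>N. real N powr (\<eta> - Re s)) \<longlonglongrightarrow> 0" using s by real_asymp
    from tendsto_mult_left[OF this, of C] show "(\<lambda>N. C * real N powr (\<eta> - Re s)) \<longlonglongrightarrow> 0" by simp
  qed
  from tendsto_add[OF this T] show ?thesis
    unfolding sums_def abel_summation by simp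
qed

text \<open>By Abel summation this growth condition puts the abscissa of convergence at 0 or below.
  The range of \<eta> is that of \<open>trapezoid_L1\<close>; small exponents are the strong
  ones.\<close>

definition subpolynomial_sums :: "(nat \<Rightarrow> complex) \<Rightarrow> bool" where
  "subpolynomial_sums b \<longleftrightarrow> (\<forall>\<eta>. 0 < \<eta> \<and> \<eta> \<le> 1 \<longrightarrow> (\<exists>C\<ge>0. \<forall>N\<ge>1. cmod (coeff_sum b N) \<le> C * real N powr \<eta>))"

lemma subpolynomial_summable:
  assumes b: "subpolynomial_sums b" and s: "Re s > 0"
  shows "summable (dirichlet_term b s)"
proof -
  define \<eta> where "\<eta> = min 1 (Re s / 2)"
  have \<eta>: "0 < \<eta>" "\<eta> \<le> 1" "\<eta> < Re s" using s by (auto simp: \<eta>_def)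
  then obtain C where "C \<ge> 0" "\<And>N. N \<ge> 1 \<Longrightarrow> cmod (coeff_sum b N) \<le> C * real N powr \<eta>"
    using b unfolding subpolynomial_sums_def by meson
  from dirichlet_abel[OF this(2,1)] \<eta> show ?thesis by (auto simp: sums_iff)
qed

text \<open>The majorant test is applied to the Abel transformed series, because the Dirichlet
  series itself may converge only conditionally. On the disc of radius d = Re z / 2 the real part
  stays at least d, and \<eta> is taken below d.\<close>

lemma subpolynomial_holomorphic:
  assumes b: "subpolynomial_sums b"
  shows "dirichlet_sum b holomorphic_on {s. Re s > 0}"
proof -
  let ?T = "\<lambda>n s. coeff_sum b (Suc n) * (of_nat (Suc n) powr (- s) - of_nat (Suc (Suc n)) powr (- s))"
  have op: "open {s. Re s > 0}" by (rule open_halfspace_Re_gt)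
  show ?thesis
  proof (rule holomorphic_uniform_sequence[OF op])
    show "(\<lambda>s. \<Sum>n<N. ?T n s) holomorphic_on {s. Re s > 0}" for N :: nat
      by (intro holomorphic_intros)
    fix z assume z: "z \<in> {s. Re s > 0}"
    define d where "d = Re z / 2"
    define \<eta> where "\<eta> = min 1 (d / 2)"
    have d: "d > 0" using z by (simp add: d_def)
    have \<eta>: "0 < \<eta>" "\<eta> \<le> 1" "\<eta> < d" using d by (auto simp: \<eta>_def)
    then obtain C where C: "C \<ge> 0" "\<And>N. N \<ge> 1 \<Longrightarrow> cmod (coeff_sum b N) \<le> C * real N powr \<eta>"
      using b unfolding subpolynomial_sums_def by meson
    have ball: "Re s \<ge> d \<and> cmod s \<le> cmod z + d" if "s \<in> cball z d" for s
    proof -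
      have n: "cmod (z - s) \<le> d" using that by (simp add: dist_norm)
      have "Re z - Re s \<le> d" using abs_Re_le_cmod[of "z - s"] n by simp
      moreover have "cmod s \<le> cmod z + cmod (z - s)" using norm_triangle_ineq4[of z "z - s"] by simp
      ultimately show ?thesis using n by (simp add: d_def)
    qed
    have "uniform_limit (cball z d) (\<lambda>N s. \<Sum>n<N. ?T n s) (\<lambda>s. \<Sum>n. ?T n s) sequentially"
    proof (rule Weierstrass_m_test)
      show "summable (\<lambda>n. C * (cmod z + d) * real (Suc n) powr (\<eta> - d - 1))"
        by (intro summable_mult summable_powr_Suc) (use \<eta> in auto)
      fix n s assume s: "s \<in> cball z d"
      have "cmod (?T n s) \<le> C * cmod s * real (Suc n) powr (\<eta> - Re s - 1)"
        by (rule abel_term_bound[OF C(2,1)]) (use ball[OF s] d in auto)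
      also have "\<dots> \<le> C * (cmod z + d) * real (Suc n) powr (\<eta> - d - 1)"
        using ball[OF s] C d by (intro mult_mono powr_mono) auto
      finally show "cmod (?T n s) \<le> C * (cmod z + d) * real (Suc n) powr (\<eta> - d - 1)" .
    qed
    also have "?this \<longleftrightarrow> uniform_limit (cball z d) (\<lambda>N s. \<Sum>n<N. ?T n s) (dirichlet_sum b) sequentially"
    proof (rule uniform_limit_cong')
      fix s assume s: "s \<in> cball z d"
      have "dirichlet_term b s sums (\<Sum>n. ?T n s)"
        by (rule dirichlet_abel[OF C(2,1)]) (use ball[OF s] \<eta> in auto)
      thus "(\<Sum>n. ?T n s) = dirichlet_sum b s" by (simp add: dirichlet_sum_def sums_iff)
    qed auto
    finally have "uniform_limit (cball z d) (\<lambda>N s. \<Sum>n<N. ?T n s) (dirichlet_sum b) sequentially" .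
    moreover have "cball z d \<subseteq> {s. Re s > 0}" using ball d by fastforce
    ultimately show "\<exists>d>0. cball z d \<subseteq> {s. Re s > 0} \<and>
        uniform_limit (cball z d) (\<lambda>N s. \<Sum>n<N. ?T n s) (dirichlet_sum b) sequentially"
      using d by blast
  qed
qed

text \<open>A growth constant common to all j dominates the Abel transformed series uniformly, so
  Tannery's theorem exchanges the limit with the sum.\<close>

lemma dirichlet_sum_tendsto:
  assumes lim: "\<And>n. n \<ge> 1 \<Longrightarrow> (\<lambda>j. b j n) \<longlonglongrightarrow> c n"
    and S: "\<And>j N. N \<ge> 1 \<Longrightarrow> cmod (coeff_sum (b j) N) \<le> C * real N powr \<eta>" and C: "C \<ge> 0"
    and s: "0 \<le> \<eta>" "\<eta> < Re s"
  shows "(\<lambda>j. dirichlet_sum (b j) s) \<longlonglongrightarrow> dirichlet_sum c s"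
proof -
  let ?T = "\<lambda>b n. coeff_sum b (Suc n) * (of_nat (Suc n) powr (- s) - of_nat (Suc (Suc n)) powr (- s))"
  have cl: "(\<lambda>j. coeff_sum (b j) N) \<longlonglongrightarrow> coeff_sum c N" for N
    unfolding coeff_sum_def by (intro tendsto_sum lim) auto
  have Sc: "cmod (coeff_sum c N) \<le> C * real N powr \<eta>" if "N \<ge> 1" for N
    by (rule LIMSEQ_le_const2[OF tendsto_norm[OF cl]]) (use S[OF that] in auto)
  have e: "dirichlet_sum (b j) s = (\<Sum>n. ?T (b j) n)" for j
    using dirichlet_abel[OF S C s] by (simp add: dirichlet_sum_def sums_iff)
  have e': "dirichlet_sum c s = (\<Sum>n. ?T c n)"
    using dirichlet_abel[OF Sc C s] by (simp add: dirichlet_sum_def sums_iff)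
  have "(\<lambda>j. \<Sum>n. ?T (b j) n) \<longlonglongrightarrow> (\<Sum>n. ?T c n)"
  proof (rule tannerys_theorem[THEN conjunct2, THEN conjunct2])
    show "(\<lambda>j. ?T (b j) k) \<longlonglongrightarrow> ?T c k" for k by (intro tendsto_intros cl)
    show "\<forall>\<^sub>F (k, j) in at_top \<times>\<^sub>F sequentially. cmod (?T (b j) k) \<le> C * cmod s * real (Suc k) powr (\<eta> - Re s - 1)"
    proof (intro always_eventually allI, clarify)
      fix k j
      show "cmod (?T (b j) k) \<le> C * cmod s * real (Suc k) powr (\<eta> - Re s - 1)"
        by (rule abel_term_bound[OF S C]) (use s in auto)
    qed
    show "summable (\<lambda>k. C * cmod s * real (Suc k) powr (\<eta> - Re s - 1))"
      by (intro summable_mult summable_powr_Suc) (use s in auto)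
  qed auto
  thus ?thesis by (simp only: e e')
qed

text \<open>Sum of the bound r^2 / 2 for the kernel and the bound 2 for u^2 times the
  kernel.\<close>

lemma fejer_weight: "fejer r u \<le> (r\<^sup>2 / 2 + 2) * (1 / (1 + u\<^sup>2))"
proof (cases "u = 0")
  case True thus ?thesis by (simp add: fejer_def)
next
  case False
  have p: "1 + u\<^sup>2 > 0" by (auto intro: add_pos_nonneg)
  have "fejer r u * u\<^sup>2 = 1 - cos (r * u)" using False by (simp add: fejer_def)
  also have "\<dots> \<le> 2" using cos_ge_minus_one[of "r * u"] by linarith
  finally have 1: "fejer r u * u\<^sup>2 \<le> 2" .
  have "1 - cos (r * u) \<le> r\<^sup>2 / 2 * u\<^sup>2"
    using one_minus_cos_le[of "r * u"] by (simp add: power_mult_distrib)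
  hence 2: "fejer r u \<le> r\<^sup>2 / 2" using False by (simp add: fejer_def divide_le_eq)
  have "fejer r u * (1 + u\<^sup>2) \<le> r\<^sup>2 / 2 + 2" using 1 2 by (simp add: distrib_left)
  thus ?thesis using p by (simp add: pos_le_divide_eq)
qed

lemma trapezoid_weight: "\<exists>C. \<forall>u. \<bar>trapezoid N u\<bar> \<le> C * (1 / (1 + u\<^sup>2))"
proof -
  define c where "c = \<bar>pi * (ln (real (Suc N)) - ln (real N))\<bar>"
  define A where "A = (ln (real (Suc N)))\<^sup>2 / 2 + 2"
  define B where "B = (ln (real N))\<^sup>2 / 2 + 2"
  have "\<bar>trapezoid N u\<bar> \<le> ((A + B) / c) * (1 / (1 + u\<^sup>2))" for u
  proof -
    have "\<bar>fejer (ln (real (Suc N))) u - fejer (ln (real N)) u\<bar> \<le> A * (1 / (1 + u\<^sup>2)) + B * (1 / (1 + u\<^sup>2))"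
      using fejer_weight[of "ln (real (Suc N))" u] fejer_weight[of "ln (real N)" u]
        fejer_nonneg[of "ln (real (Suc N))" u] fejer_nonneg[of "ln (real N)" u]
      unfolding A_def B_def by linarith
    hence "\<bar>trapezoid N u\<bar> \<le> (A * (1 / (1 + u\<^sup>2)) + B * (1 / (1 + u\<^sup>2))) / c"
      unfolding trapezoid_def abs_divide c_def by (intro divide_right_mono) auto
    moreover have "(A * w + B * w) / c = (A + B) / c * w" for w
      by (simp add: add_divide_distrib distrib_right)
    ultimately show ?thesis by (simp only:)
  qed
  thus ?thesis by blast
qed

text \<open>Rests on \<open>1 + u^2 \<le> 2 * (1 + t^2) * (1 + (u - t)^2)\<close>: translating a
  kernel costs only a constant depending on t.\<close>

lemma weight_shift:
  assumes "\<And>u. \<bar>K u\<bar> \<le> C * (1 / (1 + u\<^sup>2))"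
  shows "\<bar>K (u - t)\<bar> \<le> C * (2 + 2 * t\<^sup>2) * (1 / (1 + (u::real)\<^sup>2))"
proof -
  have C: "C \<ge> 0" using order_trans[OF abs_ge_zero assms[of 0]] by simp
  define v where "v = u - t"
  have "0 \<le> (v - t)\<^sup>2" by simp
  hence "u\<^sup>2 \<le> 2 * v\<^sup>2 + 2 * t\<^sup>2" unfolding v_def by (simp add: power2_eq_square algebra_simps)
  moreover have "(2 + 2 * t\<^sup>2) * (1 + v\<^sup>2) = 2 + 2 * t\<^sup>2 + 2 * v\<^sup>2 + 2 * t\<^sup>2 * v\<^sup>2" by (simp add: algebra_simps)
  moreover have "t\<^sup>2 * v\<^sup>2 \<ge> 0" by simp
  ultimately have le: "1 + u\<^sup>2 \<le> (2 + 2 * t\<^sup>2) * (1 + v\<^sup>2)" by linarith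
  have p: "1 + u\<^sup>2 > 0" "1 + v\<^sup>2 > 0" by (auto intro: add_pos_nonneg)
  have "1 / (1 + v\<^sup>2) \<le> (2 + 2 * t\<^sup>2) * (1 / (1 + u\<^sup>2))"
    using le p by (simp add: field_simps)
  hence "C * (1 / (1 + v\<^sup>2)) \<le> C * ((2 + 2 * t\<^sup>2) * (1 / (1 + u\<^sup>2)))" using C by (rule mult_left_mono)
  with assms[of v] show ?thesis unfolding v_def by (simp only: mult.assoc)
qed

lemma vertical_measurable [measurable]: "(\<lambda>u. vertical u n) \<in> borel_measurable borel"
  unfolding vertical_def by measurable

lemma norm_vertical: "cmod (vertical u n) \<le> 1"
  by (simp add: vertical_def)

lemma vertical_fourier:
  assumes K: "integrable lborel K" and even: "\<And>u. K (- u) = (K u :: real)" and n: "n \<ge> 1"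
  shows "(\<integral>u. vertical u n * of_real (K (u - t)) \<partial>lborel) =
      vertical t n * of_real (\<integral>u. cos (ln (real n) * u) * K u \<partial>lborel)"
proof -
  have "(\<integral>u. vertical u n * of_real (K (u - t)) \<partial>lborel) = (\<integral>u. vertical (t + u) n * of_real (K u) \<partial>lborel)"
    using lborel_integral_real_affine[of 1 "\<lambda>u. vertical u n * of_real (K (u - t))" t] by simp
  also have "\<dots> = (\<integral>u. vertical t n * (cis ((- ln (real n)) * u) * of_real (K u)) \<partial>lborel)"
    using n by (intro Bochner_Integration.integral_cong refl) (simp add: vertical_def cis_mult algebra_simps)
  also have "\<dots> = vertical t n * (\<integral>u. cis ((- ln (real n)) * u) * of_real (K u) \<partial>lborel)"
    by (rule integral_mult_right_zero)
  also have "(\<integral>u. cis ((- ln (real n)) * u) * of_real (K u) \<partial>lborel) = of_real (\<integral>u. cos ((- ln (real n)) * u) * K u \<partial>lborel)"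
    by (rule integral_cis_even[OF K even])
  finally show ?thesis by simp
qed

text \<open>In applications \<open>b\<close> is \<open>twist a \<gamma>\<close> and \<open>g\<close> is the restriction of \<open>F\<close> to the orbit of \<open>\<gamma>\<close> under
  vertical translation.  The weight \<open>1 / (1 + u\<^sup>2)\<close> dominates all kernels used below.\<close>

locale boundary_function =
  fixes b :: "nat \<Rightarrow> complex" and g :: "real \<Rightarrow> complex" and M :: real and r :: "nat \<Rightarrow> nat"
  assumes g_meas [measurable]: "g \<in> borel_measurable borel"
    and g_bound: "\<And>u. cmod (g u) \<le> M"
    and r_mono: "strict_mono r"
    and approx: "(\<lambda>k. \<integral>u. cmod (g u - (\<Sum>n=1..r k. b n * vertical u n)) * (1 / (1 + u\<^sup>2)) \<partial>lborel) \<longlonglongrightarrow> 0"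
begin

lemma M_nonneg: "M \<ge> 0"
  using g_bound[of 0] norm_ge_zero order_trans by blast

lemma integrable_weighted:
  assumes [measurable]: "f \<in> borel_measurable borel" "K \<in> borel_measurable borel"
    and f: "\<And>u. cmod (f u) \<le> B" and K: "\<And>u. \<bar>K u\<bar> \<le> C * (1 / (1 + u\<^sup>2))"
  shows "integrable lborel (\<lambda>u. f u * complex_of_real (K u))"
proof (rule Bochner_Integration.integrable_bound)
  show "integrable lborel (\<lambda>u::real. B * (C * (1 / (1 + u\<^sup>2))))"
    by (intro integrable_mult_right integrable_cauchy_weight)
  have B: "B \<ge> 0" using f[of 0] norm_ge_zero order_trans by blast
  have "norm (f u * complex_of_real (K u)) \<le> B * (C * (1 / (1 + u\<^sup>2)))" for u
    unfolding norm_mult norm_of_real using B by (intro mult_mono f K) auto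
  thus "AE u in lborel. norm (f u * complex_of_real (K u)) \<le> norm (B * (C * (1 / (1 + u\<^sup>2))))"
    by (intro AE_I2) (metis abs_ge_self order_trans real_norm_def)
qed measurable

lemma polynomial_bound: "cmod (\<Sum>n=1..N. b n * vertical u n) \<le> (\<Sum>n=1..N. cmod (b n))"
  by (rule order_trans[OF norm_sum sum_mono]) (use norm_vertical in \<open>auto simp: norm_mult intro: mult_left_le\<close>)

text \<open>A kernel dominated by the weight turns weighted L^1 approximation of g into convergence
  of the integrals, and each polynomial is integrated term by term.\<close>

lemma kernel_representation:
  assumes Km [measurable]: "K \<in> borel_measurable borel"
    and K: "\<And>u. \<bar>K u\<bar> \<le> C * (1 / (1 + u\<^sup>2))"
  shows "(\<lambda>k. \<Sum>n=1..r k. b n * (\<integral>u. vertical u n * of_real (K u) \<partial>lborel)) \<longlonglongrightarrow>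
     (\<integral>u. g u * of_real (K u) \<partial>lborel)"
proof -
  let ?P = "\<lambda>k u. \<Sum>n=1..r k. b n * vertical u n"
  have C: "C \<ge> 0" using order_trans[OF abs_ge_zero K[of 0]] by simp
  have vi: "integrable lborel (\<lambda>u. vertical u n * of_real (K u))" for n
    by (rule integrable_weighted[OF _ _ norm_vertical K]) auto
  have gi: "integrable lborel (\<lambda>u. g u * of_real (K u))"
    by (rule integrable_weighted[OF _ _ g_bound K]) auto
  have eq: "(\<Sum>n=1..r k. b n * (\<integral>u. vertical u n * of_real (K u) \<partial>lborel)) = (\<integral>u. ?P k u * of_real (K u) \<partial>lborel)" for k
  proof -
    have "(\<integral>u. ?P k u * of_real (K u) \<partial>lborel) = (\<integral>u. (\<Sum>n=1..r k. b n * (vertical u n * of_real (K u))) \<partial>lborel)"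
      by (simp add: sum_distrib_right mult.assoc)
    also have "\<dots> = (\<Sum>n=1..r k. \<integral>u. b n * (vertical u n * of_real (K u)) \<partial>lborel)"
      by (intro Bochner_Integration.integral_sum integrable_mult_right vi)
    finally show ?thesis by simp
  qed
  have pi: "integrable lborel (\<lambda>u. ?P k u * of_real (K u))" for k
    by (rule integrable_weighted[OF _ _ polynomial_bound K]) measurable
  have bnd: "cmod ((\<integral>u. g u * of_real (K u) \<partial>lborel) - (\<integral>u. ?P k u * of_real (K u) \<partial>lborel)) \<le>
      C * (\<integral>u. cmod (g u - ?P k u) * (1 / (1 + u\<^sup>2)) \<partial>lborel)" for k
  proof -
    have "(\<integral>u. g u * of_real (K u) \<partial>lborel) - (\<integral>u. ?P k u * of_real (K u) \<partial>lborel) =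
        (\<integral>u. (g u - ?P k u) * of_real (K u) \<partial>lborel)"
      unfolding left_diff_distrib by (rule Bochner_Integration.integral_diff[OF gi pi, symmetric])
    also have "cmod \<dots> \<le> (\<integral>u. C * (cmod (g u - ?P k u) * (1 / (1 + u\<^sup>2))) \<partial>lborel)"
    proof (rule Bochner_Integration.integral_norm_bound_integral)
      have gp: "cmod (g u - ?P k u) \<le> M + (\<Sum>n=1..r k. cmod (b n))" for u
        using norm_triangle_ineq4[of "g u" "?P k u"] g_bound[of u] polynomial_bound[where N = "r k" and u = u] by linarith
      show "integrable lborel (\<lambda>u. (g u - ?P k u) * of_real (K u))"
        by (rule integrable_weighted[OF _ _ gp K]) measurable
      have "integrable lborel (\<lambda>u. (g u - ?P k u) * complex_of_real (1 / (1 + u\<^sup>2)))"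
        by (rule integrable_weighted[OF _ _ gp, where C = 1]) auto
      from integrable_norm[OF this] have "integrable lborel (\<lambda>u. cmod (g u - ?P k u) * (1 / (1 + u\<^sup>2)))"
        unfolding norm_mult norm_of_real by (simp add: abs_of_nonneg)
      thus "integrable lborel (\<lambda>u. C * (cmod (g u - ?P k u) * (1 / (1 + u\<^sup>2))))"
        by (rule integrable_mult_right)
      show "norm ((g u - ?P k u) * of_real (K u)) \<le> C * (cmod (g u - ?P k u) * (1 / (1 + u\<^sup>2)))" for u
      proof -
        have "cmod (g u - ?P k u) * \<bar>K u\<bar> \<le> cmod (g u - ?P k u) * (C * (1 / (1 + u\<^sup>2)))"
          by (intro mult_left_mono K) auto
        thus ?thesis unfolding norm_mult norm_of_real by (simp only: mult.left_commute)
      qed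
    qed
    finally show ?thesis unfolding integral_mult_right_zero .
  qed
  have "(\<lambda>k. (\<integral>u. g u * of_real (K u) \<partial>lborel) - (\<integral>u. ?P k u * of_real (K u) \<partial>lborel)) \<longlonglongrightarrow> 0"
  proof (rule Lim_null_comparison[OF always_eventually[OF allI[OF bnd]]])
    show "(\<lambda>k. C * (\<integral>u. cmod (g u - ?P k u) * (1 / (1 + u\<^sup>2)) \<partial>lborel)) \<longlonglongrightarrow> 0"
      using tendsto_mult_left[OF approx, of C] by simp
  qed
  from tendsto_diff[OF tendsto_const[of "\<integral>u. g u * of_real (K u) \<partial>lborel"] this]
  show ?thesis unfolding eq by simp
qed

text \<open>Moving the kernel to t inserts the factor \<open>vertical t n\<close>, and the sums from
  \<open>kernel_representation\<close> are constant once \<open>r k \<ge> N\<close>. The bound does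
  not depend on t; this uniformity is what later allows limits of translates.\<close>

lemma partial_sum_bound:
  assumes N: "N \<ge> 1"
  shows "cmod (coeff_sum (twist b (vertical t)) N) \<le> M * (\<integral>u. \<bar>trapezoid N u\<bar> \<partial>lborel)"
proof -
  obtain C where C: "\<And>u. \<bar>trapezoid N u\<bar> \<le> C * (1 / (1 + u\<^sup>2))" using trapezoid_weight by blast
  let ?K = "\<lambda>u. trapezoid N (u - t)"
  have lim: "(\<lambda>k. \<Sum>n=1..r k. b n * (\<integral>u. vertical u n * of_real (?K u) \<partial>lborel)) \<longlonglongrightarrow>
     (\<integral>u. g u * of_real (?K u) \<partial>lborel)"
    by (rule kernel_representation[OF _ weight_shift[OF C]]) measurable
  have "(\<Sum>n=1..r k. b n * (\<integral>u. vertical u n * of_real (?K u) \<partial>lborel)) = coeff_sum (twist b (vertical t)) N"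
    if "k \<ge> N" for k
  proof -
    have rk: "r k \<ge> N" using strict_mono_imp_increasing[OF r_mono, of k] that by simp
    have "(\<Sum>n=1..r k. b n * (\<integral>u. vertical u n * of_real (?K u) \<partial>lborel)) =
        (\<Sum>n=1..r k. if n \<in> {1..N} then b n * vertical t n else 0)"
    proof (intro sum.cong refl)
      fix n assume "n \<in> {1..r k}"
      hence n: "n \<ge> 1" by simp
      show "b n * (\<integral>u. vertical u n * of_real (?K u) \<partial>lborel) = (if n \<in> {1..N} then b n * vertical t n else 0)"
        using vertical_fourier[OF trapezoid_integrable trapezoid_even n] trapezoid_cos[OF N n] n by simp
    qed
    also have "\<dots> = (\<Sum>n\<in>{1..r k} \<inter> {1..N}. b n * vertical t n)" by (rule sum.inter_restrict[symmetric]) simp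
    also have "{1..r k} \<inter> {1..N} = {1..N}" using rk by auto
    finally show ?thesis by (simp add: coeff_sum_def twist_def)
  qed
  hence "\<forall>\<^sub>F k in sequentially. (\<Sum>n=1..r k. b n * (\<integral>u. vertical u n * of_real (?K u) \<partial>lborel)) = coeff_sum (twist b (vertical t)) N"
    by (auto simp: eventually_sequentially)
  hence "(\<lambda>k. \<Sum>n=1..r k. b n * (\<integral>u. vertical u n * of_real (?K u) \<partial>lborel)) \<longlonglongrightarrow> coeff_sum (twist b (vertical t)) N"
    by (rule tendsto_eventually)
  with lim have "coeff_sum (twist b (vertical t)) N = (\<integral>u. g u * of_real (?K u) \<partial>lborel)"
    using LIMSEQ_unique by blast
  also have "cmod \<dots> \<le> (\<integral>u. M * \<bar>?K u\<bar> \<partial>lborel)"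
  proof (rule Bochner_Integration.integral_norm_bound_integral)
    show "integrable lborel (\<lambda>u. g u * of_real (?K u))"
      by (rule integrable_weighted[OF _ _ g_bound weight_shift[OF C]]) measurable
    show "integrable lborel (\<lambda>u. M * \<bar>?K u\<bar>)"
      using lborel_integrable_real_affine[OF trapezoid_integrable[of N], of 1 "- t"] by simp
    show "norm (g u * of_real (?K u)) \<le> M * \<bar>?K u\<bar>" for u
      unfolding norm_mult norm_of_real by (intro mult_right_mono g_bound) auto
  qed
  also have "\<dots> = M * (\<integral>u. \<bar>trapezoid N u\<bar> \<partial>lborel)"
    using lborel_integral_real_affine[of 1 "\<lambda>u. \<bar>?K u\<bar>" t] by simp
  finally show ?thesis .
qed

lemma subpolynomial: "subpolynomial_sums (twist b (vertical t))"
  unfolding subpolynomial_sums_def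
proof (intro allI impI)
  fix \<eta> :: real assume "0 < \<eta> \<and> \<eta> \<le> 1"
  then obtain C where C: "C \<ge> 0" "\<And>N. N \<ge> 1 \<Longrightarrow> (\<integral>u. \<bar>trapezoid N u\<bar> \<partial>lborel) \<le> C * real N powr \<eta>"
    using trapezoid_L1[of \<eta>] by blast
  show "\<exists>C\<ge>0. \<forall>N\<ge>1. cmod (coeff_sum (twist b (vertical t)) N) \<le> C * real N powr \<eta>"
  proof (intro exI[of _ "M * C"] conjI allI impI)
    show "0 \<le> M * C" using C M_nonneg by simp
    fix N :: nat assume N: "N \<ge> 1"
    have "cmod (coeff_sum (twist b (vertical t)) N) \<le> M * (C * real N powr \<eta>)"
      by (rule order_trans[OF partial_sum_bound[OF N] mult_left_mono[OF C(2)[OF N] M_nonneg]])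
    thus "cmod (coeff_sum (twist b (vertical t)) N) \<le> M * C * real N powr \<eta>" by (simp only: mult.assoc)
  qed
qed

lemma summable_dirichlet: "Re s > 0 \<Longrightarrow> summable (dirichlet_term b s)"
proof -
  assume s: "Re s > 0"
  have "summable (dirichlet_term (twist b (vertical 0)) s)"
    by (rule subpolynomial_summable[OF subpolynomial s])
  moreover have "dirichlet_term (twist b (vertical 0)) s = dirichlet_term b s"
    using dirichlet_term_vertical[of b 0 s] by (auto simp: fun_eq_iff)
  ultimately show ?thesis by simp
qed

text \<open>The kernel produces the factors n^(-\<sigma>) n^(-it), so the integrals of the
  polynomials are partial sums of the series. They are known to converge only along r; convergence
  of the full series, from \<open>summable_dirichlet\<close>, identifies the limit.\<close>

lemma poisson_representation:
  assumes \<sigma>: "\<sigma> > 0"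
  shows "dirichlet_sum b (Complex \<sigma> t) = (\<integral>u. g (t + u) * of_real (poisson \<sigma> u) \<partial>lborel)"
proof -
  let ?K = "\<lambda>u. poisson \<sigma> (u - t)"
  have C: "\<bar>poisson \<sigma> u\<bar> \<le> ((\<sigma> + 1 / \<sigma>) / pi) * (1 / (1 + u\<^sup>2))" for u
    using poisson_le_weight[OF \<sigma>, of u] poisson_nonneg[OF \<sigma>, of u] by simp
  have lim: "(\<lambda>k. \<Sum>n=1..r k. b n * (\<integral>u. vertical u n * of_real (?K u) \<partial>lborel)) \<longlonglongrightarrow>
     (\<integral>u. g u * of_real (?K u) \<partial>lborel)"
    by (rule kernel_representation[OF _ weight_shift[OF C]]) measurable
  have c: "Complex \<sigma> t = of_real \<sigma> + \<i> * of_real t" by (simp add: complex_eq_iff)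
  have "(\<Sum>n=1..N. b n * (\<integral>u. vertical u n * of_real (?K u) \<partial>lborel)) = (\<Sum>n<N. dirichlet_term b (Complex \<sigma> t) n)" for N
  proof -
    have "(\<Sum>n=1..N. b n * (\<integral>u. vertical u n * of_real (?K u) \<partial>lborel)) =
        (\<Sum>n<N. b (Suc n) * (\<integral>u. vertical u (Suc n) * of_real (?K u) \<partial>lborel))"
      by (rule sum.reindex_bij_witness[of _ Suc "\<lambda>n. n - 1"]) auto
    also have "\<dots> = (\<Sum>n<N. dirichlet_term b (Complex \<sigma> t) n)"
    proof (intro sum.cong refl)
      fix n
      have "(\<integral>u. vertical u (Suc n) * of_real (?K u) \<partial>lborel) = vertical t (Suc n) * of_real (exp (- \<sigma> * ln (real (Suc n))))"
        using vertical_fourier[OF poisson_integrable[OF \<sigma>] poisson_even, of "Suc n" t]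
          poisson_cos[OF \<sigma>, of "ln (real (Suc n))"] by simp
      also have "of_real (exp (- \<sigma> * ln (real (Suc n)))) = of_nat (Suc n) powr (- of_real \<sigma> :: complex)"
      proof -
        have "of_real (real (Suc n) powr (- \<sigma>)) = of_real (real (Suc n)) powr (of_real (- \<sigma>) :: complex)"
          by (rule powr_of_real[symmetric]) auto
        thus ?thesis by (simp add: powr_def del: of_nat_Suc)
      qed
      finally have "b (Suc n) * (\<integral>u. vertical u (Suc n) * of_real (?K u) \<partial>lborel) =
          dirichlet_term (twist b (vertical t)) (of_real \<sigma>) n"
        by (simp add: dirichlet_term_def twist_def)
      also have "\<dots> = dirichlet_term b (Complex \<sigma> t) n"
        by (simp only: dirichlet_term_vertical c)
      finally show "b (Suc n) * (\<integral>u. vertical u (Suc n) * of_real (?K u) \<partial>lborel) = dirichlet_term b (Complex \<sigma> t) n" .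
    qed
    finally show ?thesis .
  qed
  with lim have l: "(\<lambda>k. \<Sum>n<r k. dirichlet_term b (Complex \<sigma> t) n) \<longlonglongrightarrow> (\<integral>u. g u * of_real (?K u) \<partial>lborel)"
    by simp
  have "(\<lambda>N. \<Sum>n<N. dirichlet_term b (Complex \<sigma> t) n) \<longlonglongrightarrow> dirichlet_sum b (Complex \<sigma> t)"
    unfolding dirichlet_sum_def by (rule summable_LIMSEQ[OF summable_dirichlet]) (use \<sigma> in simp)
  from LIMSEQ_subseq_LIMSEQ[OF this r_mono]
  have "(\<lambda>k. \<Sum>n<r k. dirichlet_term b (Complex \<sigma> t) n) \<longlonglongrightarrow> dirichlet_sum b (Complex \<sigma> t)"
    by (simp add: o_def)
  with l have "dirichlet_sum b (Complex \<sigma> t) = (\<integral>u. g u * of_real (?K u) \<partial>lborel)"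
    using LIMSEQ_unique by blast
  also have "\<dots> = (\<integral>u. g (t + u) * of_real (poisson \<sigma> u) \<partial>lborel)"
    using lborel_integral_real_affine[of 1 "\<lambda>u. g u * of_real (?K u)" t] by simp
  finally show ?thesis .
qed

lemma dirichlet_sum_bound:
  assumes s: "Re s > 0"
  shows "cmod (dirichlet_sum b s) \<le> M"
proof -
  have "dirichlet_sum b s = (\<integral>u. g (Im s + u) * of_real (poisson (Re s) u) \<partial>lborel)"
    using poisson_representation[OF s, of "Im s"] by simp
  also have "cmod \<dots> \<le> (\<integral>u. M * poisson (Re s) u \<partial>lborel)"
  proof (rule Bochner_Integration.integral_norm_bound_integral)
    have C: "\<bar>poisson (Re s) u\<bar> \<le> ((Re s + 1 / Re s) / pi) * (1 / (1 + u\<^sup>2))" for u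
      using poisson_le_weight[OF s, of u] poisson_nonneg[OF s, of u] by simp
    show "integrable lborel (\<lambda>u. g (Im s + u) * of_real (poisson (Re s) u))"
      by (rule integrable_weighted[OF _ _ g_bound C]) measurable
    show "integrable lborel (\<lambda>u. M * poisson (Re s) u)" by (intro integrable_mult_right poisson_integrable s)
    show "norm (g (Im s + u) * of_real (poisson (Re s) u)) \<le> M * poisson (Re s) u" for u
      unfolding norm_mult norm_of_real abs_of_nonneg[OF poisson_nonneg[OF s]]
      by (intro mult_right_mono g_bound poisson_nonneg s)
  qed
  also have "\<dots> = M" by (simp add: poisson_integral s)
  finally show ?thesis .
qed

lemma radial_limit: "AE t in lborel. ((\<lambda>\<sigma>. dirichlet_sum b (Complex \<sigma> t)) \<longlongrightarrow> g t) (at_right 0)"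
  using bounded_differentiation[OF g_meas g_bound]
proof eventually_elim
  case (elim t)
  have "((\<lambda>\<sigma>. \<integral>u. g (t + u) * of_real (poisson \<sigma> u) \<partial>lborel) \<longlongrightarrow> g t) (at_right 0)"
    by (rule poisson_limit[OF g_meas g_bound elim])
  thus ?case
  proof (rule Lim_transform_eventually)
    have "\<forall>\<^sub>F \<sigma> in at_right (0::real). \<sigma> > 0" by (simp add: eventually_at_filter)
    thus "\<forall>\<^sub>F \<sigma> in at_right 0. (\<integral>u. g (t + u) * of_real (poisson \<sigma> u) \<partial>lborel) = dirichlet_sum b (Complex \<sigma> t)"
      by eventually_elim (simp add: poisson_representation)
  qed
qed

lemma boundary_value_eq: "AE t in lborel. boundary_value b t = g t"
  using radial_limit by eventually_elim (auto simp: boundary_value_def intro: tendsto_Lim)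

end

section \<open>Vertical translation of characters\<close>

text \<open>An integer relation between logarithms of primes exponentiates to an equation between
  products of prime powers. Positive and negative coefficients go to different sides, so unique
  factorisation makes both parts of each coefficient equal, hence zero.\<close>

lemma independent_ln_primes:
  assumes "P \<subseteq> {p::nat. prime p}"
  shows "module.independent (\<lambda>r. (*) (real_of_int r)) ((\<lambda>p. ln (real p)) ` P)"
proof -
  interpret Modules.module "(\<lambda>r. (*) (real_of_int r))"
    by (simp add: Modules.module.intro distrib_left mult.commute)
  show ?thesis
    unfolding independent_explicit_module
  proof (intro allI impI)
    fix T :: "real set" and c :: "real \<Rightarrow> int" and v
    assume T: "finite T" "T \<subseteq> (\<lambda>p. ln (real p)) ` P" and z: "(\<Sum>v\<in>T. real_of_int (c v) * v) = 0" and v: "v \<in> T"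
    obtain Q where Q: "Q \<subseteq> P" "finite Q" "T = (\<lambda>p. ln (real p)) ` Q"
      using finite_subset_image[OF T] by blast
    have pr: "prime p" if "p \<in> Q" for p using that Q assms by auto
    have pos: "real p > 0" if "p \<in> Q" for p using prime_gt_0_nat[OF pr[OF that]] by simp
    have inj: "inj_on (\<lambda>p. ln (real p)) Q"
      using pos by (auto simp: inj_on_def)
    define e where "e p = c (ln (real p))" for p :: nat
    have "(\<Sum>p\<in>Q. real_of_int (e p) * ln (real p)) = 0"
      using z unfolding Q(3) by (simp add: sum.reindex[OF inj] e_def)
    moreover have "real_of_int (e p) = real (nat (e p)) - real (nat (- e p))" for p by simp
    ultimately have "(\<Sum>p\<in>Q. real (nat (e p)) * ln (real p)) = (\<Sum>p\<in>Q. real (nat (- e p)) * ln (real p))"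
      by (simp add: left_diff_distrib sum_subtractf)
    hence "exp (\<Sum>p\<in>Q. real (nat (e p)) * ln (real p)) = exp (\<Sum>p\<in>Q. real (nat (- e p)) * ln (real p))"
      by simp
    moreover have "exp (\<Sum>p\<in>Q. real (f p) * ln (real p)) = real (\<Prod>p\<in>Q. p ^ f p)" for f
    proof -
      have "exp (\<Sum>p\<in>Q. real (f p) * ln (real p)) = (\<Prod>p\<in>Q. exp (real (f p) * ln (real p)))"
        using Q(2) by (rule exp_sum)
      also have "\<dots> = (\<Prod>p\<in>Q. real p ^ f p)"
        using pos by (intro prod.cong refl) (simp add: exp_of_nat_mult)
      finally show ?thesis by simp
    qed
    ultimately have eq: "(\<Prod>p\<in>Q. p ^ nat (e p)) = (\<Prod>p\<in>Q. p ^ nat (- e p))"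
      using of_nat_eq_iff by metis
    obtain p where p: "p \<in> Q" "v = ln (real p)" using v Q(3) by auto
    have "multiplicity p (\<Prod>p\<in>Q. p ^ nat (e p)) = multiplicity p (\<Prod>p\<in>Q. p ^ nat (- e p))"
      by (simp only: eq)
    hence "nat (e p) = nat (- e p)"
      using multiplicity_prod_prime_powers[OF Q(2) pr pr[OF p(1)], of "\<lambda>p. nat (e p)"]
        multiplicity_prod_prime_powers[OF Q(2) pr pr[OF p(1)], of "\<lambda>p. nat (- e p)"] p(1) by simp
    hence "e p = 0" by linarith
    thus "c v = 0" by (simp add: e_def p)
  qed
qed

lemma cis_lipschitz: "cmod (cis x - cis y) \<le> \<bar>x - y\<bar>"
proof -
  have "cmod (cis x - cis y) = cmod (cis (x - y) - 1)"
  proof -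
    have "cis x - cis y = cis y * (cis (x - y) - 1)" by (simp add: right_diff_distrib cis_mult)
    thus ?thesis by (simp add: norm_mult)
  qed
  also have "\<dots> \<le> \<bar>x - y\<bar>"
  proof (rule power2_le_imp_le)
    have "(cmod (cis (x - y) - 1))\<^sup>2 = (cos (x - y) - 1)\<^sup>2 + (sin (x - y))\<^sup>2"
      by (simp add: cmod_power2)
    also have "\<dots> = 2 * (1 - cos (x - y))"
      using sin_cos_squared_add[of "x - y"] by (simp add: power2_eq_square algebra_simps)
    also have "\<dots> \<le> \<bar>x - y\<bar>\<^sup>2" using one_minus_cos_le[of "x - y"] by simp
    finally show "(cmod (cis (x - y) - 1))\<^sup>2 \<le> \<bar>x - y\<bar>\<^sup>2" .
  qed auto
  finally show ?thesis .
qed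

text \<open>Independence of the logarithms lets Kronecker's theorem choose a single t that adjusts
  the phases at the first n primes simultaneously.\<close>

lemma vertical_approximates_primes:
  assumes \<kappa>: "\<kappa> \<in> characters" and "\<epsilon> > 0"
  shows "\<exists>t. \<forall>i<n. cmod (vertical t (enumerate {p::nat. prime p} i) - \<kappa> (enumerate {p::nat. prime p} i)) < \<epsilon>"
proof -
  let ?p = "enumerate {p::nat. prime p}"
  have pr: "prime (?p i)" for i using enumerate_in_set[OF primes_infinite, of i] by simp
  have p1: "?p i \<ge> 1" for i using prime_ge_1_nat[OF pr] .
  define \<theta> where "\<theta> i = ln (real (?p i))" for i
  define \<alpha> where "\<alpha> i = Arg2pi (\<kappa> (?p i)) / (2 * pi)" for i
  have inj: "inj_on \<theta> {..<n}"
  proof (rule inj_onI)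
    fix i j assume "\<theta> i = \<theta> j"
    hence "?p i = ?p j" using p1[of i] p1[of j] by (simp add: \<theta>_def)
    thus "i = j" using inj_enumerate[OF primes_infinite] by (auto simp: inj_def)
  qed
  have "module.independent (\<lambda>r. (*) (real_of_int r)) (\<theta> ` {..<n})"
  proof -
    have "\<theta> ` {..<n} = (\<lambda>p. ln (real p)) ` (?p ` {..<n})" by (auto simp: \<theta>_def image_image)
    moreover have "?p ` {..<n} \<subseteq> {p. prime p}" using pr by blast
    ultimately show ?thesis using independent_ln_primes by metis
  qed
  then obtain t h where th: "\<And>i. i < n \<Longrightarrow> \<bar>t * \<theta> i - of_int (h i) - \<alpha> i\<bar> < \<epsilon> / (2 * pi)"
    using Kronecker_thm_1[OF _ inj, of "\<epsilon> / (2 * pi)" \<alpha>] \<open>\<epsilon> > 0\<close> by auto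
  show ?thesis
  \<comment> \<open>Kronecker's theorem counts in full turns and \<open>vertical\<close> carries a
    minus sign, hence this rescaling of t.\<close>
  proof (intro exI[of _ "- 2 * pi * t"] allI impI)
    fix i assume i: "i < n"
    have "vertical (- 2 * pi * t) (?p i) = cis (2 * pi * (t * \<theta> i - of_int (h i)))"
    proof -
      have 1: "2 * pi * (t * \<theta> i - of_int (h i)) = 2 * pi * t * \<theta> i + 2 * pi * of_int (- h i)"
        by (simp add: right_diff_distrib)
      have 2: "cis (2 * pi * of_int (- h i)) = 1"
        by (rule cis_multiple_2pi) auto
      have "cis (2 * pi * (t * \<theta> i - of_int (h i))) = cis (2 * pi * t * \<theta> i) * cis (2 * pi * of_int (- h i))"
        unfolding 1 by (rule cis_mult[symmetric])
      hence "cis (2 * pi * (t * \<theta> i - of_int (h i))) = cis (2 * pi * t * \<theta> i)"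
        unfolding 2 by (simp only: mult_1_right)
      thus ?thesis using p1[of i] by (simp add: vertical_def \<theta>_def)
    qed
    moreover have "\<kappa> (?p i) = cis (2 * pi * \<alpha> i)"
    proof -
      have "cis (2 * pi * \<alpha> i) = exp (\<i> * of_real (Arg2pi (\<kappa> (?p i))))"
        by (simp add: \<alpha>_def cis_conv_exp)
      also have "\<dots> = of_real (cmod (\<kappa> (?p i))) * exp (\<i> * of_real (Arg2pi (\<kappa> (?p i))))"
        unfolding norm_character[OF \<kappa> p1[of i]] by simp
      also have "\<dots> = \<kappa> (?p i)" by (rule Arg2pi_eq[symmetric])
      finally show ?thesis by (rule sym)
    qed
    ultimately have "cmod (vertical (- 2 * pi * t) (?p i) - \<kappa> (?p i)) \<le> \<bar>2 * pi * (t * \<theta> i - of_int (h i)) - 2 * pi * \<alpha> i\<bar>"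
      using cis_lipschitz by metis
    also have "\<dots> = 2 * pi * \<bar>t * \<theta> i - of_int (h i) - \<alpha> i\<bar>"
      by (simp add: right_diff_distrib[symmetric] abs_mult)
    also have "\<dots> < 2 * pi * (\<epsilon> / (2 * pi))"
      using th[OF i] by (intro mult_strict_left_mono) auto
    finally show "cmod (vertical (- 2 * pi * t) (?p i) - \<kappa> (?p i)) < \<epsilon>" by simp
  qed
qed

text \<open>Stage j treats the first j primes with error 1 / (j + 1); multiplicativity carries the
  limit from primes to all n.\<close>

lemma kronecker_vertical:
  assumes \<kappa>: "\<kappa> \<in> characters"
  obtains t where "\<And>n. (\<lambda>j::nat. vertical (t j) n) \<longlonglongrightarrow> \<kappa> n"
proof -
  let ?p = "enumerate {p::nat. prime p}"
  have "\<forall>j::nat. \<exists>t. \<forall>i<j. cmod (vertical t (?p i) - \<kappa> (?p i)) < 1 / real (Suc j)"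
    by (intro allI vertical_approximates_primes[OF \<kappa>]) auto
  then obtain t where t: "\<And>j i. i < j \<Longrightarrow> cmod (vertical (t j) (?p i) - \<kappa> (?p i)) < 1 / real (Suc j)"
    by metis
  have "(\<lambda>j. vertical (t j) n) \<longlonglongrightarrow> \<kappa> n" for n
  proof (induction n rule: prime_divisors_induct)
    case zero
    show ?case using \<kappa> vertical_character by (simp add: character_0)
  next
    case (unit x)
    hence "x = Suc 0" by simp
    thus ?case using character_1[OF \<kappa>] character_1[OF vertical_character] by simp
  next
    case (factor p x)
    obtain i where i: "p = ?p i" using prime_index[OF factor(1)] .
    have "(\<lambda>j. vertical (t j) p - \<kappa> p) \<longlonglongrightarrow> 0"
    proof (rule Lim_null_comparison[OF _ LIMSEQ_inverse_real_of_nat])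
      show "\<forall>\<^sub>F j in sequentially. cmod (vertical (t j) p - \<kappa> p) \<le> inverse (real (Suc j))"
        using eventually_gt_at_top[of i]
        by eventually_elim (use t in \<open>auto simp: i inverse_eq_divide intro: less_imp_le\<close>)
    qed
    hence "(\<lambda>j. vertical (t j) p) \<longlonglongrightarrow> \<kappa> p" by (simp add: LIM_zero_iff)
    from tendsto_mult[OF this factor(2)] show ?case
      by (simp add: character_mult[OF \<kappa>] character_mult[OF vertical_character])
  qed
  thus ?thesis by (rule that)
qed

section \<open>The vertical flow and its orbits\<close>

interpretation character_flow: pair_sigma_finite character_haar "lborel :: real measure"
  by unfold_locales

definition flow :: "real \<Rightarrow> (nat \<Rightarrow> complex) \<Rightarrow> nat \<Rightarrow> complex" where
  "flow t \<gamma> = twist (vertical t) \<gamma>"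

lemma flow_character: "\<gamma> \<in> characters \<Longrightarrow> flow t \<gamma> \<in> characters"
  unfolding flow_def by (rule twist_character[OF vertical_character])

lemma measurable_flow [measurable]: "(\<lambda>(\<gamma>, t). flow t \<gamma>) \<in> character_haar \<Otimes>\<^sub>M lborel \<rightarrow>\<^sub>M character_haar"
proof (rule measurable_character_haarI)
  show "(case x of (\<gamma>, t) \<Rightarrow> flow t \<gamma>) \<in> characters" if "x \<in> space (character_haar \<Otimes>\<^sub>M lborel)" for x
    using that flow_character by (auto simp: space_pair_measure)
  fix p :: nat
  have "(\<lambda>u. vertical u p) \<in> borel_measurable lborel" by simp
  from measurable_compose[OF measurable_snd this]
  have "(\<lambda>x. vertical (snd x) p * fst x p) \<in> borel_measurable (character_haar \<Otimes>\<^sub>M lborel)"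
    by (intro borel_measurable_times measurable_compose[OF measurable_fst measurable_character])
  thus "(\<lambda>x. (case x of (\<gamma>, t) \<Rightarrow> flow t \<gamma>) p) \<in> borel_measurable (character_haar \<Otimes>\<^sub>M lborel)"
    by (simp add: flow_def twist_def case_prod_beta)
qed

lemma measurable_flow_t:
  assumes "\<gamma> \<in> characters"
  shows "(\<lambda>t. flow t \<gamma>) \<in> borel \<rightarrow>\<^sub>M character_haar"
proof (rule measurable_character_haarI)
  fix t :: real
  show "flow t \<gamma> \<in> characters" by (rule flow_character[OF assms])
next
  fix p :: nat
  show "(\<lambda>t. flow t \<gamma> p) \<in> borel_measurable borel"
    unfolding flow_def twist_def by measurable
qed

text \<open>Measurability permits exchanging the two quantifiers. By invariance the inner statement
  then no longer depends on t, and a constant holds for almost every t exactly if it is true, since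
  \<open>lborel\<close> is not the zero measure.\<close>

lemma AE_flow:
  assumes F: "{\<gamma> \<in> characters. P \<gamma>} \<in> sets character_haar"
  shows "(AE \<gamma> in character_haar. AE t in lborel. P (flow t \<gamma>)) \<longleftrightarrow> (AE \<gamma> in character_haar. P \<gamma>)"
proof -
  have "{x \<in> space (character_haar \<Otimes>\<^sub>M lborel). P (flow (snd x) (fst x))} =
      (\<lambda>(\<gamma>, t). flow t \<gamma>) -` {\<gamma> \<in> characters. P \<gamma>} \<inter> space (character_haar \<Otimes>\<^sub>M lborel)"
    using flow_character by (auto simp: space_pair_measure case_prod_beta)
  also have "\<dots> \<in> sets (character_haar \<Otimes>\<^sub>M lborel)"
    by (rule measurable_sets[OF measurable_flow F])
  finally have swap: "(AE \<gamma> in character_haar. AE t in lborel. P (flow t \<gamma>)) \<longleftrightarrow>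
      (AE t in lborel. AE \<gamma> in character_haar. P (flow t \<gamma>))"
    by (rule character_flow.AE_commute)
  have inv: "(AE \<gamma> in character_haar. P (flow t \<gamma>)) \<longleftrightarrow> (AE \<gamma> in character_haar. P \<gamma>)" for t
  proof
    assume "AE \<gamma> in character_haar. P (flow t \<gamma>)"
    from AE_character_twist[OF vertical_character this, of "- t"]
    have "AE \<gamma> in character_haar. P (flow t (twist (vertical (- t)) \<gamma>))" .
    thus "AE \<gamma> in character_haar. P \<gamma>" using AE_space
    proof eventually_elim
      case (elim \<gamma>)
      have "flow t (twist (vertical (- t)) \<gamma>) = twist (twist (vertical t) (vertical (- t))) \<gamma>"
        by (rule ext) (simp add: flow_def twist_def mult.assoc)
      also have "\<dots> = \<gamma>"
        using elim(2) by (auto simp: vertical_add twist_def vertical_def character_0)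
      finally show ?case using elim(1) by simp
    qed
  next
    assume "AE \<gamma> in character_haar. P \<gamma>"
    thus "AE \<gamma> in character_haar. P (flow t \<gamma>)"
      unfolding flow_def by (rule AE_character_twist[OF vertical_character])
  qed
  show ?thesis
    unfolding swap inv by (simp add: eventually_const_iff ae_filter_eq_bot_iff)
qed

text \<open>A rate is assumed rather than mere L^2 convergence because the errors must be summable
  over k to give convergence on almost every orbit.\<close>

locale torus_function =
  fixes a :: "nat \<Rightarrow> complex" and F :: "(nat \<Rightarrow> complex) \<Rightarrow> complex" and r :: "nat \<Rightarrow> nat"
  assumes r_mono: "strict_mono r" and F_sq: "sq_integrable character_haar F"
    and F_approx: "\<And>k. (\<integral>\<gamma>. (cmod (F \<gamma> - characters.psum a (r k) \<gamma>))\<^sup>2 \<partial>character_haar) \<le> (1/4) ^ k"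
begin

lemma F_meas [measurable]: "F \<in> borel_measurable character_haar"
  using F_sq by (simp add: sq_integrable_def)

lemma psum_flow: "characters.psum a N (flow u \<gamma>) = (\<Sum>n=1..N. twist a \<gamma> n * vertical u n)"
  by (simp add: characters.psum_def flow_def twist_def mult_ac)

lemma F_approx_L1:
  "integrable character_haar (\<lambda>\<gamma>. F \<gamma> - characters.psum a (r k) \<gamma>)"
  "(\<integral>\<gamma>. cmod (F \<gamma> - characters.psum a (r k) \<gamma>) \<partial>character_haar) \<le> (1/2) ^ k"
proof -
  have sq: "sq_integrable character_haar (\<lambda>\<gamma>. F \<gamma> - characters.psum a (r k) \<gamma>)"
    by (intro sq_integrable_diff F_sq characters.psum_sq)
  show "integrable character_haar (\<lambda>\<gamma>. F \<gamma> - characters.psum a (r k) \<gamma>)"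
    by (rule characters.L1_le_L2(1)[OF sq])
  have "(\<integral>\<gamma>. cmod (F \<gamma> - characters.psum a (r k) \<gamma>) \<partial>character_haar) \<le> sqrt ((1/4) ^ k)"
    using characters.L1_le_L2(2)[OF sq] F_approx[of k] real_sqrt_le_mono order_trans by blast
  also have "\<dots> = (1/2) ^ k" by (simp add: real_sqrt_power real_sqrt_divide)
  finally show "(\<integral>\<gamma>. cmod (F \<gamma> - characters.psum a (r k) \<gamma>) \<partial>character_haar) \<le> (1/2) ^ k" .
qed

text \<open>By Fubini's theorem and invariance the weighted error on an orbit has mean at most
  (1/2)^k times the integral of the weight. The means are summable, so the errors themselves are
  summable for almost every orbit. Nonnegative integrals are used since finiteness on single orbits
  is only part of the outcome.\<close>

lemma AE_weighted_approx:
  "AE \<gamma> in character_haar. (\<lambda>k. \<integral>\<^sup>+u. ennreal (cmod (F (flow u \<gamma>) - characters.psum a (r k) (flow u \<gamma>)) * (1 / (1 + u\<^sup>2))) \<partial>lborel) \<longlonglongrightarrow> 0"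
proof -
  define e where "e k \<gamma> = cmod (F \<gamma> - characters.psum a (r k) \<gamma>)" for k \<gamma>
  define W where "W k \<gamma> = (\<integral>\<^sup>+u. ennreal (e k (flow u \<gamma>) * (1 / (1 + u\<^sup>2))) \<partial>lborel)" for k \<gamma>
  have em [measurable]: "e k \<in> borel_measurable character_haar" for k
    unfolding e_def by measurable
  have e0: "e k \<gamma> \<ge> 0" for k \<gamma> by (simp add: e_def)
  have efm: "(\<lambda>(\<gamma>, u). e k (flow u \<gamma>)) \<in> borel_measurable (character_haar \<Otimes>\<^sub>M lborel)" for k
    using measurable_compose[OF measurable_flow em] by (simp add: case_prod_beta)
  have jm [measurable]: "(\<lambda>(\<gamma>, u). ennreal (e k (flow u \<gamma>) * (1 / (1 + u\<^sup>2)))) \<in> borel_measurable (character_haar \<Otimes>\<^sub>M lborel)" for k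
    using efm[of k] by (simp add: case_prod_beta)
  have Wm [measurable]: "W k \<in> borel_measurable character_haar" for k
    unfolding W_def by (rule lborel.borel_measurable_nn_integral[of "\<lambda>\<gamma> u. ennreal (e k (flow u \<gamma>) * (1 / (1 + u\<^sup>2)))", OF jm])
  have w: "(\<integral>\<^sup>+u. ennreal (1 / (1 + u\<^sup>2)) \<partial>(lborel :: real measure)) < \<infinity>"
    using integrable_cauchy_weight by (simp add: nn_integral_eq_integral)
  have "(\<integral>\<^sup>+\<gamma>. W k \<gamma> \<partial>character_haar) \<le> (\<integral>\<^sup>+u. ennreal (1 / (1 + u\<^sup>2)) \<partial>(lborel :: real measure)) * ennreal ((1/2) ^ k)" for k
  proof -
    have "(\<integral>\<^sup>+\<gamma>. W k \<gamma> \<partial>character_haar) =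
        (\<integral>\<^sup>+u. \<integral>\<^sup>+\<gamma>. ennreal (e k (flow u \<gamma>) * (1 / (1 + u\<^sup>2))) \<partial>character_haar \<partial>lborel)"
      unfolding W_def by (rule character_flow.Fubini'[symmetric]) (rule jm)
    also have "\<dots> \<le> (\<integral>\<^sup>+u. ennreal (1 / (1 + u\<^sup>2)) * ennreal ((1/2) ^ k) \<partial>(lborel :: real measure))"
    proof (intro nn_integral_mono)
      fix u :: real
      have m: "(\<lambda>\<gamma>. ennreal (e k (flow u \<gamma>))) \<in> borel_measurable character_haar"
        using measurable_compose[OF measurable_twist[OF vertical_character] em] by (simp add: flow_def)
      have "(\<integral>\<^sup>+\<gamma>. ennreal (e k (flow u \<gamma>) * (1 / (1 + u\<^sup>2))) \<partial>character_haar) =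
          (\<integral>\<^sup>+\<gamma>. ennreal (e k (flow u \<gamma>)) \<partial>character_haar) * ennreal (1 / (1 + u\<^sup>2))"
      proof -
        have n: "0 \<le> 1 / (1 + u\<^sup>2)" by simp
        show ?thesis unfolding ennreal_mult[OF e0 n] by (rule nn_integral_multc[OF m])
      qed
      also have "(\<integral>\<^sup>+\<gamma>. ennreal (e k (flow u \<gamma>)) \<partial>character_haar) = (\<integral>\<^sup>+\<gamma>. ennreal (e k \<gamma>) \<partial>character_haar)"
        unfolding flow_def by (rule nn_integral_character_twist[OF vertical_character]) measurable
      also have "\<dots> \<le> ennreal ((1/2) ^ k)" using F_approx_L1[of k] by (simp add: e_def nn_integral_eq_integral)
      finally show "(\<integral>\<^sup>+\<gamma>. ennreal (e k (flow u \<gamma>) * (1 / (1 + u\<^sup>2))) \<partial>character_haar) \<le>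
          ennreal (1 / (1 + u\<^sup>2)) * ennreal ((1/2) ^ k)"
        by (simp add: mult.commute mult_right_mono)
    qed
    also have "\<dots> = (\<integral>\<^sup>+u. ennreal (1 / (1 + u\<^sup>2)) \<partial>(lborel :: real measure)) * ennreal ((1/2) ^ k)"
      by (rule nn_integral_multc) measurable
    finally show ?thesis .
  qed
  hence "(\<Sum>k. \<integral>\<^sup>+\<gamma>. W k \<gamma> \<partial>character_haar) \<le>
      (\<Sum>k. (\<integral>\<^sup>+u. ennreal (1 / (1 + u\<^sup>2)) \<partial>(lborel :: real measure)) * ennreal ((1/2) ^ k))"
    by (intro suminf_le) auto
  also have "\<dots> = (\<integral>\<^sup>+u. ennreal (1 / (1 + u\<^sup>2)) \<partial>(lborel :: real measure)) * (\<Sum>k. ennreal ((1/2) ^ k))"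
    by (rule ennreal_suminf_cmult)
  also have "(\<Sum>k. ennreal ((1/2) ^ k)) = ennreal (\<Sum>k. (1/2) ^ k)"
    by (intro suminf_ennreal2) (auto simp: summable_geometric)
  also have "(\<integral>\<^sup>+u. ennreal (1 / (1 + u\<^sup>2)) \<partial>(lborel :: real measure)) * \<dots> < \<infinity>"
    using w by (simp add: ennreal_mult_less_top)
  finally have "(\<integral>\<^sup>+\<gamma>. (\<Sum>k. W k \<gamma>) \<partial>character_haar) < \<infinity>"
    by (subst nn_integral_suminf) auto
  hence "AE \<gamma> in character_haar. (\<Sum>k. W k \<gamma>) \<noteq> \<infinity>"
    by (intro nn_integral_PInf_AE) auto
  thus ?thesis
  proof eventually_elim
    case (elim \<gamma>)
    have fin: "W k \<gamma> < \<top>" for k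
    proof -
      have "W k \<gamma> \<le> (\<Sum>k. W k \<gamma>)" using sum_le_suminf[of "\<lambda>k. W k \<gamma>" "{k}"] by simp
      thus ?thesis using elim by (simp add: less_top top.not_eq_extremum)
    qed
    have "W k \<gamma> = ennreal (enn2real (W k \<gamma>))" for k using fin[of k] by simp
    moreover have "summable (\<lambda>k. enn2real (W k \<gamma>))"
      using elim calculation by (intro summable_suminf_not_top) auto
    hence "(\<lambda>k. ennreal (enn2real (W k \<gamma>))) \<longlonglongrightarrow> ennreal 0"
      by (intro tendsto_ennrealI summable_LIMSEQ_zero)
    ultimately have "(\<lambda>k. W k \<gamma>) \<longlonglongrightarrow> 0" by simp
    thus ?case by (simp add: W_def e_def)
  qed
qed

text \<open>The bound is asked at every character because \<open>boundary_function\<close> wants it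
  at every point of the orbit; an essentially bounded function is truncated beforehand.\<close>

lemma AE_boundary_function_bounded:
  assumes M: "\<And>\<gamma>. \<gamma> \<in> characters \<Longrightarrow> cmod (F \<gamma>) \<le> M"
  shows "AE \<gamma> in character_haar. boundary_function (twist a \<gamma>) (\<lambda>u. F (flow u \<gamma>)) M r"
  using AE_weighted_approx AE_space
proof eventually_elim
  case (elim \<gamma>)
  hence \<gamma>: "\<gamma> \<in> characters" by simp
  have [measurable]: "(\<lambda>u. F (flow u \<gamma>)) \<in> borel_measurable borel"
    using measurable_compose[OF measurable_flow_t[OF \<gamma>] F_meas] .
  have m: "(\<lambda>u. cmod (F (flow u \<gamma>) - characters.psum a (r k) (flow u \<gamma>)) * (1 / (1 + u\<^sup>2))) \<in> borel_measurable borel" for k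
    unfolding psum_flow by measurable
  show ?case
  proof
    show "cmod (F (flow u \<gamma>)) \<le> M" for u using M[OF flow_character[OF \<gamma>]] .
    have eq: "enn2real (\<integral>\<^sup>+u. ennreal (cmod (F (flow u \<gamma>) - characters.psum a (r k) (flow u \<gamma>)) * (1 / (1 + u\<^sup>2))) \<partial>lborel) =
       (\<integral>u. cmod (F (flow u \<gamma>) - (\<Sum>n=1..r k. twist a \<gamma> n * vertical u n)) * (1 / (1 + u\<^sup>2)) \<partial>lborel)" for k
      using m[of k] by (subst integral_eq_nn_integral) (auto simp: psum_flow)
    have "(\<lambda>k. enn2real (\<integral>\<^sup>+u. ennreal (cmod (F (flow u \<gamma>) - characters.psum a (r k) (flow u \<gamma>)) * (1 / (1 + u\<^sup>2))) \<partial>lborel)) \<longlonglongrightarrow> enn2real 0"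
      using elim(1) by (intro tendsto_enn2real) auto
    thus "(\<lambda>k. \<integral>u. cmod (F (flow u \<gamma>) - (\<Sum>n=1..r k. twist a \<gamma> n * vertical u n)) * (1 / (1 + u\<^sup>2)) \<partial>lborel) \<longlonglongrightarrow> 0"
      unfolding eq by simp
  qed (use r_mono in auto)
qed

end

lemma cnj_character: "\<gamma> \<in> characters \<Longrightarrow> (\<lambda>n. cnj (\<gamma> n)) \<in> characters"
  by (auto simp: characters_def)

text \<open>By Kronecker's theorem suitable vertical translates undo the twist by \<open>\<gamma>\<close>.\<close>

lemma boundary_function_H_infinity:
  assumes "boundary_function (twist a \<gamma>) g M r" and \<gamma>: "\<gamma> \<in> characters"
  shows "a \<in> H_infinity"
proof -
  interpret boundary_function "twist a \<gamma>" g M r by fact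
  obtain t where t: "\<And>n. (\<lambda>j::nat. vertical (t j) n) \<longlonglongrightarrow> cnj (\<gamma> n)"
    using kronecker_vertical[OF cnj_character[OF \<gamma>]] by blast
  define b where "b j = twist (twist a \<gamma>) (vertical (t j))" for j
  have lim: "(\<lambda>j. b j n) \<longlonglongrightarrow> a n" if "n \<ge> 1" for n
  proof -
    have "(\<lambda>j. a n * \<gamma> n * vertical (t j) n) \<longlonglongrightarrow> a n * \<gamma> n * cnj (\<gamma> n)"
      by (intro tendsto_intros t)
    also have "a n * \<gamma> n * cnj (\<gamma> n) = a n"
      using norm_character[OF \<gamma> that] complex_norm_square[of "\<gamma> n"] by (simp add: mult.assoc)
    finally show ?thesis by (simp add: b_def twist_def)
  qed
  \<comment> \<open>One constant serves all j, since \<open>partial_sum_bound\<close> is uniform in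
    the translation.\<close>
  have bound: "\<exists>C\<ge>0. \<forall>N\<ge>1. \<forall>j. cmod (coeff_sum (b j) N) \<le> C * real N powr \<eta>" if \<eta>: "0 < \<eta>" "\<eta> \<le> 1" for \<eta>
  proof -
    obtain C where C: "C \<ge> 0" "\<And>N. N \<ge> 1 \<Longrightarrow> (\<integral>u. \<bar>trapezoid N u\<bar> \<partial>lborel) \<le> C * real N powr \<eta>"
      using trapezoid_L1[OF \<eta>] by blast
    have "cmod (coeff_sum (b j) N) \<le> M * C * real N powr \<eta>" if "N \<ge> 1" for j N
      unfolding b_def mult.assoc
      by (rule order_trans[OF partial_sum_bound[OF that] mult_left_mono[OF C(2)[OF that] M_nonneg]])
    thus ?thesis using C M_nonneg by (intro exI[of _ "M * C"]) auto
  qed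
  have sub: "subpolynomial_sums a"
    unfolding subpolynomial_sums_def
  proof (intro allI impI, elim conjE)
    fix \<eta> :: real assume \<eta>: "0 < \<eta>" "\<eta> \<le> 1"
    obtain C where C: "C \<ge> 0" "\<And>N j. N \<ge> 1 \<Longrightarrow> cmod (coeff_sum (b j) N) \<le> C * real N powr \<eta>"
      using bound[OF \<eta>] by blast
    have "cmod (coeff_sum a N) \<le> C * real N powr \<eta>" if N: "N \<ge> 1" for N
    proof (rule LIMSEQ_le_const2)
      show "(\<lambda>j. cmod (coeff_sum (b j) N)) \<longlonglongrightarrow> cmod (coeff_sum a N)"
        unfolding coeff_sum_def by (intro tendsto_norm tendsto_sum lim) auto
    qed (use C(2)[OF N] in auto)
    thus "\<exists>C\<ge>0. \<forall>N\<ge>1. cmod (coeff_sum a N) \<le> C * real N powr \<eta>" using C(1) by blast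
  qed
  have "cmod (dirichlet_sum a s) \<le> M" if s: "Re s > 0" for s
  proof -
    define \<eta> where "\<eta> = min 1 (Re s / 2)"
    have \<eta>: "0 < \<eta>" "\<eta> \<le> 1" "\<eta> < Re s" using s by (auto simp: \<eta>_def)
    obtain C where C: "C \<ge> 0" "\<And>N j. N \<ge> 1 \<Longrightarrow> cmod (coeff_sum (b j) N) \<le> C * real N powr \<eta>"
      using bound[OF \<eta>(1,2)] by blast
    have "(\<lambda>j. dirichlet_sum (b j) s) \<longlonglongrightarrow> dirichlet_sum a s"
      by (rule dirichlet_sum_tendsto[OF lim C(2,1)]) (use \<eta> in auto)
    moreover have "cmod (dirichlet_sum (b j) s) \<le> M" for j
    proof -
      have "dirichlet_sum (b j) s = dirichlet_sum (twist a \<gamma>) (s + \<i> * of_real (t j))"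
        by (simp add: dirichlet_sum_def b_def dirichlet_term_vertical)
      thus ?thesis using dirichlet_sum_bound[of "s + \<i> * of_real (t j)"] s by simp
    qed
    ultimately show ?thesis by (intro LIMSEQ_le_const2[OF tendsto_norm]) auto
  qed
  hence "bounded (dirichlet_sum a ` {s. Re s > 0})" by (auto simp: bounded_iff)
  with subpolynomial_summable[OF sub] subpolynomial_holomorphic[OF sub]
  show ?thesis by (simp add: H_infinity_def)
qed

theorem (in torus_function) boundary_values_if_bounded:
  assumes M: "AE \<gamma> in character_haar. cmod (F \<gamma>) \<le> M" "M \<ge> 0"
  shows "a \<in> H_infinity"
    and "AE \<gamma> in character_haar. AE t in lborel. boundary_value (twist a \<gamma>) t = F (flow t \<gamma>)"
proof -
  \<comment> \<open>Truncation turns the essential bound into a bound everywhere;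
    \<open>AE_flow\<close> then shows that F' and F agree almost everywhere along almost every
    orbit.\<close>
  define F' where "F' \<gamma> = (if cmod (F \<gamma>) \<le> M then F \<gamma> else 0)" for \<gamma>
  have F'm [measurable]: "F' \<in> borel_measurable character_haar" unfolding F'_def by measurable
  have ae: "AE \<gamma> in character_haar. F' \<gamma> = F \<gamma>" using M(1) by eventually_elim (simp add: F'_def)
  interpret T: torus_function a F' r
  proof
    show "strict_mono r" by (rule r_mono)
    have "integrable character_haar (\<lambda>\<gamma>. (cmod (F' \<gamma>))\<^sup>2)"
      by (rule integrable_cong_AE[THEN iffD1, of "\<lambda>\<gamma>. (cmod (F \<gamma>))\<^sup>2"])
         (use F_sq ae in \<open>auto simp: sq_integrable_def\<close>)
    thus "sq_integrable character_haar F'" by (simp add: sq_integrable_def)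
    show "(\<integral>\<gamma>. (cmod (F' \<gamma> - characters.psum a (r k) \<gamma>))\<^sup>2 \<partial>character_haar) \<le> (1/4) ^ k" for k
    proof -
      have "(\<integral>\<gamma>. (cmod (F' \<gamma> - characters.psum a (r k) \<gamma>))\<^sup>2 \<partial>character_haar) =
          (\<integral>\<gamma>. (cmod (F \<gamma> - characters.psum a (r k) \<gamma>))\<^sup>2 \<partial>character_haar)"
        by (rule integral_cong_AE) (use ae in auto)
      thus ?thesis using F_approx[of k] by simp
    qed
  qed
  have bf: "AE \<gamma> in character_haar. boundary_function (twist a \<gamma>) (\<lambda>u. F' (flow u \<gamma>)) M r"
    by (rule T.AE_boundary_function_bounded) (auto simp: F'_def M)
  \<comment> \<open>The statement does not mention \<gamma>: one good character suffices, and on a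
    probability space one exists.\<close>
  have "AE \<gamma> in character_haar. a \<in> H_infinity"
    using bf AE_space by eventually_elim (auto intro: boundary_function_H_infinity)
  thus "a \<in> H_infinity"
    using characters.emeasure_space_1 by (simp add: eventually_const_iff ae_filter_eq_bot_iff)
  have "AE \<gamma> in character_haar. AE t in lborel. F' (flow t \<gamma>) = F (flow t \<gamma>)"
  proof (rule AE_flow[THEN iffD2])
    have "{\<gamma> \<in> space character_haar. F' \<gamma> = F \<gamma>} \<in> sets character_haar" by measurable
    thus "{\<gamma> \<in> characters. F' \<gamma> = F \<gamma>} \<in> sets character_haar" by simp
  qed (rule ae)
  thus "AE \<gamma> in character_haar. AE t in lborel. boundary_value (twist a \<gamma>) t = F (flow t \<gamma>)"
    using bf
  proof eventually_elim
    case (elim \<gamma>)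
    show ?case using elim(1) boundary_function.boundary_value_eq[OF elim(2)]
      by eventually_elim simp
  qed
qed

section \<open>Gaussian averages of bounded Dirichlet series\<close>

text \<open>Averaging \<open>n\<^sup>-\<^sup>s\<close> over \<open>s = \<epsilon> + \<i>(t + v sqrt \<epsilon>)\<close> with \<open>v\<close> standard normal gives \<open>n\<^sup>-\<^sup>i\<^sup>t\<close> times this
  weight.\<close>

definition gauss_weight :: "real \<Rightarrow> nat \<Rightarrow> real" where
  "gauss_weight \<epsilon> n = exp (- \<epsilon> * ln (real n) - \<epsilon> * (ln (real n))\<^sup>2 / 2)"

lemma gauss_weight_pos: "gauss_weight \<epsilon> n > 0"
  by (simp add: gauss_weight_def)

lemma gauss_weight_le_1: "\<epsilon> \<ge> 0 \<Longrightarrow> gauss_weight \<epsilon> n \<le> 1"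
proof -
  assume "\<epsilon> \<ge> 0"
  moreover have "ln (real n) \<ge> 0" by (cases "n = 0") auto
  ultimately have "\<epsilon> * ln (real n) \<ge> 0" "\<epsilon> * (ln (real n))\<^sup>2 / 2 \<ge> 0" by auto
  thus ?thesis unfolding gauss_weight_def exp_le_one_iff by linarith
qed

text \<open>The quadratic term in the exponent beats every power of n: once
  \<open>ln n \<ge> 4 / \<epsilon>\<close> it alone exceeds 2 ln n.\<close>

lemma summable_gauss_weight:
  assumes "\<epsilon> > 0"
  shows "summable (gauss_weight \<epsilon>)"
proof (rule summable_comparison_test_ev)
  show "summable (\<lambda>n. real n powr (-2))" by (simp add: summable_real_powr_iff)
  have "filterlim (\<lambda>n. ln (real n)) at_top sequentially" by real_asymp
  hence "\<forall>\<^sub>F n in sequentially. ln (real n) \<ge> 4 / \<epsilon>" by (auto simp: filterlim_at_top)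
  thus "\<forall>\<^sub>F n in sequentially. norm (gauss_weight \<epsilon> n) \<le> real n powr (-2)"
    using eventually_gt_at_top[of 0]
  proof eventually_elim
    case (elim n)
    define L where "L = ln (real n)"
    have L: "L \<ge> 0" "4 \<le> \<epsilon> * L" using elim assms by (auto simp: L_def field_simps)
    have "4 * L \<le> \<epsilon> * L * L" using L by (intro mult_right_mono) auto
    hence "2 * L \<le> \<epsilon> * L\<^sup>2 / 2" by (simp add: power2_eq_square mult.assoc)
    moreover have "\<epsilon> * L \<ge> 0" using assms L by simp
    ultimately have "- \<epsilon> * L - \<epsilon> * L\<^sup>2 / 2 \<le> - 2 * L" by linarith
    hence "gauss_weight \<epsilon> n \<le> exp (- 2 * L)" by (simp add: gauss_weight_def L_def)
    also have "\<dots> = real n powr (-2)" using elim by (simp add: powr_def L_def)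
    finally show ?case using gauss_weight_pos[of \<epsilon> n] by simp
  qed
qed

lemma gauss_weight_tendsto: "(\<lambda>j. gauss_weight (1 / real (Suc j)) n) \<longlonglongrightarrow> 1"
proof -
  have z: "(\<lambda>j. 1 / real (Suc j)) \<longlonglongrightarrow> 0" by real_asymp
  have "(\<lambda>j. exp (- (1 / real (Suc j)) * ln (real n) - (1 / real (Suc j)) * (ln (real n))\<^sup>2 / 2)) \<longlonglongrightarrow>
      exp (- 0 * ln (real n) - 0 * (ln (real n))\<^sup>2 / 2)"
    by (intro tendsto_intros z) auto
  thus ?thesis by (simp add: gauss_weight_def)
qed

lemma vertical_gaussian:
  assumes "\<epsilon> > 0" "m \<ge> 1"
  shows "(\<integral>v. vertical (t + sqrt \<epsilon> * v) m \<partial>std_normal_distribution) =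
     vertical t m * of_real (exp (- \<epsilon> * (ln (real m))\<^sup>2 / 2))"
proof -
  have "(\<integral>v. vertical (t + sqrt \<epsilon> * v) m \<partial>std_normal_distribution) =
      (\<integral>v. vertical t m * iexp (- (sqrt \<epsilon> * ln (real m)) * v) \<partial>std_normal_distribution)"
    using assms by (intro Bochner_Integration.integral_cong refl)
      (simp add: vertical_def cis_mult cis_conv_exp exp_add[symmetric] algebra_simps)
  also have "\<dots> = vertical t m * char std_normal_distribution (- (sqrt \<epsilon> * ln (real m)))"
    unfolding char_def by (rule integral_mult_right_zero)
  also have "char std_normal_distribution (- (sqrt \<epsilon> * ln (real m))) = of_real (exp (- \<epsilon> * (ln (real m))\<^sup>2 / 2))"
    using assms by (simp add: char_std_normal_distribution power_mult_distrib)
  finally show ?thesis .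
qed

text \<open>Supplies the majorant for integrating the series along a vertical line. Convergence at
  \<delta> bounds the partial sums of the coefficients a(n) n^(-\<delta>); Abel summation at
  distance \<delta> further right costs a factor of the modulus of s, hence linear growth in
  u.\<close>

lemma partial_sum_growth:
  assumes "summable (dirichlet_term a (of_real \<delta>))" and \<delta>: "\<delta> > 0"
  shows "\<exists>B\<ge>0. \<forall>N u. cmod (\<Sum>n<N. dirichlet_term a (Complex (2 * \<delta>) u) n) \<le> B * (1 + \<bar>u\<bar>)"
proof -
  define b where "b n = a n * of_nat n powr (- of_real \<delta>)" for n
  have bt: "dirichlet_term b s n = dirichlet_term a (of_real \<delta> + s) n" for s n
    by (simp add: dirichlet_term_def b_def powr_add mult.assoc del: of_nat_Suc)
       (simp add: powr_diff powr_minus divide_inverse mult.assoc del: of_nat_Suc)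
  have cs: "coeff_sum b N = (\<Sum>n<N. dirichlet_term a (of_real \<delta>) n)" for N
  proof -
    have "coeff_sum b N = (\<Sum>n<N. b (Suc n))"
      unfolding coeff_sum_def by (rule sum.reindex_bij_witness[of _ Suc "\<lambda>n. n - 1"]) auto
    thus ?thesis by (simp add: b_def dirichlet_term_def)
  qed
  have "convergent (coeff_sum b)"
    using assms(1) unfolding summable_iff_convergent cs [abs_def] .
  hence "Bseq (coeff_sum b)" by (rule convergent_imp_Bseq)
  then obtain B where B: "B > 0" "\<And>N. cmod (coeff_sum b N) \<le> B" by (auto simp: Bseq_def)
  define Z where "Z = (\<Sum>n. real (Suc n) powr (0 - \<delta> - 1))"
  have Zs: "summable (\<lambda>n. real (Suc n) powr (0 - \<delta> - 1))" using \<delta> by (intro summable_powr_Suc) auto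
  have Z: "Z \<ge> 0" unfolding Z_def by (intro suminf_nonneg Zs) auto
  show ?thesis
  proof (intro exI[of _ "B + B * (\<delta> + 1) * Z"] conjI allI)
    show "0 \<le> B + B * (\<delta> + 1) * Z" using B \<delta> Z by (intro add_nonneg_nonneg mult_nonneg_nonneg) auto
    fix N u
    define s where "s = Complex \<delta> u"
    have s: "Re s = \<delta>" by (simp add: s_def)
    have sn: "cmod s \<le> (\<delta> + 1) * (1 + \<bar>u\<bar>)"
    proof -
      have "cmod s \<le> \<delta> + \<bar>u\<bar>" using cmod_le[of s] \<delta> by (simp add: s_def)
      also have "\<dots> \<le> (\<delta> + 1) * (1 + \<bar>u\<bar>)" using \<delta> by (simp add: algebra_simps)
      finally show ?thesis .
    qed
    have "(\<Sum>n<N. dirichlet_term a (Complex (2 * \<delta>) u) n) = (\<Sum>n<N. dirichlet_term b s n)"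
    proof -
      have "Complex (2 * \<delta>) u = of_real \<delta> + s" by (simp add: s_def complex_eq_iff)
      thus ?thesis by (simp add: bt)
    qed
    also have "\<dots> = coeff_sum b N * of_nat (Suc N) powr (- s) +
       (\<Sum>n<N. coeff_sum b (Suc n) * (of_nat (Suc n) powr (- s) - of_nat (Suc (Suc n)) powr (- s)))"
      by (rule abel_summation)
    also have "cmod \<dots> \<le> B * 1 + (\<Sum>n<N. B * cmod s * real (Suc n) powr (0 - \<delta> - 1))"
    proof (rule order_trans[OF norm_triangle_ineq add_mono])
      have "cmod (of_nat (Suc N) powr (- s)) = real (Suc N) powr (- \<delta>)"
        using norm_powr_real_powr[of "of_nat (Suc N)" "- s"] s by simp
      also have "\<dots> \<le> 1" using \<delta> powr_mono[of "-\<delta>" 0 "real (Suc N)"] by simp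
      finally show "cmod (coeff_sum b N * of_nat (Suc N) powr (- s)) \<le> B * 1"
        unfolding norm_mult using B by (intro mult_mono) auto
      show "cmod (\<Sum>n<N. coeff_sum b (Suc n) * (of_nat (Suc n) powr (- s) - of_nat (Suc (Suc n)) powr (- s)))
         \<le> (\<Sum>n<N. B * cmod s * real (Suc n) powr (0 - \<delta> - 1))"
      proof (rule order_trans[OF norm_sum sum_mono])
        fix n
        show "cmod (coeff_sum b (Suc n) * (of_nat (Suc n) powr (- s) - of_nat (Suc (Suc n)) powr (- s)))
           \<le> B * cmod s * real (Suc n) powr (0 - \<delta> - 1)"
          using abel_term_bound[of b B 0 s n] B \<delta> s by simp
      qed
    qed
    also have "(\<Sum>n<N. B * cmod s * real (Suc n) powr (0 - \<delta> - 1)) = B * cmod s * (\<Sum>n<N. real (Suc n) powr (0 - \<delta> - 1))"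
      by (simp only: sum_distrib_left)
    also have "B * 1 + \<dots> \<le> B * 1 + B * ((\<delta> + 1) * (1 + \<bar>u\<bar>)) * Z"
      unfolding Z_def using B sn \<delta>
      by (intro add_left_mono mult_mono sum_le_suminf Zs sum_nonneg mult_left_mono) auto
    also have "\<dots> \<le> (B + B * (\<delta> + 1) * Z) * (1 + \<bar>u\<bar>)"
      using B by (simp add: algebra_simps)
    finally show "cmod (\<Sum>n<N. dirichlet_term a (Complex (2 * \<delta>) u) n) \<le> (B + B * (\<delta> + 1) * Z) * (1 + \<bar>u\<bar>)" .
  qed
qed

text \<open>The weights are summable, so for bounded coefficients this converges absolutely at every
  character, where the twisted series on the boundary need not converge.\<close>

definition gauss_sum :: "(nat \<Rightarrow> complex) \<Rightarrow> real \<Rightarrow> (nat \<Rightarrow> complex) \<Rightarrow> complex" where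
  "gauss_sum a \<epsilon> \<gamma> = (\<Sum>n. a (Suc n) * of_real (gauss_weight \<epsilon> (Suc n)) * \<gamma> (Suc n))"

text \<open>At a vertical character this sum is the mean of D over the line Re s = \<epsilon> with
  respect to a normal law, hence bounded by M. Exchanging sum and mean uses the linear growth of the
  partial sums and the finite second moment of the law.\<close>

lemma gauss_sum_vertical_bound:
  assumes conv: "\<And>s. Re s > 0 \<Longrightarrow> summable (dirichlet_term a s)"
    and M: "\<And>s. Re s > 0 \<Longrightarrow> cmod (dirichlet_sum a s) \<le> M" and \<epsilon>: "\<epsilon> > 0"
  shows "cmod (gauss_sum a \<epsilon> (vertical t)) \<le> M"
proof -
  let ?P = "std_normal_distribution"
  interpret P: real_distribution ?P by (rule real_dist_normal_dist)
  let ?s = "\<lambda>v. Complex \<epsilon> (t + sqrt \<epsilon> * v)"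
  let ?D = "\<lambda>N v. \<Sum>n<N. dirichlet_term a (?s v) n"
  \<comment> \<open>Half of \<epsilon> is used because \<open>partial_sum_growth\<close> doubles its
    parameter.\<close>
  obtain B where B: "B \<ge> 0" "\<And>N u. cmod (\<Sum>n<N. dirichlet_term a (Complex \<epsilon> u) n) \<le> B * (1 + \<bar>u\<bar>)"
    using partial_sum_growth[of a "\<epsilon> / 2"] conv[of "of_real (\<epsilon> / 2)"] \<epsilon> by auto
  have form: "dirichlet_term a (?s v) n = a (Suc n) * of_nat (Suc n) powr (- of_real \<epsilon>) * vertical (t + sqrt \<epsilon> * v) (Suc n)" for n v
  proof -
    have "?s v = of_real \<epsilon> + \<i> * of_real (t + sqrt \<epsilon> * v)" by (simp add: complex_eq_iff)
    hence "dirichlet_term a (?s v) n = dirichlet_term (twist a (vertical (t + sqrt \<epsilon> * v))) (of_real \<epsilon>) n"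
      by (simp only: dirichlet_term_vertical)
    thus ?thesis by (simp add: dirichlet_term_def twist_def mult_ac)
  qed
  have vm [measurable]: "(\<lambda>v. vertical (t + sqrt \<epsilon> * v) n) \<in> borel_measurable borel" for n
    using measurable_compose[OF _ vertical_measurable, of "\<lambda>v. t + sqrt \<epsilon> * v"] by simp
  have Dm [measurable]: "?D N \<in> borel_measurable borel" for N
    unfolding form by measurable
  have lim: "(\<lambda>N. ?D N v) \<longlonglongrightarrow> dirichlet_sum a (?s v)" for v
    unfolding dirichlet_sum_def by (rule summable_LIMSEQ[OF conv]) (use \<epsilon> in simp)
  have Sm [measurable]: "(\<lambda>v. dirichlet_sum a (?s v)) \<in> borel_measurable borel"
    by (rule borel_measurable_LIMSEQ_metric[OF Dm lim])
  have "(\<lambda>N. \<integral>v. ?D N v \<partial>?P) \<longlonglongrightarrow> (\<integral>v. dirichlet_sum a (?s v) \<partial>?P)"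
  \<comment> \<open>The majorant comes from
    \<open>2 * sqrt \<epsilon> * \<bar>v\<bar> \<le> \<epsilon> + v^2\<close>, applied to the linear
    bound at height \<open>t + sqrt \<epsilon> * v\<close>.\<close>
  proof (rule integral_dominated_convergence[where w = "\<lambda>v. B * (2 + \<bar>t\<bar> + \<epsilon> + v ^ 2)"])
    show "integrable ?P (\<lambda>v. B * (2 + \<bar>t\<bar> + \<epsilon> + v ^ 2))"
      using integrable_std_normal_distribution_moment[of 2]
      by (intro integrable_mult_right Bochner_Integration.integrable_add) auto
    show "AE v in ?P. (\<lambda>N. ?D N v) \<longlonglongrightarrow> dirichlet_sum a (?s v)" using lim by simp
    have "cmod (?D N v) \<le> B * (2 + \<bar>t\<bar> + \<epsilon> + v ^ 2)" for N v
    proof -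
      have "cmod (?D N v) \<le> B * (1 + \<bar>t + sqrt \<epsilon> * v\<bar>)" by (rule B(2))
      also have "\<dots> \<le> B * (2 + \<bar>t\<bar> + \<epsilon> + v ^ 2)"
      proof (rule mult_left_mono[OF _ B(1)])
        have "0 \<le> (sqrt \<epsilon> - \<bar>v\<bar>)\<^sup>2" by simp
        hence "2 * (sqrt \<epsilon> * \<bar>v\<bar>) \<le> \<epsilon> + v\<^sup>2"
          using \<epsilon> by (simp add: power2_diff)
        moreover have "sqrt \<epsilon> * \<bar>v\<bar> \<ge> 0" using \<epsilon> by simp
        moreover have "\<bar>t + sqrt \<epsilon> * v\<bar> \<le> \<bar>t\<bar> + sqrt \<epsilon> * \<bar>v\<bar>"
          using abs_triangle_ineq[of t "sqrt \<epsilon> * v"] \<epsilon> by (simp add: abs_mult)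
        ultimately show "1 + \<bar>t + sqrt \<epsilon> * v\<bar> \<le> 2 + \<bar>t\<bar> + \<epsilon> + v\<^sup>2" by linarith
      qed
      finally show ?thesis .
    qed
    thus "AE v in ?P. norm (?D N v) \<le> B * (2 + \<bar>t\<bar> + \<epsilon> + v ^ 2)" for N by simp
  qed auto
  also have "(\<lambda>N. \<integral>v. ?D N v \<partial>?P) = (\<lambda>N. \<Sum>n<N. a (Suc n) * of_real (gauss_weight \<epsilon> (Suc n)) * vertical t (Suc n))"
  proof
    fix N
    have i: "integrable ?P (\<lambda>v. vertical (t + sqrt \<epsilon> * v) n)" for n
      by (rule P.integrable_const_bound[of _ 1]) (auto simp: norm_vertical)
    have "(\<integral>v. ?D N v \<partial>?P) = (\<Sum>n<N. \<integral>v. a (Suc n) * of_nat (Suc n) powr (- of_real \<epsilon>) * vertical (t + sqrt \<epsilon> * v) (Suc n) \<partial>?P)"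
      unfolding form by (intro Bochner_Integration.integral_sum integrable_mult_right i)
    also have "\<dots> = (\<Sum>n<N. a (Suc n) * of_real (gauss_weight \<epsilon> (Suc n)) * vertical t (Suc n))"
    proof (intro sum.cong refl)
      fix n
      have p: "of_nat (Suc n) powr (- of_real \<epsilon>) = (of_real (exp (- \<epsilon> * ln (real (Suc n)))) :: complex)"
      proof -
        have "of_real (real (Suc n) powr (- \<epsilon>)) = of_real (real (Suc n)) powr (of_real (- \<epsilon>) :: complex)"
          by (rule powr_of_real[symmetric]) auto
        thus ?thesis by (simp add: powr_def del: of_nat_Suc)
      qed
      have w: "gauss_weight \<epsilon> (Suc n) = exp (- \<epsilon> * ln (real (Suc n))) * exp (- \<epsilon> * (ln (real (Suc n)))\<^sup>2 / 2)"
        unfolding gauss_weight_def exp_add[symmetric] by (simp add: algebra_simps del: of_nat_Suc)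
      show "(\<integral>v. a (Suc n) * of_nat (Suc n) powr (- of_real \<epsilon>) * vertical (t + sqrt \<epsilon> * v) (Suc n) \<partial>?P) =
          a (Suc n) * of_real (gauss_weight \<epsilon> (Suc n)) * vertical t (Suc n)"
        unfolding integral_mult_right_zero p w of_real_mult
        using vertical_gaussian[OF \<epsilon>, of "Suc n" t] by (simp only: mult_ac le_add2 One_nat_def Suc_le_mono le0)
    qed
    finally show "(\<integral>v. ?D N v \<partial>?P) = (\<Sum>n<N. a (Suc n) * of_real (gauss_weight \<epsilon> (Suc n)) * vertical t (Suc n))" .
  qed
  finally have "gauss_sum a \<epsilon> (vertical t) = (\<integral>v. dirichlet_sum a (?s v) \<partial>?P)"
    unfolding gauss_sum_def by (intro sums_unique[symmetric]) (simp add: sums_def)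
  also have "cmod \<dots> \<le> (\<integral>v. M \<partial>?P)"
  proof (rule Bochner_Integration.integral_norm_bound_integral)
    have b: "cmod (dirichlet_sum a (?s v)) \<le> M" for v by (rule M) (use \<epsilon> in simp)
    show "integrable ?P (\<lambda>v. dirichlet_sum a (?s v))"
      by (rule P.integrable_const_bound[of _ M]) (use b in auto)
    show "norm (dirichlet_sum a (?s v)) \<le> M" for v by (rule b)
  qed auto
  also have "\<dots> = M" using P.prob_space by simp
  finally show ?thesis .
qed

text \<open>The terms are dominated by A times the weights uniformly in the character, so the bound
  survives the limit along vertical characters tending to \<gamma>.\<close>

lemma gauss_sum_bound:
  assumes conv: "\<And>s. Re s > 0 \<Longrightarrow> summable (dirichlet_term a s)"
    and M: "\<And>s. Re s > 0 \<Longrightarrow> cmod (dirichlet_sum a s) \<le> M" and \<epsilon>: "\<epsilon> > 0"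
    and a: "\<And>n. cmod (a n) \<le> A" and \<gamma>: "\<gamma> \<in> characters"
  shows "cmod (gauss_sum a \<epsilon> \<gamma>) \<le> M"
proof -
  obtain t where t: "\<And>n. (\<lambda>j::nat. vertical (t j) n) \<longlonglongrightarrow> \<gamma> n"
    using kronecker_vertical[OF \<gamma>] by blast
  have A: "A \<ge> 0" using a[of 0] norm_ge_zero order_trans by blast
  have "(\<lambda>j. gauss_sum a \<epsilon> (vertical (t j))) \<longlonglongrightarrow> gauss_sum a \<epsilon> \<gamma>"
    unfolding gauss_sum_def
  proof (rule tannerys_theorem[THEN conjunct2, THEN conjunct2])
    show "(\<lambda>j. a (Suc n) * of_real (gauss_weight \<epsilon> (Suc n)) * vertical (t j) (Suc n)) \<longlonglongrightarrow>
        a (Suc n) * of_real (gauss_weight \<epsilon> (Suc n)) * \<gamma> (Suc n)" for n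
      by (intro tendsto_intros t)
    show "\<forall>\<^sub>F (n, j) in at_top \<times>\<^sub>F sequentially.
        cmod (a (Suc n) * of_real (gauss_weight \<epsilon> (Suc n)) * vertical (t j) (Suc n)) \<le> A * gauss_weight \<epsilon> (Suc n)"
    proof (intro always_eventually allI, clarify)
      fix n j
      have "cmod (a (Suc n)) * gauss_weight \<epsilon> (Suc n) * cmod (vertical (t j) (Suc n)) \<le> A * gauss_weight \<epsilon> (Suc n) * 1"
        using a A gauss_weight_pos[of \<epsilon> "Suc n"] norm_vertical
        by (intro mult_mono mult_nonneg_nonneg) auto
      thus "cmod (a (Suc n) * of_real (gauss_weight \<epsilon> (Suc n)) * vertical (t j) (Suc n)) \<le> A * gauss_weight \<epsilon> (Suc n)"
        using gauss_weight_pos[of \<epsilon> "Suc n"] by (simp add: norm_mult)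
    qed
    show "summable (\<lambda>n. A * gauss_weight \<epsilon> (Suc n))"
      using summable_gauss_weight[OF \<epsilon>] by (intro summable_mult) (simp add: summable_Suc_iff)
  qed auto
  from tendsto_norm[OF this] show ?thesis
    by (rule LIMSEQ_le_const2) (use gauss_sum_vertical_bound[OF conv M \<epsilon>] in auto)
qed

text \<open>The Gaussian sums lie in the closed ball of radius M at every character and converge to
  F in L^2 as the regularisation is removed; being essentially bounded by M is preserved.\<close>

lemma (in torus_function) H_infinity_imp_bounded:
  assumes a: "summable (\<lambda>n. (cmod (a n))\<^sup>2)" and H: "a \<in> H_infinity"
  obtains M where "M \<ge> 0" "AE \<gamma> in character_haar. cmod (F \<gamma>) \<le> M"
proof -
  have conv: "\<And>s. Re s > 0 \<Longrightarrow> summable (dirichlet_term a s)" using H by (auto simp: H_infinity_def)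
  have "bounded (dirichlet_sum a ` {s. Re s > 0})" using H by (simp add: H_infinity_def)
  then obtain M where M: "\<And>s. Re s > 0 \<Longrightarrow> cmod (dirichlet_sum a s) \<le> M"
    by (auto simp: bounded_iff)
  have M0: "M \<ge> 0" by (rule order_trans[OF norm_ge_zero M[of 1]]) simp
  have "Bseq (\<lambda>n. (cmod (a n))\<^sup>2)" 
    by (intro convergent_imp_Bseq convergentI[OF summable_LIMSEQ_zero[OF a]])
  then obtain K where "\<forall>n. norm ((cmod (a n))\<^sup>2) \<le> K" unfolding Bseq_def by blast
  hence K: "\<And>n. (cmod (a n))\<^sup>2 \<le> K" by simp
  have A: "cmod (a n) \<le> sqrt K" for n using K[of n] real_le_rsqrt by blast
  have pl: "AE \<gamma> in character_haar. (\<lambda>k. characters.psum a (r k) \<gamma>) \<longlonglongrightarrow> F \<gamma>"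
  proof -
    have "AE \<gamma> in character_haar. summable (\<lambda>k. cmod (F \<gamma> - characters.psum a (r k) \<gamma>))"
      by (rule characters.AE_summable_if_L1_small) (use F_approx_L1 in auto)
    thus ?thesis
    proof eventually_elim
      case (elim \<gamma>)
      hence "(\<lambda>k. F \<gamma> - characters.psum a (r k) \<gamma>) \<longlonglongrightarrow> 0"
        using summable_LIMSEQ_zero tendsto_norm_zero_iff by blast
      from tendsto_diff[OF tendsto_const[of "F \<gamma>"] this] show ?case by simp
    qed
  qed
  define \<epsilon> where "\<epsilon> j = 1 / real (Suc j)" for j
  define c where "c j n = a n * of_real (gauss_weight (\<epsilon> j) n)" for j n
  \<comment> \<open>Index 0 is included, as only an upper bound for the squared L^2 distance between
    F and the Gaussian sum is needed.\<close>
  define \<Delta> where "\<Delta> j = (\<Sum>n. (cmod (a n - c j n))\<^sup>2)" for j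
  have \<epsilon>: "\<epsilon> j > 0" for j by (simp add: \<epsilon>_def)
  have ac: "cmod (a n - c j n) = cmod (a n) * (1 - gauss_weight (\<epsilon> j) n)" for j n
  proof -
    have "a n - c j n = a n * of_real (1 - gauss_weight (\<epsilon> j) n)" by (simp add: c_def right_diff_distrib)
    thus ?thesis using gauss_weight_le_1[of "\<epsilon> j" n] \<epsilon>[of j] by (simp add: norm_mult del: of_real_diff)
  qed
  have acle: "(cmod (a n - c j n))\<^sup>2 \<le> (cmod (a n))\<^sup>2" for j n
    unfolding ac using gauss_weight_le_1[of "\<epsilon> j" n] \<epsilon>[of j] gauss_weight_pos[of "\<epsilon> j" n]
    by (intro power_mono mult_left_le) auto
  have acs: "summable (\<lambda>n. (cmod (a n - c j n))\<^sup>2)" for j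
    by (rule summable_comparison_test'[OF a]) (use acle in auto)
  have D0: "\<Delta> \<longlonglongrightarrow> 0"
  proof -
    have "(\<lambda>j. \<Sum>n. (cmod (a n - c j n))\<^sup>2) \<longlonglongrightarrow> (\<Sum>n. 0)"
    proof (rule tannerys_theorem[THEN conjunct2, THEN conjunct2])
      show "(\<lambda>j. (cmod (a n - c j n))\<^sup>2) \<longlonglongrightarrow> 0" for n
      proof -
        have "(\<lambda>j. (cmod (a n) * (1 - gauss_weight (\<epsilon> j) n))\<^sup>2) \<longlonglongrightarrow> (cmod (a n) * (1 - 1))\<^sup>2"
          unfolding \<epsilon>_def by (intro tendsto_intros gauss_weight_tendsto)
        thus ?thesis by (simp add: ac)
      qed
      show "\<forall>\<^sub>F (n, j) in at_top \<times>\<^sub>F sequentially. norm ((cmod (a n - c j n))\<^sup>2) \<le> (cmod (a n))\<^sup>2"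
        by (intro always_eventually allI, clarify) (simp add: acle)
    qed (use a in auto)
    thus ?thesis by (simp add: \<Delta>_def [abs_def])
  qed
  \<comment> \<open>The excess of F over M is at most its distance to any function bounded by M, so
    its squared norm is at most \<open>\<Delta> j\<close> for every j and hence 0. This avoids
    choosing an almost everywhere convergent subsequence of the Gaussian sums.\<close>
  define \<psi> where "\<psi> \<gamma> = max 0 (cmod (F \<gamma>) - M)" for \<gamma>
  have \<psi>m [measurable]: "\<psi> \<in> borel_measurable character_haar" unfolding \<psi>_def by measurable
  have est: "integrable character_haar (\<lambda>\<gamma>. (\<psi> \<gamma>)\<^sup>2) \<and> (\<integral>\<gamma>. (\<psi> \<gamma>)\<^sup>2 \<partial>character_haar) \<le> \<Delta> j" for j
  proof -
    let ?E = "gauss_sum a (\<epsilon> j)"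
    let ?f = "\<lambda>k. characters.psum (\<lambda>n. a n - c j n) (r k)"
    have El: "(\<lambda>k. characters.psum (c j) (r k) \<gamma>) \<longlonglongrightarrow> ?E \<gamma>" if \<gamma>: "\<gamma> \<in> characters" for \<gamma>
    proof -
      have "summable (\<lambda>n. a (Suc n) * of_real (gauss_weight (\<epsilon> j) (Suc n)) * \<gamma> (Suc n))"
      proof (rule summable_comparison_test')
        show "summable (\<lambda>n. sqrt K * gauss_weight (\<epsilon> j) (Suc n))"
          using summable_gauss_weight[OF \<epsilon>] by (intro summable_mult) (simp add: summable_Suc_iff)
        show "cmod (a (Suc n) * of_real (gauss_weight (\<epsilon> j) (Suc n)) * \<gamma> (Suc n)) \<le> sqrt K * gauss_weight (\<epsilon> j) (Suc n)" if "n \<ge> 0" for n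
          using A[of "Suc n"] gauss_weight_pos[of "\<epsilon> j" "Suc n"] norm_character[OF \<gamma>, of "Suc n"]
          by (simp add: norm_mult)
      qed
      hence "(\<lambda>N. \<Sum>n<N. a (Suc n) * of_real (gauss_weight (\<epsilon> j) (Suc n)) * \<gamma> (Suc n)) \<longlonglongrightarrow> ?E \<gamma>"
        unfolding gauss_sum_def by (rule summable_LIMSEQ)
      moreover have "(\<Sum>n<N. a (Suc n) * of_real (gauss_weight (\<epsilon> j) (Suc n)) * \<gamma> (Suc n)) = characters.psum (c j) N \<gamma>" for N
        unfolding characters.psum_def c_def
        by (rule sum.reindex_bij_witness[of _ "\<lambda>n. n - 1" Suc]) auto
      ultimately have "(\<lambda>N. characters.psum (c j) N \<gamma>) \<longlonglongrightarrow> ?E \<gamma>" by simp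
      from LIMSEQ_subseq_LIMSEQ[OF this r_mono] show ?thesis by (simp add: o_def)
    qed
    have Em [measurable]: "?E \<in> borel_measurable character_haar"
      by (rule borel_measurable_LIMSEQ_metric[OF _ El]) auto
    have diff: "?f k \<gamma> = characters.psum a (r k) \<gamma> - characters.psum (c j) (r k) \<gamma>" for k \<gamma>
      by (simp add: characters.psum_def left_diff_distrib sum_subtractf)
    have l: "AE \<gamma> in character_haar. (\<lambda>k. ?f k \<gamma>) \<longlonglongrightarrow> F \<gamma> - ?E \<gamma>"
      using pl AE_space by eventually_elim (auto simp: diff intro!: tendsto_diff El)
    have b: "sq_integrable character_haar (?f k) \<and> (\<integral>\<gamma>. (cmod (?f k \<gamma>))\<^sup>2 \<partial>character_haar) \<le> \<Delta> j" if "k \<ge> 0" for k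
    proof
      show "sq_integrable character_haar (?f k)" by (rule characters.psum_sq)
      have "(\<integral>\<gamma>. (cmod (?f k \<gamma>))\<^sup>2 \<partial>character_haar) = (\<Sum>n\<in>{1..r k}. (cmod (a n - c j n))\<^sup>2)"
        unfolding characters.psum_def by (rule characters.integral_norm_sum_sq) auto
      also have "\<dots> \<le> \<Delta> j" unfolding \<Delta>_def by (intro sum_le_suminf acs) auto
      finally show "(\<integral>\<gamma>. (cmod (?f k \<gamma>))\<^sup>2 \<partial>character_haar) \<le> \<Delta> j" .
    qed
    have sq: "sq_integrable character_haar (\<lambda>\<gamma>. F \<gamma> - ?E \<gamma>)"
      and le: "(\<integral>\<gamma>. (cmod (F \<gamma> - ?E \<gamma>))\<^sup>2 \<partial>character_haar) \<le> \<Delta> j"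
      using characters.fatou_L2[OF _ _ l b] by auto
    have \<psi>le: "(\<psi> \<gamma>)\<^sup>2 \<le> (cmod (F \<gamma> - ?E \<gamma>))\<^sup>2" if \<gamma>: "\<gamma> \<in> characters" for \<gamma>
    proof (rule power_mono)
      have "cmod (?E \<gamma>) \<le> M" by (rule gauss_sum_bound[OF conv M \<epsilon> A \<gamma>])
      thus "\<psi> \<gamma> \<le> cmod (F \<gamma> - ?E \<gamma>)"
        using norm_triangle_ineq2[of "F \<gamma>" "?E \<gamma>"] by (simp add: \<psi>_def)
    qed (simp add: \<psi>_def)
    have i: "integrable character_haar (\<lambda>\<gamma>. (cmod (F \<gamma> - ?E \<gamma>))\<^sup>2)" using sq by (simp add: sq_integrable_def)
    have "integrable character_haar (\<lambda>\<gamma>. (\<psi> \<gamma>)\<^sup>2)"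
      by (rule Bochner_Integration.integrable_bound[OF i]) (use \<psi>le in \<open>auto intro!: AE_I2\<close>)
    moreover from this have "(\<integral>\<gamma>. (\<psi> \<gamma>)\<^sup>2 \<partial>character_haar) \<le> (\<integral>\<gamma>. (cmod (F \<gamma> - ?E \<gamma>))\<^sup>2 \<partial>character_haar)"
      by (rule integral_mono[OF _ i]) (use \<psi>le in auto)
    ultimately show ?thesis using le by simp
  qed
  have "(\<integral>\<gamma>. (\<psi> \<gamma>)\<^sup>2 \<partial>character_haar) \<le> 0"
    by (rule LIMSEQ_le_const[OF D0]) (use est in auto)
  moreover have "(\<integral>\<gamma>. (\<psi> \<gamma>)\<^sup>2 \<partial>character_haar) \<ge> 0" by simp
  ultimately have "(\<integral>\<gamma>. (\<psi> \<gamma>)\<^sup>2 \<partial>character_haar) = 0" by linarith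
  hence "AE \<gamma> in character_haar. (\<psi> \<gamma>)\<^sup>2 = 0"
    using est integral_nonneg_eq_0_iff_AE[of character_haar "\<lambda>\<gamma>. (\<psi> \<gamma>)\<^sup>2"] by auto
  hence "AE \<gamma> in character_haar. cmod (F \<gamma>) \<le> M"
    by eventually_elim (auto simp: \<psi>_def max_def split: if_splits)
  with M0 show ?thesis by (rule that)
qed

section \<open>Sine series and dilations\<close>

abbreviation unit_lebesgue :: "real measure" where
  "unit_lebesgue \<equiv> lebesgue_on {0<..<1}"

lemma prob_space_unit_lebesgue: "prob_space unit_lebesgue"
proof
  have "emeasure unit_lebesgue (space unit_lebesgue) = emeasure lebesgue {0<..<1::real}"
    by (simp add: emeasure_restrict_space space_restrict_space)
  thus "emeasure unit_lebesgue (space unit_lebesgue) = 1" by simp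
qed

lemma L2_unit_iff: "f \<in> L2_unit \<longleftrightarrow> sq_integrable unit_lebesgue f"
  by (simp add: L2_unit_def sq_integrable_def)

lemma measurable_unit_lebesgue: "f \<in> borel_measurable borel \<Longrightarrow> f \<in> borel_measurable unit_lebesgue"
  by (intro measurable_restrict_space1 measurable_completion) simp

lemma nn_integral_unit_lebesgue:
  "(\<integral>\<^sup>+x. f x \<partial>unit_lebesgue) = (\<integral>\<^sup>+x. f x * indicator {0<..<1} x \<partial>lborel)"
  by (simp add: nn_integral_restrict_space nn_integral_completion)

lemma AE_unit_lebesgue:
  "(AE x in unit_lebesgue. P x) \<longleftrightarrow> (AE x in lborel. 0 < x \<and> x < 1 \<longrightarrow> P x)"
  by (simp add: AE_restrict_space_iff AE_completion_iff)

lemma integral_unit_FTC: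
  fixes f F :: "real \<Rightarrow> real"
  assumes F: "\<And>x. (F has_real_derivative f x) (at x)" and f: "continuous_on UNIV f"
  shows "(\<integral>x. f x \<partial>unit_lebesgue) = F 1 - F 0"
proof -
  have cont: "continuous_on {0..1} f" using f continuous_on_subset by blast
  have hi: "(f has_integral (F 1 - F 0)) {0..1}"
    by (rule fundamental_theorem_of_calculus)
       (auto simp flip: has_real_derivative_iff_has_vector_derivative intro: has_field_derivative_at_within F)
  have si: "set_integrable lborel {0..1} f"
    by (rule borel_integrable_atLeastAtMost') (rule cont)
  have [measurable]: "f \<in> borel_measurable borel" using f by (rule borel_measurable_continuous_onI)
  have "(\<integral>x. f x \<partial>unit_lebesgue) = (\<integral>x. indicator {0<..<1} x *\<^sub>R f x \<partial>lebesgue)"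
    by (rule integral_restrict_space) simp
  also have "\<dots> = (\<integral>x. indicator {0<..<1} x *\<^sub>R f x \<partial>lborel)"
    by (rule integral_completion) measurable
  also have "\<dots> = (\<integral>x. indicator {0..1} x *\<^sub>R f x \<partial>lborel)"
  proof (rule integral_cong_AE)
    show "AE x in lborel. indicator {0<..<1} x *\<^sub>R f x = indicator {0..1} x *\<^sub>R f x"
      using AE_lborel_singleton[of 0] AE_lborel_singleton[of 1]
      by eventually_elim (auto simp: indicator_def)
  qed measurable
  also have "\<dots> = F 1 - F 0"
    using set_borel_integral_eq_integral(2)[OF si] integral_unique[OF hi]
    by (simp add: set_lebesgue_integral_def)
  finally show ?thesis .
qed

lemma integral_unit_cos:
  "(\<integral>x. cos (pi * of_int k * x) \<partial>unit_lebesgue) = (if k = 0 then 1 else 0)"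
proof (cases "k = 0")
  case True
  thus ?thesis using prob_space.prob_space[OF prob_space_unit_lebesgue] by simp
next
  case False
  have "((\<lambda>x. sin (pi * of_int k * x) / (pi * of_int k)) has_real_derivative cos (pi * of_int k * x)) (at x)" for x
    using False by (auto intro!: derivative_eq_intros)
  moreover have "continuous_on UNIV (\<lambda>x. cos (pi * of_int k * x))" by (intro continuous_intros)
  ultimately have "(\<integral>x. cos (pi * of_int k * x) \<partial>unit_lebesgue) =
      sin (pi * of_int k * 1) / (pi * of_int k) - sin (pi * of_int k * 0) / (pi * of_int k)"
    by (rule integral_unit_FTC)
  thus ?thesis using False by (simp add: sin_times_pi_eq_0 mult.commute)
qed

lemma sine_basis_measurable [measurable]: "sine_basis n \<in> borel_measurable unit_lebesgue"
  unfolding sine_basis_def [abs_def]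
  by (rule measurable_unit_lebesgue) (intro borel_measurable_continuous_onI continuous_intros)

lemma sine_basis_bound: "cmod (sine_basis n x) \<le> sqrt 2"
  unfolding sine_basis_def norm_of_real abs_mult by (auto intro!: mult_left_le)

lemma sine_basis_orthonormal:
  assumes "m \<ge> 1" "n \<ge> 1"
  shows "(\<integral>x. sine_basis m x * cnj (sine_basis n x) \<partial>unit_lebesgue) = (if m = n then 1 else 0)"
proof -
  interpret prob_space unit_lebesgue by (rule prob_space_unit_lebesgue)
  have i: "integrable unit_lebesgue (\<lambda>x. cos (pi * of_int k * x))" for k
    by (rule integrable_const_bound[of _ 1])
       (auto intro!: measurable_unit_lebesgue borel_measurable_continuous_onI continuous_intros)
  have eq: "sine_basis m x * cnj (sine_basis n x) =
      of_real (cos (pi * of_int (int m - int n) * x) - cos (pi * of_int (int m + int n) * x))" for x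
  proof -
    have "2 * (sin (pi * real m * x) * sin (pi * real n * x)) =
        cos (pi * of_int (int m - int n) * x) - cos (pi * of_int (int m + int n) * x)"
    proof -
      have "pi * of_int (int m - int n) * x = pi * real m * x - pi * real n * x"
        "pi * of_int (int m + int n) * x = pi * real m * x + pi * real n * x"
        by (simp_all add: algebra_simps)
      thus ?thesis unfolding sin_times_sin by simp
    qed
    moreover have "(sqrt 2 * sin (pi * real m * x)) * (sqrt 2 * sin (pi * real n * x)) =
        2 * (sin (pi * real m * x) * sin (pi * real n * x))"
      by simp
    ultimately show ?thesis unfolding sine_basis_def complex_cnj_complex_of_real of_real_mult[symmetric] by simp
  qed
  have "(\<integral>x. sine_basis m x * cnj (sine_basis n x) \<partial>unit_lebesgue) =
      of_real ((if int m - int n = 0 then 1 else 0) - (if int m + int n = 0 then 1 else 0))"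
    unfolding eq integral_complex_of_real Bochner_Integration.integral_diff[OF i i] integral_unit_cos ..
  thus ?thesis using assms by simp
qed

interpretation sine: bounded_orthonormal unit_lebesgue sine_basis "sqrt 2"
proof -
  interpret prob_space unit_lebesgue by (rule prob_space_unit_lebesgue)
  show "bounded_orthonormal unit_lebesgue sine_basis (sqrt 2)"
    by unfold_locales (auto simp: sine_basis_orthonormal sine_basis_bound)
qed

lemma cnj_sine_basis: "cnj (sine_basis n x) = sine_basis n x"
  by (simp add: sine_basis_def)

text \<open>Multiplication by cos (pi x) sends a sine to the mean of its two neighbours, so the
  annihilator of the sines is stable under it. The cosine is injective on (0,1) and therefore
  generates the Borel sets. Finally the first sine has no zero in (0,1).\<close>

lemma sine_uniqueness:
  assumes h: "integrable unit_lebesgue h"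
    and z: "\<And>n. n \<ge> 1 \<Longrightarrow> (\<integral>x. h x * sine_basis n x \<partial>unit_lebesgue) = 0"
  shows "AE x in unit_lebesgue. h x = 0"
proof -
  let ?E = "sine_basis ` {1..}"
  let ?X = "\<lambda>x::real. cos (pi * x)"
  let ?G = "{X -` C \<inter> space unit_lebesgue |X C. X \<in> {?X} \<and> closed C}"
  have Em: "e \<in> borel_measurable unit_lebesgue" if "e \<in> ?E" for e using that by auto
  have Eb: "\<exists>K. \<forall>x\<in>space unit_lebesgue. cmod (e x) \<le> K" if "e \<in> ?E" for e
    using that sine_basis_bound by auto
  have Xmeas: "?X \<in> borel_measurable unit_lebesgue"
    by (intro measurable_unit_lebesgue borel_measurable_continuous_onI continuous_intros)
  have step: "(\<lambda>x. g x * of_real (?X x)) \<in> annihilator unit_lebesgue ?E"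
    if g: "g \<in> annihilator unit_lebesgue ?E" for g
  proof -
    have gi: "integrable unit_lebesgue g" using g by (auto simp: annihilator_def)
    \<comment> \<open>The case n = 0 holds since \<open>sine_basis 0\<close> vanishes; it is the
      lower neighbour of the first sine.\<close>
    have gz: "(\<integral>x. g x * sine_basis n x \<partial>unit_lebesgue) = 0" for n
      using g by (cases "n = 0") (auto simp: annihilator_def sine_basis_def)
    have ge: "integrable unit_lebesgue (\<lambda>x. g x * sine_basis n x)" for n
      by (rule sine.integrable_mult_bounded[OF gi sine_basis_measurable]) (rule sine_basis_bound)
    have "integrable unit_lebesgue (\<lambda>x. g x * of_real (?X x))"
      by (rule sine.integrable_mult_bounded[OF gi, where K = 1]) (use Xmeas in auto)
    moreover have "(\<integral>x. g x * of_real (?X x) * sine_basis n x \<partial>unit_lebesgue) = 0" if n: "n \<ge> 1" for n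
    proof -
      have eq: "g x * of_real (?X x) * sine_basis n x =
          (1/2) * (g x * sine_basis (n + 1) x + g x * sine_basis (n - 1) x)" for x
      proof -
        have "sin (pi * real n * x) * cos (pi * x) = (sin (pi * real (n + 1) * x) + sin (pi * real (n - 1) * x)) / 2"
          unfolding sin_times_cos using n by (simp add: of_nat_diff algebra_simps)
        hence s: "sqrt 2 * sin (pi * real n * x) * cos (pi * x) =
            (sqrt 2 * sin (pi * real (n + 1) * x) + sqrt 2 * sin (pi * real (n - 1) * x)) / 2"
          by (simp add: distrib_left mult.assoc)
        have "of_real (?X x) * sine_basis n x = of_real (sqrt 2 * sin (pi * real n * x) * cos (pi * x))"
          by (simp add: sine_basis_def mult_ac)
        also have "\<dots> = (1/2) * (sine_basis (n + 1) x + sine_basis (n - 1) x)"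
          unfolding s by (simp add: sine_basis_def)
        finally show ?thesis by (simp only: mult.assoc mult.left_commute[of "1/2"] distrib_left)
      qed
      show ?thesis
        unfolding eq integral_mult_right_zero Bochner_Integration.integral_add[OF ge ge] gz by simp
    qed
    ultimately show ?thesis by (auto simp: annihilator_def)
  qed
  have borel_gen: "S \<in> sigma_sets (space unit_lebesgue) ?G"
    if S: "S \<in> sets borel" "S \<subseteq> {0<..<1}" for S :: "real set"
  proof -
    have sp: "space unit_lebesgue = {0<..<1}" by (simp add: space_restrict_space)
    let ?S = "sigma (space unit_lebesgue) ?G"
    have G: "?G \<subseteq> Pow (space unit_lebesgue)" by auto
    have spS: "space ?S = {0<..<1}" using G sp by (simp add: space_measure_of)
    have closed_in: "{x \<in> {0<..<1}. ?X x \<in> C} \<in> sets ?S" if "closed C" for C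
    proof -
      have "{x \<in> {0<..<1}. ?X x \<in> C} = ?X -` C \<inter> space unit_lebesgue" by (auto simp: sp)
      hence "{x \<in> {0<..<1}. ?X x \<in> C} \<in> ?G" using that by blast
      thus ?thesis using G by (simp add: sets_measure_of sigma_sets.Basic)
    qed
    have "(\<lambda>x. x) \<in> borel_measurable ?S"
    proof (rule borel_measurableI_le)
      fix y :: real
      consider "y \<le> 0" | "y \<ge> 1" | "0 < y" "y < 1" by linarith
      thus "{x \<in> space ?S. x \<le> y} \<in> sets ?S"
        unfolding spS
      proof cases
        case 1
        hence "{x \<in> {0<..<1}. x \<le> y} = {}" by auto
        thus "{x \<in> {0<..<1}. x \<le> y} \<in> sets ?S" by (simp only: sets.empty_sets)
      next
        case 2
        hence "{x \<in> {0<..<1}. x \<le> y} = space ?S" unfolding spS by auto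
        thus "{x \<in> {0<..<1}. x \<le> y} \<in> sets ?S" by (simp only: sets.top)
      next
        case 3
        \<comment> \<open>The cosine decreases on [0, pi], so initial segments of (0,1) are
          preimages of closed rays.\<close>
        have "x \<le> y \<longleftrightarrow> cos (pi * y) \<le> cos (pi * x)" if "0 < x" "x < 1" for x
          using 3 that by (subst cos_mono_le_eq) auto
        hence "{x \<in> {0<..<1}. x \<le> y} = {x \<in> {0<..<1}. ?X x \<in> {cos (pi * y)..}}" by auto
        moreover have "{x \<in> {0<..<1}. ?X x \<in> {cos (pi * y)..}} \<in> sets ?S" by (rule closed_in) simp
        ultimately show "{x \<in> {0<..<1}. x \<le> y} \<in> sets ?S" by (simp only:)
      qed
    qed
    from measurable_sets[OF this S(1)] have "S \<inter> {0<..<1} \<in> sets ?S" unfolding spS by simp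
    moreover have "S \<inter> {0<..<1} = S" using S by auto
    ultimately show ?thesis using G by (simp add: sets_measure_of)
  qed
  have gen: "\<exists>A'\<in>sigma_sets (space unit_lebesgue) ?G. AE x in unit_lebesgue. x \<in> A \<longleftrightarrow> x \<in> A'"
    if "A \<in> sets unit_lebesgue" for A
  proof -
    have A: "A \<in> sets lebesgue" "A \<subseteq> {0<..<1}"
      using that by (auto simp: sets_restrict_space_iff)
    obtain S N N' where S: "A = S \<union> N" "N \<subseteq> N'" "N' \<in> null_sets lborel" "S \<in> sets lborel"
      using sets_completionE[OF A(1)] .
    have "AE x in lborel. x \<notin> N'" by (rule AE_not_in[OF S(3)])
    hence "AE x in unit_lebesgue. x \<in> A \<longleftrightarrow> x \<in> S"
      unfolding AE_unit_lebesgue by eventually_elim (use S in auto)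
    thus ?thesis using borel_gen[of S] S A by auto
  qed
  have "AE x in unit_lebesgue. h x * sine_basis 1 x = 0"
  proof (rule sine.annihilator_eq_0[OF Em Eb _ _ gen])
    show "X \<in> borel_measurable unit_lebesgue \<and> (\<exists>B. \<forall>x\<in>space unit_lebesgue. \<bar>X x\<bar> \<le> B)" if "X \<in> {?X}" for X
      using that Xmeas by (auto intro!: exI[of _ 1])
    show "(\<lambda>x. g x * of_real (X x)) \<in> annihilator unit_lebesgue ?E"
      if "X \<in> {?X}" "g \<in> annihilator unit_lebesgue ?E" for X g using that step by simp
    show "h \<in> annihilator unit_lebesgue ?E" using h z by (auto simp: annihilator_def)
  qed auto
  thus ?thesis using AE_space
  proof eventually_elim
    case (elim x)
    hence "sin (pi * x) > 0" by (intro sin_gt_zero) auto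
    thus ?case using elim(1) by (simp add: sine_basis_def)
  qed
qed

section \<open>Expansion of a square-integrable function in sines\<close>

context
  fixes \<phi> :: "real \<Rightarrow> complex"
  assumes \<phi>: "sq_integrable unit_lebesgue \<phi>"
begin

lemma transform_eq: "dirichlet_transform \<phi> n = (\<integral>x. \<phi> x * cnj (sine_basis n x) \<partial>unit_lebesgue)"
  by (simp add: dirichlet_transform_def L2_inner_def)

text \<open>Expands the nonnegative squared distance between \<phi> and its partial sum p; both the
  inner product of \<phi> with p and the squared norm of p equal the left-hand side.\<close>

lemma bessel: "(\<Sum>n=1..N. (cmod (dirichlet_transform \<phi> n))\<^sup>2) \<le> (\<integral>x. (cmod (\<phi> x))\<^sup>2 \<partial>unit_lebesgue)"
proof -
  let ?a = "dirichlet_transform \<phi>"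
  let ?p = "sine.psum ?a N"
  have int: "integrable unit_lebesgue (\<lambda>x. \<phi> x * cnj (sine_basis n x))" if "n \<ge> 1" for n
    by (rule sq_integrable_prod(1)[OF \<phi> sq_integrable_cnj[OF sine.u_sq[OF that]]])
  have "(\<integral>x. \<phi> x * cnj (?p x) \<partial>unit_lebesgue) = (\<integral>x. (\<Sum>n=1..N. cnj (?a n) * (\<phi> x * cnj (sine_basis n x))) \<partial>unit_lebesgue)"
    by (simp add: sine.psum_def sum_distrib_left mult_ac)
  also have "\<dots> = (\<Sum>n=1..N. \<integral>x. cnj (?a n) * (\<phi> x * cnj (sine_basis n x)) \<partial>unit_lebesgue)"
    by (intro Bochner_Integration.integral_sum integrable_mult_right int) auto
  also have "\<dots> = (\<Sum>n=1..N. of_real ((cmod (?a n))\<^sup>2))"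
    by (intro sum.cong refl) (simp add: transform_eq[symmetric] complex_norm_square mult.commute del: of_real_power)
  finally have ip: "(\<integral>x. \<phi> x * cnj (?p x) \<partial>unit_lebesgue) = of_real (\<Sum>n=1..N. (cmod (?a n))\<^sup>2)" by simp
  have pp: "(\<integral>x. (cmod (?p x))\<^sup>2 \<partial>unit_lebesgue) = (\<Sum>n=1..N. (cmod (?a n))\<^sup>2)"
    unfolding sine.psum_def by (rule sine.integral_norm_sum_sq) auto
  have i1: "integrable unit_lebesgue (\<lambda>x. (cmod (\<phi> x))\<^sup>2)" using \<phi> by (simp add: sq_integrable_def)
  have i2: "integrable unit_lebesgue (\<lambda>x. (cmod (?p x))\<^sup>2)" using sine.psum_sq[of ?a N] by (simp add: sq_integrable_def)
  have i3: "integrable unit_lebesgue (\<lambda>x. \<phi> x * cnj (?p x))"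
    by (rule sq_integrable_prod(1)[OF \<phi> sq_integrable_cnj[OF sine.psum_sq]])
  have expand: "(cmod (z - w))\<^sup>2 = (cmod z)\<^sup>2 + (cmod w)\<^sup>2 - 2 * Re (z * cnj w)" for z w
    unfolding cmod_power2 by (simp add: power2_eq_square algebra_simps)
  have "0 \<le> (\<integral>x. (cmod (\<phi> x - ?p x))\<^sup>2 \<partial>unit_lebesgue)" by simp
  also have "\<dots> = (\<integral>x. (cmod (\<phi> x))\<^sup>2 \<partial>unit_lebesgue) + (\<integral>x. (cmod (?p x))\<^sup>2 \<partial>unit_lebesgue)
      - 2 * Re (\<integral>x. \<phi> x * cnj (?p x) \<partial>unit_lebesgue)"
    unfolding expand
      Bochner_Integration.integral_diff[OF Bochner_Integration.integrable_add[OF i1 i2] integrable_mult_right[OF integrable_Re[OF i3], of 2]]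
      Bochner_Integration.integral_add[OF i1 i2] integral_mult_right_zero integral_Re[OF i3] ..
  finally show ?thesis unfolding ip pp by simp
qed

lemma transform_summable: "summable (\<lambda>n. (cmod (dirichlet_transform \<phi> n))\<^sup>2)"
proof (subst summable_Suc_iff[symmetric], rule summableI_nonneg_bounded)
  fix N
  have "(\<Sum>n<N. (cmod (dirichlet_transform \<phi> (Suc n)))\<^sup>2) = (\<Sum>n=1..N. (cmod (dirichlet_transform \<phi> n))\<^sup>2)"
    by (rule sum.reindex_bij_witness[of _ "\<lambda>n. n - 1" Suc]) auto
  thus "(\<Sum>n<N. (cmod (dirichlet_transform \<phi> (Suc n)))\<^sup>2) \<le> (\<integral>x. (cmod (\<phi> x))\<^sup>2 \<partial>unit_lebesgue)"
    using bessel by simp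
qed auto

text \<open>Riesz-Fischer provides some L^2 sum f of the series; f has the same sine coefficients as
  \<phi>, and uniqueness identifies the two almost everywhere.\<close>

lemma sine_expansion:
  "(\<lambda>N. \<integral>x. (cmod (\<phi> x - sine.psum (dirichlet_transform \<phi>) N x))\<^sup>2 \<partial>unit_lebesgue) \<longlonglongrightarrow> 0"
proof -
  let ?a = "dirichlet_transform \<phi>"
  obtain r f where rf: "strict_mono r" "sq_integrable unit_lebesgue f"
    "AE x in unit_lebesgue. (\<lambda>k. sine.psum ?a (r k) x) \<longlonglongrightarrow> f x"
    "\<And>N. (\<integral>x. (cmod (f x - sine.psum ?a N x))\<^sup>2 \<partial>unit_lebesgue) \<le> sine.l2tail ?a N"
    "\<And>k. sine.l2tail ?a (r k) \<le> (1/4) ^ k"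
    by (rule sine.riesz_fischer[OF transform_summable]) (rule that; assumption)
  have fl: "(\<lambda>N. \<integral>x. (cmod (f x - sine.psum ?a N x))\<^sup>2 \<partial>unit_lebesgue) \<longlonglongrightarrow> 0"
    by (rule tendsto_sandwich[OF _ _ tendsto_const sine.l2tail_lim[OF transform_summable]])
       (auto simp: rf(4))
  have coeff: "(\<integral>x. f x * cnj (sine_basis n x) \<partial>unit_lebesgue) = ?a n" if n: "n \<ge> 1" for n
  proof -
    have "(\<lambda>N. \<integral>x. sine.psum ?a N x * cnj (sine_basis n x) \<partial>unit_lebesgue) \<longlonglongrightarrow> (\<integral>x. f x * cnj (sine_basis n x) \<partial>unit_lebesgue)"
      by (rule inner_tendsto[where gN = "\<lambda>_. sine_basis n"])
         (use fl sine.psum_sq rf(2) sine.u_sq[OF n] in auto)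
    moreover have "\<forall>\<^sub>F N in sequentially. (\<integral>x. sine.psum ?a N x * cnj (sine_basis n x) \<partial>unit_lebesgue) = ?a n"
      using eventually_ge_at_top[of n] by eventually_elim (rule sine.inner_psum_u[OF n])
    hence "(\<lambda>N. \<integral>x. sine.psum ?a N x * cnj (sine_basis n x) \<partial>unit_lebesgue) \<longlonglongrightarrow> ?a n"
      by (rule tendsto_eventually)
    ultimately show ?thesis by (rule LIMSEQ_unique)
  qed
  have d: "sq_integrable unit_lebesgue (\<lambda>x. f x - \<phi> x)" by (rule sq_integrable_diff[OF rf(2) \<phi>])
  have "AE x in unit_lebesgue. f x - \<phi> x = 0"
  proof (rule sine_uniqueness[OF sine.L1_le_L2(1)[OF d]])
    fix n :: nat assume n: "n \<ge> 1"
    have "(\<integral>x. (f x - \<phi> x) * sine_basis n x \<partial>unit_lebesgue) =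
        (\<integral>x. f x * cnj (sine_basis n x) - \<phi> x * cnj (sine_basis n x) \<partial>unit_lebesgue)"
      by (simp add: cnj_sine_basis left_diff_distrib)
    also have "\<dots> = (\<integral>x. f x * cnj (sine_basis n x) \<partial>unit_lebesgue) - (\<integral>x. \<phi> x * cnj (sine_basis n x) \<partial>unit_lebesgue)"
      by (intro Bochner_Integration.integral_diff sq_integrable_prod(1) rf \<phi> sq_integrable_cnj sine.u_sq n)
    also have "\<dots> = 0" by (simp add: coeff[OF n] transform_eq)
    finally show "(\<integral>x. (f x - \<phi> x) * sine_basis n x \<partial>unit_lebesgue) = 0" .
  qed
  hence ae: "AE x in unit_lebesgue. f x = \<phi> x" by eventually_elim simp
  have "(\<integral>x. (cmod (\<phi> x - sine.psum ?a N x))\<^sup>2 \<partial>unit_lebesgue) = (\<integral>x. (cmod (f x - sine.psum ?a N x))\<^sup>2 \<partial>unit_lebesgue)" for N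
    by (rule integral_cong_AE) (use ae \<phi> rf(2) in \<open>auto simp: sq_integrable_def\<close>)
  with fl show ?thesis by simp
qed

end

text \<open>The distance to the nearest even integer. The modulus of an odd 2-periodic extension at
  y is the modulus of the original function at this point, away from integers.\<close>

definition fold_unit :: "real \<Rightarrow> real" where
  "fold_unit y = \<bar>y - 2 * of_int \<lfloor>(y + 1) / 2\<rfloor>\<bar>"

lemma fold_unit_measurable [measurable]: "fold_unit \<in> borel_measurable borel"
  unfolding fold_unit_def [abs_def] by measurable

lemma fold_unit_even: "real (2 * j) < y \<Longrightarrow> y < real (2 * j) + 1 \<Longrightarrow> fold_unit y = y - real (2 * j)"
proof -
  assume y: "real (2 * j) < y" "y < real (2 * j) + 1"
  have "\<lfloor>(y + 1) / 2\<rfloor> = int j" using y by (intro floor_unique) auto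
  thus ?thesis using y by (simp add: fold_unit_def)
qed

lemma fold_unit_odd: "real (2 * j + 1) < y \<Longrightarrow> y < real (2 * j + 1) + 1 \<Longrightarrow> fold_unit y = real (2 * j + 2) - y"
proof -
  assume y: "real (2 * j + 1) < y" "y < real (2 * j + 1) + 1"
  have "\<lfloor>(y + 1) / 2\<rfloor> = int j + 1" using y by (intro floor_unique) auto
  thus ?thesis using y by (simp add: fold_unit_def)
qed

text \<open>On the open interval from k to k + 1 the folding map is a translation onto (0,1) for
  even k and a reflection onto it for odd k.\<close>

lemma nn_integral_fold_piece:
  fixes w :: "real \<Rightarrow> ennreal"
  assumes [measurable]: "w \<in> borel_measurable borel"
  shows "(\<integral>\<^sup>+y. w (fold_unit y) * indicator {real k<..<real k + 1} y \<partial>lborel) = (\<integral>\<^sup>+y. w y * indicator {0<..<1} y \<partial>lborel)"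
proof (cases "even k")
  case True
  then obtain j where k: "k = 2 * j" by (auto elim: evenE)
  have "(\<integral>\<^sup>+y. w (fold_unit y) * indicator {real k<..<real k + 1} y \<partial>lborel) =
      (\<integral>\<^sup>+y. w (fold_unit (real k + 1 * y)) * indicator {real k<..<real k + 1} (real k + 1 * y) \<partial>lborel)"
    by (subst nn_integral_real_affine[where c = 1 and t = "real k"]) auto
  also have "\<dots> = (\<integral>\<^sup>+y. w y * indicator {0<..<1} y \<partial>lborel)"
    by (intro nn_integral_cong) (auto simp: indicator_def fold_unit_even[of j] k)
  finally show ?thesis .
next
  case False
  then obtain j where k: "k = 2 * j + 1" by (auto elim: oddE)
  have "(\<integral>\<^sup>+y. w (fold_unit y) * indicator {real k<..<real k + 1} y \<partial>lborel) =
      (\<integral>\<^sup>+y. w (fold_unit (real k + 1 + (-1) * y)) * indicator {real k<..<real k + 1} (real k + 1 + (-1) * y) \<partial>lborel)"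
    by (subst nn_integral_real_affine[where c = "-1" and t = "real k + 1"]) auto
  also have "\<dots> = (\<integral>\<^sup>+y. w y * indicator {0<..<1} y \<partial>lborel)"
    by (intro nn_integral_cong) (auto simp: indicator_def fold_unit_odd[of j] k)
  finally show ?thesis .
qed

text \<open>After rescaling, (0, n) consists of n unit pieces with equal integrals, so
  \<open>x \<mapsto> fold_unit (n * x)\<close> preserves Lebesgue measure on (0,1).\<close>

lemma nn_integral_fold:
  fixes w :: "real \<Rightarrow> ennreal"
  assumes [measurable]: "w \<in> borel_measurable borel" and n: "n \<ge> 1"
  shows "(\<integral>\<^sup>+x. w (fold_unit (real n * x)) \<partial>unit_lebesgue) = (\<integral>\<^sup>+x. w x \<partial>unit_lebesgue)"
proof -
  let ?I = "\<integral>\<^sup>+y. w y * indicator {0<..<1} y \<partial>lborel"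
  have J: "(\<integral>\<^sup>+y. w (fold_unit y) * indicator {0<..<real k} y \<partial>lborel) = of_nat k * ?I" for k
  proof (induction k)
    case 0 thus ?case by simp
  next
    case (Suc k)
    have "(\<integral>\<^sup>+y. w (fold_unit y) * indicator {0<..<real (Suc k)} y \<partial>lborel) =
        (\<integral>\<^sup>+y. w (fold_unit y) * indicator {0<..<real k} y + w (fold_unit y) * indicator {real k<..<real k + 1} y \<partial>lborel)"
    proof (rule nn_integral_cong_AE)
      show "AE y in lborel. w (fold_unit y) * indicator {0<..<real (Suc k)} y =
          w (fold_unit y) * indicator {0<..<real k} y + w (fold_unit y) * indicator {real k<..<real k + 1} y"
        using AE_lborel_singleton[of "real k"] by eventually_elim (auto simp: indicator_def)
    qed
    also have "\<dots> = (\<integral>\<^sup>+y. w (fold_unit y) * indicator {0<..<real k} y \<partial>lborel) +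
        (\<integral>\<^sup>+y. w (fold_unit y) * indicator {real k<..<real k + 1} y \<partial>lborel)"
      by (rule nn_integral_add) measurable
    also have "\<dots> = of_nat (Suc k) * ?I"
      unfolding Suc nn_integral_fold_piece[OF assms(1)] by (simp add: distrib_right add.commute)
    finally show ?case .
  qed
  have "of_nat n * ?I = (\<integral>\<^sup>+y. w (fold_unit y) * indicator {0<..<real n} y \<partial>lborel)" by (rule J[symmetric])
  also have "\<dots> = ennreal \<bar>real n\<bar> * (\<integral>\<^sup>+x. w (fold_unit (0 + real n * x)) * indicator {0<..<real n} (0 + real n * x) \<partial>lborel)"
    using n by (intro nn_integral_real_affine) auto
  also have "(\<integral>\<^sup>+x. w (fold_unit (0 + real n * x)) * indicator {0<..<real n} (0 + real n * x) \<partial>lborel) =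
      (\<integral>\<^sup>+x. w (fold_unit (real n * x)) * indicator {0<..<1} x \<partial>lborel)"
    using n by (intro nn_integral_cong) (auto simp: indicator_def zero_less_mult_iff)
  finally have "of_nat n * ?I = of_nat n * (\<integral>\<^sup>+x. w (fold_unit (real n * x)) * indicator {0<..<1} x \<partial>lborel)"
    by (simp add: ennreal_of_nat_eq_real_of_nat)
  hence "?I = (\<integral>\<^sup>+x. w (fold_unit (real n * x)) * indicator {0<..<1} x \<partial>lborel)"
    using n by (simp add: ennreal_mult_cancel_left)
  thus ?thesis by (simp add: nn_integral_unit_lebesgue)
qed

lemma odd_periodic_fold:
  assumes "0 < fold_unit y" "fold_unit y < 1"
  shows "odd_periodic f y = of_real (sgn (y - 2 * of_int \<lfloor>(y + 1) / 2\<rfloor>)) * f (fold_unit y)"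
  using assms by (auto simp: odd_periodic_def fold_unit_def Let_def abs_if sgn_if split: if_splits)

lemma AE_fold_unit:
  assumes P: "AE x in unit_lebesgue. P x" and n: "n \<ge> 1"
  shows "AE x in unit_lebesgue. 0 < fold_unit (real n * x) \<and> fold_unit (real n * x) < 1 \<and> P (fold_unit (real n * x))"
proof -
  have "AE x in lborel. 0 < x \<and> x < 1 \<longrightarrow> P x" using P by (simp add: AE_unit_lebesgue)
  then obtain N where N: "N \<in> null_sets lborel" "{x \<in> space lborel. \<not> (0 < x \<and> x < 1 \<longrightarrow> P x)} \<subseteq> N"
    by (auto simp: eventually_ae_filter)
  \<comment> \<open>Adjoining the complement of (0,1) also excludes the points that fold to 0 or 1,
    where the odd extension is not given by f.\<close>
  define N' where "N' = N \<union> {..0} \<union> {1..}"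
  have [measurable]: "N' \<in> sets borel" using N(1) by (auto simp: N'_def null_sets_def)
  have "(\<integral>\<^sup>+x. indicator N' (fold_unit (real n * x)) \<partial>unit_lebesgue) = (\<integral>\<^sup>+x. indicator N' x \<partial>unit_lebesgue)"
    by (rule nn_integral_fold[OF _ n]) measurable
  also have "\<dots> = (\<integral>\<^sup>+x. 0 \<partial>unit_lebesgue)"
  proof (rule nn_integral_cong_AE)
    have "AE x in lborel. x \<notin> N" by (rule AE_not_in[OF N(1)])
    thus "AE x in unit_lebesgue. (indicator N' x :: ennreal) = 0"
      unfolding AE_unit_lebesgue by eventually_elim (auto simp: N'_def indicator_def)
  qed
  finally have z: "(\<integral>\<^sup>+x. indicator N' (fold_unit (real n * x)) \<partial>unit_lebesgue) = 0" by simp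
  have m: "(\<lambda>x. indicator N' (fold_unit (real n * x)) :: ennreal) \<in> borel_measurable unit_lebesgue"
    by (rule measurable_unit_lebesgue) measurable
  have "AE x in unit_lebesgue. (indicator N' (fold_unit (real n * x)) :: ennreal) = 0"
    using z nn_integral_0_iff_AE[OF m] by simp
  thus ?thesis
  proof eventually_elim
    case (elim x)
    hence "fold_unit (real n * x) \<notin> N'" by (simp add: indicator_def split: if_splits)
    hence "fold_unit (real n * x) \<notin> N" "0 < fold_unit (real n * x)" "fold_unit (real n * x) < 1"
      by (auto simp: N'_def not_le)
    moreover from this N(2) have "P (fold_unit (real n * x))" by force
    ultimately show ?case by blast
  qed
qed

text \<open>Composing a Lebesgue measurable function with a Borel map need not give a measurable
  function, so dilations are treated through a Borel representative.\<close>

lemma borel_version: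
  fixes f :: "real \<Rightarrow> complex"
  assumes "f \<in> borel_measurable unit_lebesgue"
  obtains g where "g \<in> borel_measurable borel" "AE x in unit_lebesgue. f x = g x"
proof -
  let ?f = "\<lambda>x. indicator {0<..<1} x *\<^sub>R f x"
  have m: "?f \<in> borel_measurable lebesgue"
    using assms by (subst (asm) borel_measurable_restrict_space_iff) auto
  obtain u where u: "u \<in> borel_measurable lborel" "AE x in lborel. Re (?f x) = u x"
  proof -
    have "(\<lambda>x. Re (?f x)) \<in> borel_measurable lebesgue"
      by (rule measurable_compose[OF m]) simp
    from completion_ex_borel_measurable_real[OF this] show ?thesis using that by blast
  qed
  obtain v where v: "v \<in> borel_measurable lborel" "AE x in lborel. Im (?f x) = v x"
  proof -
    have "(\<lambda>x. Im (?f x)) \<in> borel_measurable lebesgue"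
      by (rule measurable_compose[OF m]) simp
    from completion_ex_borel_measurable_real[OF this] show ?thesis using that by blast
  qed
  show ?thesis
  proof (rule that[of "\<lambda>x. Complex (u x) (v x)"])
    show "(\<lambda>x. Complex (u x) (v x)) \<in> borel_measurable borel"
      using u(1) v(1) by (simp add: borel_measurable_complex_iff)
    show "AE x in unit_lebesgue. f x = Complex (u x) (v x)"
      unfolding AE_unit_lebesgue using u(2) v(2) by eventually_elim (auto simp: complex_eq_iff)
  qed
qed

text \<open>Completeness of Lebesgue measure: corresponding preimages differ only by a null
  set.\<close>

lemma measurable_unit_AE_cong:
  fixes f g :: "real \<Rightarrow> complex"
  assumes g: "g \<in> borel_measurable borel" and ae: "AE x in unit_lebesgue. f x = g x"
  shows "f \<in> borel_measurable unit_lebesgue"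
proof -
  let ?f = "\<lambda>x. indicator {0<..<1} x *\<^sub>R f x" and ?g = "\<lambda>x. indicator {0<..<1} x *\<^sub>R g x"
  have gm: "?g \<in> borel_measurable lebesgue"
    using g by (intro measurable_completion borel_measurable_scaleR) auto
  have "AE x in lebesgue. ?f x = ?g x"
    using ae by (auto simp: AE_restrict_space_iff indicator_def elim!: eventually_mono)
  have "?f \<in> borel_measurable lebesgue"
  proof (rule measurableI)
    fix A :: "complex set" assume A: "A \<in> sets borel"
    show "?f -` A \<inter> space lebesgue \<in> sets lebesgue"
    proof (rule completion.in_sets_AE)
      show "AE x in lebesgue. (x \<in> ?g -` A \<inter> space lebesgue) = (x \<in> ?f -` A \<inter> space lebesgue)"
        using \<open>AE x in lebesgue. ?f x = ?g x\<close> by eventually_elim auto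
      show "?g -` A \<inter> space lebesgue \<in> sets lebesgue" by (rule measurable_sets[OF gm A])
    qed auto
  qed auto
  thus ?thesis by (subst borel_measurable_restrict_space_iff) auto
qed

lemma odd_periodic_measurable:
  assumes [measurable]: "f \<in> borel_measurable borel"
  shows "odd_periodic f \<in> borel_measurable borel"
  unfolding odd_periodic_def [abs_def] Let_def by measurable

text \<open>Up to a factor of modulus 1 the dilation is f composed with the measure-preserving
  folding map.\<close>

lemma dilation_isometry:
  assumes f: "sq_integrable unit_lebesgue f" and n: "n \<ge> 1"
  shows "sq_integrable unit_lebesgue (\<lambda>x. odd_periodic f (real n * x))"
    and "(\<integral>x. (cmod (odd_periodic f (real n * x)))\<^sup>2 \<partial>unit_lebesgue) = (\<integral>x. (cmod (f x))\<^sup>2 \<partial>unit_lebesgue)"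
proof -
  obtain g where g [measurable]: "g \<in> borel_measurable borel" and fg: "AE x in unit_lebesgue. f x = g x"
    by (rule borel_version[of f]) (use f in \<open>auto simp: sq_integrable_def\<close>)
  have ae: "AE x in unit_lebesgue. odd_periodic f (real n * x) = odd_periodic g (real n * x) \<and>
      (cmod (odd_periodic f (real n * x)))\<^sup>2 = (cmod (g (fold_unit (real n * x))))\<^sup>2"
    using AE_fold_unit[OF fg n]
  proof eventually_elim
    case (elim x)
    hence r: "0 < fold_unit (real n * x)" "fold_unit (real n * x) < 1" by auto
    have "\<bar>sgn z\<bar> = 1" if "\<bar>z\<bar> > 0" for z :: real using that by (simp add: sgn_if)
    hence "\<bar>sgn (real n * x - 2 * of_int \<lfloor>(real n * x + 1) / 2\<rfloor>)\<bar> = 1"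
      using r(1) unfolding fold_unit_def by blast
    thus ?case using elim by (simp add: odd_periodic_fold[OF r] norm_mult)
  qed
  have om: "(\<lambda>x. odd_periodic g (real n * x)) \<in> borel_measurable borel"
    using measurable_compose[OF _ odd_periodic_measurable[OF g], of "\<lambda>x. real n * x"] by simp
  have fm: "(\<lambda>x. odd_periodic f (real n * x)) \<in> borel_measurable unit_lebesgue"
    by (rule measurable_unit_AE_cong[OF om]) (use ae in \<open>auto elim: eventually_mono\<close>)
  have "(\<integral>\<^sup>+x. ennreal ((cmod (odd_periodic f (real n * x)))\<^sup>2) \<partial>unit_lebesgue) =
      (\<integral>\<^sup>+x. ennreal ((cmod (g (fold_unit (real n * x))))\<^sup>2) \<partial>unit_lebesgue)"
    by (rule nn_integral_cong_AE) (use ae in \<open>auto elim: eventually_mono\<close>)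
  also have "\<dots> = (\<integral>\<^sup>+x. ennreal ((cmod (g x))\<^sup>2) \<partial>unit_lebesgue)"
    by (rule nn_integral_fold[OF _ n, of "\<lambda>x. ennreal ((cmod (g x))\<^sup>2)"]) measurable
  also have "\<dots> = (\<integral>\<^sup>+x. ennreal ((cmod (f x))\<^sup>2) \<partial>unit_lebesgue)"
    by (rule nn_integral_cong_AE) (use fg in \<open>auto elim: eventually_mono\<close>)
  finally have eq: "(\<integral>\<^sup>+x. ennreal ((cmod (odd_periodic f (real n * x)))\<^sup>2) \<partial>unit_lebesgue) =
      (\<integral>\<^sup>+x. ennreal ((cmod (f x))\<^sup>2) \<partial>unit_lebesgue)" .
  have "(\<integral>\<^sup>+x. ennreal ((cmod (f x))\<^sup>2) \<partial>unit_lebesgue) < \<infinity>"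
    using f by (simp add: sq_integrable_def nn_integral_eq_integral)
  hence "integrable unit_lebesgue (\<lambda>x. (cmod (odd_periodic f (real n * x)))\<^sup>2)"
    using fm by (intro integrableI_bounded) (auto simp: eq)
  thus "sq_integrable unit_lebesgue (\<lambda>x. odd_periodic f (real n * x))"
    using fm by (simp add: sq_integrable_def)
  show "(\<integral>x. (cmod (odd_periodic f (real n * x)))\<^sup>2 \<partial>unit_lebesgue) = (\<integral>x. (cmod (f x))\<^sup>2 \<partial>unit_lebesgue)"
  proof -
    have e: "(\<integral>x. (cmod (k x))\<^sup>2 \<partial>unit_lebesgue) = enn2real (\<integral>\<^sup>+x. ennreal ((cmod (k x))\<^sup>2) \<partial>unit_lebesgue)"
      if "k \<in> borel_measurable unit_lebesgue" for k :: "real \<Rightarrow> complex"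
      using that by (intro integral_eq_nn_integral) auto
    show ?thesis using e[OF fm] e[of f] f eq by (simp add: sq_integrable_def)
  qed
qed

section \<open>Inner products of dilations and of twisted sums\<close>

lemma odd_periodic_diff: "odd_periodic (\<lambda>x. f x - g x) y = odd_periodic f y - odd_periodic g y"
  by (simp add: odd_periodic_def Let_def)

lemma odd_periodic_cong_odd:
  assumes odd: "\<And>x. s (- x) = - s x" and per: "\<And>x k. s (x - 2 * of_int k) = s x"
  shows "odd_periodic s y = (s y :: complex)"
proof -
  define z where "z = y - 2 * of_int \<lfloor>(y + 1) / 2\<rfloor>"
  have sz: "s z = s y" by (simp add: z_def per)
  have "of_int \<lfloor>(y + 1) / 2\<rfloor> \<le> (y + 1) / 2" by linarith
  hence "z \<ge> -1" by (simp add: z_def)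
  then consider "z > 0" | "-1 < z" "z < 0" | "z = 0" | "z = -1" by linarith
  thus ?thesis
  proof cases
    case 3
    have "s 0 = 0" using odd[of 0] by simp
    thus ?thesis using 3 sz by (simp add: odd_periodic_def Let_def z_def[symmetric])
  next
    case 4
    have "s (-1) = s 1" using per[of 1 1] by simp
    hence "s (-1) = 0" using odd[of 1] by simp
    thus ?thesis using 4 sz by (simp add: odd_periodic_def Let_def z_def[symmetric])
  qed (use sz odd in \<open>auto simp: odd_periodic_def Let_def z_def[symmetric]\<close>)
qed

text \<open>A sine polynomial is its own odd periodic extension, and dilating by m multiplies every
  frequency by m.\<close>

lemma odd_periodic_psum: "odd_periodic (sine.psum a N) (real m * x) = (\<Sum>n=1..N. a n * sine_basis (m * n) x)"
proof -
  have "sine_basis n (y - 2 * of_int k) = sine_basis n y" for n y k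
  proof -
    have "sin (pi * real n * (y - 2 * of_int k)) = sin (pi * real n * y - 2 * pi * of_int (int n * k))"
      by (simp add: algebra_simps)
    also have "\<dots> = sin (pi * real n * y)"
      unfolding sin_diff using sin_integer_2pi[OF Ints_of_int, of "int n * k"] cos_integer_2pi[OF Ints_of_int, of "int n * k"]
      by simp
    finally show ?thesis by (simp add: sine_basis_def)
  qed
  hence "odd_periodic (sine.psum a N) (real m * x) = sine.psum a N (real m * x)"
    by (intro odd_periodic_cong_odd) (auto simp: sine.psum_def sine_basis_def sum_negf)
  also have "\<dots> = (\<Sum>n=1..N. a n * sine_basis (m * n) x)"
    by (simp add: sine.psum_def sine_basis_def mult_ac)
  finally show ?thesis .
qed

text \<open>Truncating both indices at the same N gives one finite expression for the dilated sines
  and for the characters. Comparing the two limits along N spares any discussion of the double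
  series itself.\<close>

definition gram :: "(nat \<Rightarrow> complex) \<Rightarrow> nat \<Rightarrow> nat \<Rightarrow> nat \<Rightarrow> complex" where
  "gram a N m n = (\<Sum>j=1..N. \<Sum>k=1..N. if m * j = n * k then a j * cnj (a k) else 0)"

lemma (in bounded_orthonormal) inner_dilated:
  assumes "m \<ge> 1" "n \<ge> 1"
  shows "(\<integral>x. (\<Sum>j=1..N. a j * u (m * j) x) * cnj (\<Sum>k=1..N. a k * u (n * k) x) \<partial>M) = gram a N m n"
proof -
  have i: "integrable M (\<lambda>x. (a j * cnj (a k)) * (u (m * j) x * cnj (u (n * k) x)))" if "j \<ge> 1" "k \<ge> 1" for j k
    using that assms by (intro integrable_mult_right sq_integrable_prod(1) sq_integrable_cnj u_sq) auto
  have "(\<integral>x. (\<Sum>j=1..N. a j * u (m * j) x) * cnj (\<Sum>k=1..N. a k * u (n * k) x) \<partial>M) =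
      (\<integral>x. (\<Sum>j=1..N. \<Sum>k=1..N. (a j * cnj (a k)) * (u (m * j) x * cnj (u (n * k) x))) \<partial>M)"
    by (intro Bochner_Integration.integral_cong refl) (simp add: sum_product mult_ac)
  also have "\<dots> = (\<Sum>j=1..N. \<Sum>k=1..N. \<integral>x. (a j * cnj (a k)) * (u (m * j) x * cnj (u (n * k) x)) \<partial>M)"
  proof -
    have "(\<integral>x. (\<Sum>j=1..N. \<Sum>k=1..N. (a j * cnj (a k)) * (u (m * j) x * cnj (u (n * k) x))) \<partial>M) =
        (\<Sum>j=1..N. \<integral>x. (\<Sum>k=1..N. (a j * cnj (a k)) * (u (m * j) x * cnj (u (n * k) x))) \<partial>M)"
      by (intro Bochner_Integration.integral_sum Bochner_Integration.integrable_sum i) auto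
    also have "\<dots> = (\<Sum>j=1..N. \<Sum>k=1..N. \<integral>x. (a j * cnj (a k)) * (u (m * j) x * cnj (u (n * k) x)) \<partial>M)"
      by (intro sum.cong refl Bochner_Integration.integral_sum i) auto
    finally show ?thesis .
  qed
  also have "\<dots> = gram a N m n"
    unfolding gram_def
  proof (intro sum.cong refl)
    fix j k assume "j \<in> {1..N}" "k \<in> {1..N}"
    hence "m * j \<ge> 1" "n * k \<ge> 1" using assms by (auto simp: Suc_le_eq)
    thus "(\<integral>x. (a j * cnj (a k)) * (u (m * j) x * cnj (u (n * k) x)) \<partial>M) = (if m * j = n * k then a j * cnj (a k) else 0)"
      unfolding integral_mult_right_zero by (simp add: u_orth)
  qed
  finally show ?thesis .
qed

text \<open>Forming the extension is linear and dilation preserves the norm, so the sine expansion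
  of \<phi> remains an L^2 expansion after dilation, and inner products pass to the limit.\<close>

lemma dilation_inner:
  assumes \<phi>: "sq_integrable unit_lebesgue \<phi>" and mn: "m \<ge> 1" "n \<ge> 1"
  shows "(\<lambda>N. gram (dirichlet_transform \<phi>) N m n) \<longlonglongrightarrow>
     L2_inner (\<lambda>x. odd_periodic \<phi> (real m * x)) (\<lambda>x. odd_periodic \<phi> (real n * x))"
proof -
  let ?a = "dirichlet_transform \<phi>"
  let ?s = "\<lambda>m N x. odd_periodic (sine.psum ?a N) (real m * x)"
  have conv: "(\<lambda>N. \<integral>x. (cmod (odd_periodic \<phi> (real m * x) - ?s m N x))\<^sup>2 \<partial>unit_lebesgue) \<longlonglongrightarrow> 0" if "m \<ge> 1" for m
    using sine_expansion[OF \<phi>]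
      dilation_isometry(2)[OF sq_integrable_diff[OF \<phi> sine.psum_sq[of ?a]] that]
    by (simp add: odd_periodic_diff)
  have "(\<lambda>N. \<integral>x. ?s m N x * cnj (?s n N x) \<partial>unit_lebesgue) \<longlonglongrightarrow>
      (\<integral>x. odd_periodic \<phi> (real m * x) * cnj (odd_periodic \<phi> (real n * x)) \<partial>unit_lebesgue)"
    by (rule inner_tendsto) (use conv mn \<phi> dilation_isometry(1) sine.psum_sq in auto)
  thus ?thesis
    unfolding odd_periodic_psum sine.inner_dilated[OF mn] L2_inner_def .
qed

lemma character_inner:
  assumes F: "sq_integrable character_haar F"
    and l: "(\<lambda>N. \<integral>\<gamma>. (cmod (F \<gamma> - characters.psum a N \<gamma>))\<^sup>2 \<partial>character_haar) \<longlonglongrightarrow> 0"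
    and mn: "m \<ge> 1" "n \<ge> 1"
  shows "(\<lambda>N. gram a N m n) \<longlonglongrightarrow> (\<integral>\<gamma>. of_real ((cmod (F \<gamma>))\<^sup>2) * (\<gamma> m * cnj (\<gamma> n)) \<partial>character_haar)"
proof -
  have mult_sq: "sq_integrable character_haar (\<lambda>\<gamma>. \<gamma> m * f \<gamma>)"
    if "sq_integrable character_haar f" "m \<ge> 1" for f m
  proof -
    have "integrable character_haar (\<lambda>\<gamma>. (cmod (\<gamma> m * f \<gamma>))\<^sup>2) \<longleftrightarrow> integrable character_haar (\<lambda>\<gamma>. (cmod (f \<gamma>))\<^sup>2)"
      by (intro Bochner_Integration.integrable_cong refl) (use that(2) in \<open>simp add: norm_mult norm_character\<close>)
    thus ?thesis using that by (auto simp: sq_integrable_def)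
  qed
  have conv: "(\<lambda>N. \<integral>\<gamma>. (cmod (\<gamma> m * F \<gamma> - \<gamma> m * characters.psum a N \<gamma>))\<^sup>2 \<partial>character_haar) \<longlonglongrightarrow> 0" if "m \<ge> 1" for m
  proof -
    have "(\<integral>\<gamma>. (cmod (\<gamma> m * F \<gamma> - \<gamma> m * characters.psum a N \<gamma>))\<^sup>2 \<partial>character_haar) =
        (\<integral>\<gamma>. (cmod (F \<gamma> - characters.psum a N \<gamma>))\<^sup>2 \<partial>character_haar)" for N
      by (intro Bochner_Integration.integral_cong refl)
         (use that in \<open>simp add: norm_mult norm_character flip: right_diff_distrib\<close>)
    thus ?thesis using l by simp
  qed
  have "(\<lambda>N. \<integral>\<gamma>. (\<gamma> m * characters.psum a N \<gamma>) * cnj (\<gamma> n * characters.psum a N \<gamma>) \<partial>character_haar) \<longlonglongrightarrow>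
      (\<integral>\<gamma>. (\<gamma> m * F \<gamma>) * cnj (\<gamma> n * F \<gamma>) \<partial>character_haar)"
    by (rule inner_tendsto) (use conv mn F mult_sq characters.psum_sq in auto)
  also have "(\<lambda>N. \<integral>\<gamma>. (\<gamma> m * characters.psum a N \<gamma>) * cnj (\<gamma> n * characters.psum a N \<gamma>) \<partial>character_haar) = (\<lambda>N. gram a N m n)"
  proof
    fix N
    have "\<gamma> m * characters.psum a N \<gamma> = (\<Sum>j=1..N. a j * \<gamma> (m * j))" if "\<gamma> \<in> characters" for \<gamma> m
      by (simp add: characters.psum_def sum_distrib_left character_mult[OF that] mult_ac)
    hence "(\<integral>\<gamma>. (\<gamma> m * characters.psum a N \<gamma>) * cnj (\<gamma> n * characters.psum a N \<gamma>) \<partial>character_haar) =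
        (\<integral>\<gamma>. (\<Sum>j=1..N. a j * \<gamma> (m * j)) * cnj (\<Sum>k=1..N. a k * \<gamma> (n * k)) \<partial>character_haar)"
      by (intro Bochner_Integration.integral_cong refl) simp
    thus "(\<integral>\<gamma>. (\<gamma> m * characters.psum a N \<gamma>) * cnj (\<gamma> n * characters.psum a N \<gamma>) \<partial>character_haar) = gram a N m n"
      by (simp only: characters.inner_dilated[OF mn])
  qed
  also have "(\<integral>\<gamma>. (\<gamma> m * F \<gamma>) * cnj (\<gamma> n * F \<gamma>) \<partial>character_haar) =
      (\<integral>\<gamma>. of_real ((cmod (F \<gamma>))\<^sup>2) * (\<gamma> m * cnj (\<gamma> n)) \<partial>character_haar)"
    by (intro Bochner_Integration.integral_cong refl) (simp only: complex_norm_square complex_cnj_mult mult_ac)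
  finally show ?thesis .
qed

text \<open>Uniqueness of Fourier coefficients is applied to the integrable function |F|^2 - 1, the
  constant 1 having exactly the coefficients on the right.\<close>

lemma unimodular_iff:
  assumes F: "sq_integrable character_haar F"
  shows "(AE \<gamma> in character_haar. cmod (F \<gamma>) = 1) \<longleftrightarrow>
    (\<forall>m\<ge>1. \<forall>n\<ge>1. (\<integral>\<gamma>. of_real ((cmod (F \<gamma>))\<^sup>2) * (\<gamma> m * cnj (\<gamma> n)) \<partial>character_haar) = (if m = n then 1 else 0))"
proof
  assume ae: "AE \<gamma> in character_haar. cmod (F \<gamma>) = 1"
  have [measurable]: "F \<in> borel_measurable character_haar" using F by (simp add: sq_integrable_def)
  have "(\<integral>\<gamma>. of_real ((cmod (F \<gamma>))\<^sup>2) * (\<gamma> m * cnj (\<gamma> n)) \<partial>character_haar) = (\<integral>\<gamma>. \<gamma> m * cnj (\<gamma> n) \<partial>character_haar)" for m n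
    by (rule integral_cong_AE) (use ae in \<open>auto elim: eventually_mono\<close>)
  thus "\<forall>m\<ge>1. \<forall>n\<ge>1. (\<integral>\<gamma>. of_real ((cmod (F \<gamma>))\<^sup>2) * (\<gamma> m * cnj (\<gamma> n)) \<partial>character_haar) = (if m = n then 1 else 0)"
    by (simp add: integral_character_prod)
next
  assume *: "\<forall>m\<ge>1. \<forall>n\<ge>1. (\<integral>\<gamma>. of_real ((cmod (F \<gamma>))\<^sup>2) * (\<gamma> m * cnj (\<gamma> n)) \<partial>character_haar) = (if m = n then 1 else 0)"
  let ?h = "\<lambda>\<gamma>. complex_of_real ((cmod (F \<gamma>))\<^sup>2) - 1"
  have Fi: "integrable character_haar (\<lambda>\<gamma>. complex_of_real ((cmod (F \<gamma>))\<^sup>2))"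
    using F unfolding sq_integrable_def by (intro integrable_of_real) auto
  have "AE \<gamma> in character_haar. ?h \<gamma> = 0"
  proof (rule character_haar_uniqueness)
    show "integrable character_haar ?h" using Fi by (intro Bochner_Integration.integrable_diff) auto
    fix m n :: nat assume mn: "m \<ge> 1" "n \<ge> 1"
    have i1: "integrable character_haar (\<lambda>\<gamma>. complex_of_real ((cmod (F \<gamma>))\<^sup>2) * (\<gamma> m * cnj (\<gamma> n)))"
      by (rule characters.integrable_mult_bounded[OF Fi, where K = 1]) (use mn in \<open>auto simp: norm_mult norm_character\<close>)
    have i2: "integrable character_haar (\<lambda>\<gamma>. \<gamma> m * cnj (\<gamma> n))"
      by (rule characters.integrable_const_bound[of _ 1]) (use mn in \<open>auto simp: norm_mult norm_character\<close>)
    have "(\<integral>\<gamma>. ?h \<gamma> * (\<gamma> m * cnj (\<gamma> n)) \<partial>character_haar) =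
        (\<integral>\<gamma>. of_real ((cmod (F \<gamma>))\<^sup>2) * (\<gamma> m * cnj (\<gamma> n)) \<partial>character_haar) - (\<integral>\<gamma>. \<gamma> m * cnj (\<gamma> n) \<partial>character_haar)"
      unfolding left_diff_distrib mult_1_left by (rule Bochner_Integration.integral_diff[OF i1 i2])
    also have "\<dots> = 0" using * mn by (simp add: integral_character_prod)
    finally show "(\<integral>\<gamma>. ?h \<gamma> * (\<gamma> m * cnj (\<gamma> n)) \<partial>character_haar) = 0" .
  qed
  thus "AE \<gamma> in character_haar. cmod (F \<gamma>) = 1"
  proof eventually_elim
    case (elim \<gamma>)
    hence "(cmod (F \<gamma>))\<^sup>2 = 1" by (metis eq_iff_diff_eq_0 of_real_1 of_real_eq_iff)
    thus ?case by (simp add: power2_eq_1_iff) (smt (verit) norm_ge_zero)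
  qed
qed

theorem corollary4p5:
  fixes \<phi> :: "real \<Rightarrow> complex"
  assumes "\<phi> \<in> L2_unit"
  shows "orthonormal_sequence (\<lambda>n x. odd_periodic \<phi> (real n * x)) \<longleftrightarrow>
         dirichlet_transform \<phi> \<in> H_infinity \<and>
         (AE \<gamma> in character_haar. AE t in lborel.
            cmod (boundary_value (twist (dirichlet_transform \<phi>) \<gamma>) t) = 1)"
proof -
  let ?a = "dirichlet_transform \<phi>"
  have \<phi>: "sq_integrable unit_lebesgue \<phi>" using assms by (simp add: L2_unit_iff)
  note sm = transform_summable[OF \<phi>]
  obtain r F where rF: "strict_mono r" "sq_integrable character_haar F"
    "AE \<gamma> in character_haar. (\<lambda>k. characters.psum ?a (r k) \<gamma>) \<longlonglongrightarrow> F \<gamma>"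
    "\<And>N. (\<integral>\<gamma>. (cmod (F \<gamma> - characters.psum ?a N \<gamma>))\<^sup>2 \<partial>character_haar) \<le> characters.l2tail ?a N"
    "\<And>k. characters.l2tail ?a (r k) \<le> (1/4) ^ k"
    by (rule characters.riesz_fischer[OF sm]) (rule that; assumption)
  interpret torus_function ?a F r
    by unfold_locales (use rF order_trans in blast)+
  have Fl: "(\<lambda>N. \<integral>\<gamma>. (cmod (F \<gamma> - characters.psum ?a N \<gamma>))\<^sup>2 \<partial>character_haar) \<longlonglongrightarrow> 0"
    by (rule tendsto_sandwich[OF _ _ tendsto_const characters.l2tail_lim[OF sm]]) (auto simp: rF(4))
  have dil: "(\<lambda>x. odd_periodic \<phi> (real n * x)) \<in> L2_unit" if "n \<ge> 1" for n
    using dilation_isometry(1)[OF \<phi> that] by (simp add: L2_unit_iff)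
  have inner: "L2_inner (\<lambda>x. odd_periodic \<phi> (real m * x)) (\<lambda>x. odd_periodic \<phi> (real n * x)) =
      (\<integral>\<gamma>. of_real ((cmod (F \<gamma>))\<^sup>2) * (\<gamma> m * cnj (\<gamma> n)) \<partial>character_haar)" if "m \<ge> 1" "n \<ge> 1" for m n
    using dilation_inner[OF \<phi> that] character_inner[OF rF(2) Fl that] by (rule LIMSEQ_unique)
  have orth: "orthonormal_sequence (\<lambda>n x. odd_periodic \<phi> (real n * x)) \<longleftrightarrow> (AE \<gamma> in character_haar. cmod (F \<gamma>) = 1)"
    unfolding orthonormal_sequence_def unimodular_iff[OF rF(2)] using dil inner by auto
  have flow: "(AE \<gamma> in character_haar. AE t in lborel. cmod (F (flow t \<gamma>)) = 1) \<longleftrightarrow> (AE \<gamma> in character_haar. cmod (F \<gamma>) = 1)"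
  proof (rule AE_flow)
    have "{\<gamma> \<in> space character_haar. cmod (F \<gamma>) = 1} \<in> sets character_haar" by measurable
    thus "{\<gamma> \<in> characters. cmod (F \<gamma>) = 1} \<in> sets character_haar" by simp
  qed
  \<comment> \<open>Conditional on reading boundary values as F along orbits, which needs F
    essentially bounded. In one direction |F| = 1 supplies this, in the other
    \<open>H_infinity_imp_bounded\<close>.\<close>
  have boundary: "(AE \<gamma> in character_haar. AE t in lborel. cmod (boundary_value (twist ?a \<gamma>) t) = 1) \<longleftrightarrow>
      (AE \<gamma> in character_haar. cmod (F \<gamma>) = 1)"
    if "AE \<gamma> in character_haar. AE t in lborel. boundary_value (twist ?a \<gamma>) t = F (flow t \<gamma>)"
  proof -
    have "AE \<gamma> in character_haar. (AE t in lborel. cmod (boundary_value (twist ?a \<gamma>) t) = 1) \<longleftrightarrow>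
        (AE t in lborel. cmod (F (flow t \<gamma>)) = 1)"
      using that
    proof eventually_elim
      case (elim \<gamma>)
      show ?case by (rule eventually_subst) (use elim in \<open>auto elim: eventually_mono\<close>)
    qed
    hence "(AE \<gamma> in character_haar. AE t in lborel. cmod (boundary_value (twist ?a \<gamma>) t) = 1) \<longleftrightarrow>
        (AE \<gamma> in character_haar. AE t in lborel. cmod (F (flow t \<gamma>)) = 1)"
      by (rule eventually_subst)
    thus ?thesis by (simp only: flow)
  qed
  show ?thesis
    unfolding orth
  proof
    assume ae: "AE \<gamma> in character_haar. cmod (F \<gamma>) = 1"
    hence "AE \<gamma> in character_haar. cmod (F \<gamma>) \<le> 1" by eventually_elim simp
    note b = boundary_values_if_bounded[OF this]
    show "?a \<in> H_infinity \<and> (AE \<gamma> in character_haar. AE t in lborel. cmod (boundary_value (twist ?a \<gamma>) t) = 1)"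
      using b(1) boundary[OF b(2)] ae by simp
  next
    assume H: "?a \<in> H_infinity \<and> (AE \<gamma> in character_haar. AE t in lborel. cmod (boundary_value (twist ?a \<gamma>) t) = 1)"
    obtain M where "M \<ge> 0" "AE \<gamma> in character_haar. cmod (F \<gamma>) \<le> M"
      by (rule H_infinity_imp_bounded[OF sm]) (use H in auto)
    from boundary_values_if_bounded(2)[OF this(2,1)] show "AE \<gamma> in character_haar. cmod (F \<gamma>) = 1"
      using boundary H by blast
  qed
qed

end
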